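(* Let $G$ be a non-trivial finite group of order $n$, let $\Gamma=\mathcal G(\mathcal C(G))$ be the group generated by the Cayley machine of $G$, let $S=\{\mathcal C(G)_g,\ \mathcal C(G)_g^{-1}\mid g\in G\}$, let $P$ be a parabolic subgroup of $\Gamma$ and let $X=\mathrm{Sch}(\Gamma,P,S)$. Then $$\zeta_X(t)=(1-t^2)^{-(n-1)}\prod_{q=2}^{\infty}\left[\ \prod_{1\le p<q,\ (p,q)=1}\left(1-2nt\cos\frac pq\pi+(2n-1)t^2\right)^{-\frac{(n-1)^2}{n^q-1}}\right],$$ and this product converges for $|t|<\frac1{2n-1}$. Moreover, if $G$ is abelian, then $\zeta_X=\zeta_{G\,\mathrm{wr}\,\mathbb Z}$.
   Context: The Cayley machine $\mathcal C(G)$ is the Mealy automaton with state set and alphabet $G$ which, in state $g$ on input $a$, outputs $ga$ and moves to state $ga$. State $g$ computes the bijection $\mathcal C(G)_g(a_0,a_1,\dots,a_m)=(ga_0,ga_0a_1,\dots,ga_0a_1\cdots a_m)$ of words over $G$, extended by the same formula to right-infinite words $G^\omega$; $\Gamma=\mathcal G(\mathcal C(G))$ is the group generated by these maps, and $|S|=2n$. A parabolic subgroup is the stabilizer $P$ in $\Gamma$ of some $w\in G^\omega$; $P_k$ denotes the stabilizer of the length-$k$ prefix of $w$ (of index $n^k$). For $Q\le\Gamma$, the Schreier graph $\mathrm{Sch}(\Gamma,Q,S)$ has vertices the left cosets $\Gamma/Q$ and, for each $s\in S$, an edge from $gQ$ to $sgQ$; its Markov operator is $f\mapsto\big(gQ\mapsto\frac1{|S|}\sum_{s\in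 S}f(sgQ)\big)$ on $\ell^2(\Gamma/Q)$. For a finite $d$-regular graph $Y$ the Ihara zeta function is $\zeta_Y(t)=\prod_{[C]}(1-t^{|C|})^{-1}$ over equivalence classes of primitive cyclically reduced closed paths $C$, of length $|C|$; by Ihara's formula, $\zeta_Y(t)=(1-t^2)^{-\frac{d-2}{2}|V(Y)|}\det(1-tdM_Y+(d-1)t^2)^{-1}$ with $M_Y$ the Markov operator of $Y$. For $X_k=\mathrm{Sch}(\Gamma,P_k,S)$, the zeta function of $X$ is defined, with respect to the approximating sequence $\{X_k\}$ and with $d=2n$, by $\ln\zeta_X(t)=\lim_{k\to\infty}\frac1{|V(X_k)|}\ln\zeta_{X_k}(t)$. Equivalently, for $|t|<\frac1{d-1}$, $$\ln\zeta_X(t)=-\tfrac{d-2}{2}\ln(1-t^2)-\int_{-1}^1\ln(1-td\lambda+(d-1)t^2)\,\mathrm d\mu(\lambda),$$ where $\mu$ is the weak limit of the measures $\mu_k=\sum_\lambda\frac{\#_k(\lambda)}{n^k}\delta_\lambda$ ($\lambda$ running over the eigenvalues of the Markov operator of $X_k$, with multiplicities $\#_k(\lambda)$). For $G$ abelian, $\Gamma$ is identified with the restricted wreath product $G\,\mathrm{wr}\,\mathbb Z=\left(\bigoplus_{\mathbb Z}G\right)\rtimes\mathbb Z$ (it is known that they are isomorphic), and $\zeta_{G\,\mathrm{wr}\,\mathbb Z}$ is the zeta function of this group with respect to the generators $S$: $\ln\zeta_\Gamma(t)=-\frac{d-2}{2}\ln(1-t^2)-\mathrm{tr}\,\ln(1-tdM+(d-1)t^2)$,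 where $d=2n$, $M$ is the Markov operator on $\ell^2(\Gamma)$ of the Cayley graph with respect to $S$, and $\mathrm{tr}(T)=\langle T\delta_1,\delta_1\rangle$ with $\delta_1$ the characteristic function of the identity. *)

theory Defs
  imports
    "HOL-Analysis.Analysis"
    "HOL-Algebra.Bij"
    "HOL-Algebra.Group_Action"
    "HOL-Algebra.Left_Coset"
    "HOL-Algebra.Product_Groups"
    "Graph_Theory.Arc_Walk"
begin

section \<open>Mealy automata and Cayley machines\<close>

record ('q, 'a) mealy =
  states :: "'q set"
  alphabet :: "'a set"
  next_state :: "'q \<Rightarrow> 'a \<Rightarrow> 'q"
  out_letter :: "'q \<Rightarrow> 'a \<Rightarrow> 'a"

definition infinite_words :: "'a set \<Rightarrow> (nat \<Rightarrow> 'a) set" where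
  "infinite_words A = (UNIV \<rightarrow> A)"

text \<open>The state reached from \<open>q\<close> after reading the first \<open>i\<close> letters of \<open>w\<close>.\<close>

primrec mealy_run :: "('q, 'a) mealy \<Rightarrow> 'q \<Rightarrow> (nat \<Rightarrow> 'a) \<Rightarrow> nat \<Rightarrow> 'q" where
  "mealy_run A q w 0 = q"
| "mealy_run A q w (Suc i) = next_state A (mealy_run A q w i) (w i)"

text \<open>Restricted to infinite words over the alphabet, because \<^const>\<open>BijGroup\<close> consists of
  extensional functions.\<close>

definition mealy_map :: "('q, 'a) mealy \<Rightarrow> 'q \<Rightarrow> (nat \<Rightarrow> 'a) \<Rightarrow> (nat \<Rightarrow> 'a)" where
  "mealy_map A q = (\<lambda>w \<in> infinite_words (alphabet A). \<lambda>i. out_letter A (mealy_run A q w i) (w i))"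

text \<open>For an invertible automaton every state induces a bijection, so that the intersection with
  the carrier built into \<^const>\<open>subgroup_generated\<close> is harmless. The product in
  \<^const>\<open>BijGroup\<close> is composition of maps, i.e. the group acts on the left.\<close>

definition automaton_group :: "('q, 'a) mealy \<Rightarrow> ((nat \<Rightarrow> 'a) \<Rightarrow> (nat \<Rightarrow> 'a)) monoid" where
  "automaton_group A =
     subgroup_generated (BijGroup (infinite_words (alphabet A))) (mealy_map A ` states A)"

definition cayley_machine :: "('a, 'm) monoid_scheme \<Rightarrow> ('a, 'a) mealy" where
  "cayley_machine G =
     \<lparr>states = carrier G, alphabet = carrier G,
      next_state = (\<lambda>g a. g \<otimes>\<^bsub>G\<^esub> a), out_letter = (\<lambda>g a. g \<otimes>\<^bsub>G\<^esub> a)\<rparr>"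

definition symmetric_generators :: "('q, 'a) mealy \<Rightarrow> ((nat \<Rightarrow> 'a) \<Rightarrow> (nat \<Rightarrow> 'a)) set" where
  "symmetric_generators A =
     mealy_map A ` states A \<union> (\<lambda>q. inv\<^bsub>automaton_group A\<^esub> (mealy_map A q)) ` states A"

definition parabolic_subgroup ::
    "((nat \<Rightarrow> 'a) \<Rightarrow> (nat \<Rightarrow> 'a), 'm) monoid_scheme \<Rightarrow> (nat \<Rightarrow> 'a) \<Rightarrow> ((nat \<Rightarrow> 'a) \<Rightarrow> (nat \<Rightarrow> 'a)) set" where
  "parabolic_subgroup \<Gamma> w = stabilizer \<Gamma> (\<lambda>\<gamma>. \<gamma>) w"

text \<open>The stabilizer of the prefix of length \<open>k\<close> of \<open>w\<close>. Mealy maps preserve common prefixes,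
  hence an element of the automaton group maps the prefix of length \<open>k\<close> of \<open>w\<close> to the prefix of
  length \<open>k\<close> of the image of \<open>w\<close>.\<close>

definition prefix_stabilizer ::
    "((nat \<Rightarrow> 'a) \<Rightarrow> (nat \<Rightarrow> 'a), 'm) monoid_scheme \<Rightarrow> (nat \<Rightarrow> 'a) \<Rightarrow> nat \<Rightarrow> ((nat \<Rightarrow> 'a) \<Rightarrow> (nat \<Rightarrow> 'a)) set" where
  "prefix_stabilizer \<Gamma> w k = {\<gamma> \<in> carrier \<Gamma>. \<forall>i<k. \<gamma> w i = w i}"

section \<open>Ihara zeta functions of finite graphs\<close>

text \<open>A graph is given by its oriented edges, as a \<^typ>\<open>('v, 'e) pre_digraph\<close>, together with the
  map \<open>\<iota>\<close> that reverses the orientation of an edge. Paths are lists of oriented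
  edges (\<^const>\<open>pre_digraph.awalk\<close>).\<close>

definition cyclically_reduced :: "('e \<Rightarrow> 'e) \<Rightarrow> 'e list \<Rightarrow> bool" where
  "cyclically_reduced \<iota> p \<longleftrightarrow> (\<forall>i<length p. p ! (Suc i mod length p) \<noteq> \<iota> (p ! i))"

definition primitive_path :: "'e list \<Rightarrow> bool" where
  "primitive_path p \<longleftrightarrow> (\<forall>q m. p = concat (replicate m q) \<longrightarrow> m = 1)"

text \<open>Closed paths are equivalent if they differ by the choice of the initial vertex; a closed
  path and its reverse are not identified.\<close>

definition cyclic_class :: "'e list \<Rightarrow> 'e list set" where
  "cyclic_class p = range (\<lambda>m. rotate m p)"

definition prime_cycles :: "('v, 'e) pre_digraph \<Rightarrow> ('e \<Rightarrow> 'e) \<Rightarrow> 'e list set set" where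
  "prime_cycles Y \<iota> =
     cyclic_class ` {p. p \<noteq> [] \<and> (\<exists>u. pre_digraph.awalk Y u p u) \<and> cyclically_reduced \<iota> p \<and> primitive_path p}"

definition cycle_length :: "'e list set \<Rightarrow> nat" where
  "cycle_length C = the_elem (length ` C)"

text \<open>\<open>has_ln_ihara_zeta Y \<iota> t l\<close>: the Euler product
  \<open>\<Prod>[C]. (1 - t^|C|)^(-1)\<close> converges absolutely at \<open>t\<close>, \<open>|t| < 1\<close>, and \<open>l\<close> is the logarithm
  of its value obtained by summing the principal logarithms of the factors. This is the branch
  that is analytic in \<open>t\<close> and vanishes at \<open>t = 0\<close>; it need not be the principal logarithm of
  the product.\<close>

definition has_ln_ihara_zeta ::
    "('v, 'e) pre_digraph \<Rightarrow> ('e \<Rightarrow> 'e) \<Rightarrow> complex \<Rightarrow> complex \<Rightarrow> bool" where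
  "has_ln_ihara_zeta Y \<iota> t l \<longleftrightarrow>
     ((\<lambda>C. - Ln (1 - t ^ cycle_length C)) has_sum l) (prime_cycles Y \<iota>)"

section \<open>Schreier graphs and their zeta functions\<close>

text \<open>The generating set \<open>S\<close> is closed under inverses. The edge labelled \<open>s\<close> from \<open>V\<close> to \<open>sV\<close>
  and the edge labelled by the inverse of \<open>s\<close> from \<open>sV\<close> to \<open>V\<close> are the two orientations of one
  geometric edge, so the graph is regular of degree \<open>|S|\<close>.\<close>

definition schreier_graph ::
    "('a, 'm) monoid_scheme \<Rightarrow> 'a set \<Rightarrow> 'a set \<Rightarrow> ('a set, 'a set \<times> 'a) pre_digraph" where
  "schreier_graph \<Gamma> Q S =
     \<lparr>verts = lcosets\<^bsub>\<Gamma>\<^esub> Q, arcs = (lcosets\<^bsub>\<Gamma>\<^esub> Q) \<times> S,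
      tail = fst, head = (\<lambda>(V, s). s <#\<^bsub>\<Gamma>\<^esub> V)\<rparr>"

definition schreier_rev :: "('a, 'm) monoid_scheme \<Rightarrow> 'a set \<times> 'a \<Rightarrow> 'a set \<times> 'a" where
  "schreier_rev \<Gamma> = (\<lambda>(V, s). (s <#\<^bsub>\<Gamma>\<^esub> V, inv\<^bsub>\<Gamma>\<^esub> s))"

text \<open>\<open>has_schreier_zeta \<Gamma> S P Q t z\<close>: the zeta function of \<open>Sch(\<Gamma>, P, S)\<close>, with respect to the
  sequence of finite graphs \<open>X k = Sch(\<Gamma>, Q k, S)\<close>, is defined at \<open>t\<close> and has the value \<open>z\<close> there.
  The first condition says that the sequence is approximating: subgroups converge pointwise iff
  the corresponding rooted Schreier graphs converge on balls.\<close>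

definition has_schreier_zeta ::
    "('a, 'm) monoid_scheme \<Rightarrow> 'a set \<Rightarrow> 'a set \<Rightarrow> (nat \<Rightarrow> 'a set) \<Rightarrow> complex \<Rightarrow> complex \<Rightarrow> bool" where
  "has_schreier_zeta \<Gamma> S P Q t z \<longleftrightarrow>
     (\<forall>\<gamma>\<in>carrier \<Gamma>. \<forall>\<^sub>F k in sequentially. \<gamma> \<in> Q k \<longleftrightarrow> \<gamma> \<in> P) \<and>
     (\<forall>k. finite (verts (schreier_graph \<Gamma> (Q k) S))) \<and>
     (\<exists>l L. (\<forall>k. has_ln_ihara_zeta (schreier_graph \<Gamma> (Q k) S) (schreier_rev \<Gamma>) t (l k)) \<and>
            (\<lambda>k. l k / of_nat (card (verts (schreier_graph \<Gamma> (Q k) S)))) \<longlonglongrightarrow> L \<and>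
            z = exp L)"

section \<open>The zeta function of a group\<close>

text \<open>Vectors of \<open>\<ell>\<^sup>2(H)\<close> are represented by functions on the whole type; only their values on the
  carrier matter.\<close>

definition ell2 :: "('a, 'm) monoid_scheme \<Rightarrow> ('a \<Rightarrow> complex) set" where
  "ell2 H = {x. (\<lambda>g. (cmod (x g))\<^sup>2) summable_on carrier H}"

definition ell2_norm :: "('a, 'm) monoid_scheme \<Rightarrow> ('a \<Rightarrow> complex) \<Rightarrow> real" where
  "ell2_norm H x = sqrt (\<Sum>\<^sub>\<infinity>g\<in>carrier H. (cmod (x g))\<^sup>2)"

definition ell2_inner :: "('a, 'm) monoid_scheme \<Rightarrow> ('a \<Rightarrow> complex) \<Rightarrow> ('a \<Rightarrow> complex) \<Rightarrow> complex" where
  "ell2_inner H x y = (\<Sum>\<^sub>\<infinity>g\<in>carrier H. x g * cnj (y g))"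

definition markov_operator ::
    "('a, 'm) monoid_scheme \<Rightarrow> 'a set \<Rightarrow> ('a \<Rightarrow> complex) \<Rightarrow> ('a \<Rightarrow> complex)" where
  "markov_operator H S f = (\<lambda>g. (\<Sum>s\<in>S. f (s \<otimes>\<^bsub>H\<^esub> g)) / of_nat (card S))"

definition poly_op :: "complex poly \<Rightarrow> (('a \<Rightarrow> complex) \<Rightarrow> ('a \<Rightarrow> complex)) \<Rightarrow> ('a \<Rightarrow> complex) \<Rightarrow> ('a \<Rightarrow> complex)" where
  "poly_op p T x = (\<lambda>g. \<Sum>i\<le>degree p. poly.coeff p i * (T ^^ i) x g)"

text \<open>The continuous functional calculus \<open>L = f(T)\<close> for a self-adjoint operator \<open>T\<close> on \<open>\<ell>\<^sup>2(H)\<close> with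
  spectrum contained in \<open>[-1, 1]\<close>, for \<open>f\<close> continuous on \<open>[-1, 1]\<close>: \<open>L\<close> is the limit in operator
  norm of \<open>p\<^sub>j(T)\<close> for polynomials \<open>p\<^sub>j\<close> converging uniformly to \<open>f\<close> on \<open>[-1, 1]\<close>. By the spectral
  theorem the limit does not depend on the choice of the polynomials.\<close>

definition is_functional_calculus ::
    "('a, 'm) monoid_scheme \<Rightarrow> (('a \<Rightarrow> complex) \<Rightarrow> ('a \<Rightarrow> complex)) \<Rightarrow> (real \<Rightarrow> complex) \<Rightarrow>
     (('a \<Rightarrow> complex) \<Rightarrow> ('a \<Rightarrow> complex)) \<Rightarrow> bool" where
  "is_functional_calculus H T f L \<longleftrightarrow>
     (\<forall>x\<in>ell2 H. L x \<in> ell2 H) \<and>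
     (\<exists>p. uniform_limit {-1..1} (\<lambda>j x. poly (p j) (complex_of_real x)) f sequentially \<and>
          (\<forall>\<epsilon>>0. \<forall>\<^sub>F j in sequentially. \<forall>x\<in>ell2 H.
             ell2_norm H (\<lambda>g. poly_op (p j) T x g - L x g) \<le> \<epsilon> * ell2_norm H x))"

definition vn_trace :: "('a, 'm) monoid_scheme \<Rightarrow> (('a \<Rightarrow> complex) \<Rightarrow> ('a \<Rightarrow> complex)) \<Rightarrow> complex" where
  "vn_trace H T = ell2_inner H (T (indicator {\<one>\<^bsub>H\<^esub>})) (indicator {\<one>\<^bsub>H\<^esub>})"

text \<open>\<open>has_group_zeta H S t z\<close>: \<open>z\<close> is the value at \<open>t\<close> of the zeta function of the group \<open>H\<close> with
  respect to the symmetric generating set \<open>S\<close>. For \<open>d = |S|\<close> and \<open>|t| < 1/(d - 1)\<close> the numbers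
  \<open>1 - td\<lambda> + (d - 1)t\<^sup>2\<close>, \<open>\<lambda> \<in> [-1, 1]\<close>, avoid the branch cut of \<^const>\<open>Ln\<close>: such a number is a
  product of two factors \<open>1 - \<alpha>t\<close> with \<open>|\<alpha>| \<le> d - 1\<close>.\<close>

definition has_group_zeta :: "('a, 'm) monoid_scheme \<Rightarrow> 'a set \<Rightarrow> complex \<Rightarrow> complex \<Rightarrow> bool" where
  "has_group_zeta H S t z \<longleftrightarrow>
     (\<exists>L. is_functional_calculus H (markov_operator H S)
            (\<lambda>x. Ln (1 - t * of_nat (card S) * of_real x + (of_nat (card S) - 1) * t\<^sup>2)) L \<and>
          z = exp (- ((of_nat (card S) - 2) / 2) * Ln (1 - t\<^sup>2) - vn_trace H L))"

section \<open>The restricted wreath product with the integers\<close>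

definition wreath_int :: "('a, 'm) monoid_scheme \<Rightarrow> ((int \<Rightarrow> 'a) \<times> int) monoid" where
  "wreath_int G =
     \<lparr>carrier = carrier (sum_group (UNIV :: int set) (\<lambda>_. G)) \<times> UNIV,
      mult = (\<lambda>(f, a) (h, b). (f \<otimes>\<^bsub>sum_group UNIV (\<lambda>_. G)\<^esub> (\<lambda>i. h (i - a)), a + b)),
      one = (\<one>\<^bsub>sum_group UNIV (\<lambda>_. G)\<^esub>, 0)\<rparr>"

end

theory Submission
  imports
    Defs
    "HOL-Computational_Algebra.Polynomial"
    "HOL-Algebra.FiniteProduct"
begin

text \<open>Every element of \<open>\<Gamma>\<close> acts on \<open>G\<^sup>\<omega>\<close> by words in the generators, and \<open>X k\<close> is the orbital graph of
  the words of length \<open>k\<close>. So the closed cyclically reduced paths of \<open>X k\<close> are counted by the fixed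
  points of cyclically reduced words, and by a recursion for Chebyshev-like polynomials by the
  closed walks of the graph, that is by the moments of the spectral measure.

  The sum of all generators \<open>C(G)\<^sub>g\<close> is \<open>n\<close> times the composition of \<open>T = C(G)\<^sub>1\<close> with the averaging
  over the first letter. A product of \<open>j\<close> such sums and their adjoints, with prescribed signs, is a walk on
  the integers, and it collapses to a shift composed with the averaging over the first \<open>w\<close> letters,
  where \<open>w\<close> is the width of the walk. In the limit \<open>k \<rightarrow> \<infinity>\<close> its normalized trace is \<open>n\<^sup>j n\<^sup>-\<^sup>w\<close> for a closed
  walk and \<open>0\<close> otherwise. A closed walk of width \<open>w\<close> fits into the path graph with \<open>Q - 1\<close> vertices in \<open>Q - 1 - w\<close>
  ways, and \<open>\<Sum>Q. (n - 1)\<^sup>2 n\<^sup>-\<^sup>Q max 0 (Q - 1 - w) = n\<^sup>-\<^sup>w\<close>. Hence the limit measure is the mixture, with weights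
  \<open>(n - 1)\<^sup>2 n\<^sup>-\<^sup>Q\<close>, of the eigenvalues \<open>cos (p \<pi> / Q)\<close>, \<open>0 < p < Q\<close>, of path graphs; reducing the fractions \<open>p / Q\<close> turns
  the weights into \<open>\<Sum>r. (n - 1)\<^sup>2 n\<^sup>-\<^sup>q\<^sup>r = (n - 1)\<^sup>2 / (n\<^sup>q - 1)\<close>.

  If \<open>G\<close> is abelian, the maps of \<open>\<Gamma>\<close> are affine: they are powers of the automorphism \<open>T\<close> of \<open>G\<^sup>\<omega>\<close> followed by
  translations. This gives the wreath product, and a nontrivial affine map fixes a vanishing proportion of the words of
  length \<open>k\<close>. So the moments above are also the moments of the Markov operator of the group at
  the identity. The functional calculus of the logarithm is given by a series of reduced words
  that converges absolutely in operator norm for \<open>|t| < 1 / (d - 1)\<close>.\<close>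

section \<open>Euler products over primitive cycles\<close>

text \<open>The zeta function of a finite graph is an Euler product here, so Ihara's formula enters
  through its combinatorial content. Sorting closed cyclically reduced paths by primitive root and
  cyclic class turns the product into the series of N_m t^m / m. Here N_m is the trace, at the
  adjacency operator, of the m-th power sum of the inverse roots of 1 - x t + (d - 1) t^2, plus d -
  2 per vertex at even m, the source of the factor in 1 - t^2. This trace is linear in the numbers
  of fixed points of words, so no eigenvalue of \<open>X k\<close> is computed; only path graphs are
  diagonalized. There are d (d - 1)^(m - 1) reduced words of length m; per vertex this bounds N_m
  uniformly in k and gives both the exchange of limit and series and the radius 1 / (d - 1). It also
  settles the group side, where an absolute estimate over all d^m words would only reach a smaller
  disc. Logarithms are those given by the series, so the branch of \<open>Ln\<close> has to be
  checked only for the two linear factors of the quadratic.\<close>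

lemma concat_replicate_commute:
  "concat (replicate m x) @ x = x @ concat (replicate m x)"
  by (induction m) auto

lemma concat_replicate_mult:
  "concat (replicate m (concat (replicate k r))) = concat (replicate (m * k) r)"
  by (induction m) (auto simp: replicate_add)

lemma length_concat_replicate [simp]: "length (concat (replicate m x)) = m * length x"
  by (induction m) auto

text \<open>If z is a power of both u and v, then z z begins with u v and, by symmetry, with v u;
  both are the prefix of z z of length |u| + |v|.\<close>

lemma append_commute_of_powers:
  assumes eq: "concat (replicate m x) = concat (replicate n y)" and "m \<ge> 1" "n \<ge> 1"
  shows "x @ y = y @ x"
proof -
  let ?z = "concat (replicate m x)"
  have pre: "u @ v = take (length u + length v) (z @ z)"
    if z: "z = concat (replicate (Suc k) u)" "z = concat (replicate (Suc l) v)" for u v z :: "'a list" and k l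
  proof -
    let ?K = "concat (replicate k u)" and ?L = "concat (replicate l v)"
    have "z @ z = z @ u @ ?K" by (subst (2) z(1)) simp
    also have "\<dots> = (u @ z) @ ?K"
      using concat_replicate_commute[of "Suc k" u] unfolding z(1)[symmetric] by simp
    also have "\<dots> = (u @ v) @ (?L @ ?K)" by (subst z(2)) simp
    finally show ?thesis by (metis append_eq_conv_conj length_append)
  qed
  obtain m' n' where "m = Suc m'" "n = Suc n'" using assms by (metis Suc_le_D One_nat_def)
  then show ?thesis
    using pre[of "concat (replicate m x)" m' x n' y] pre[of "concat (replicate m x)" n' y m' x] eq
    by (metis add.commute)
qed

lemma primitive_not_Nil: "primitive_path p \<Longrightarrow> p \<noteq> []"
  unfolding primitive_path_def by (metis concat.simps(1) replicate_0 zero_neq_one)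

text \<open>Two words with a common power commute, and commuting words are powers of a single word;
  primitivity forces both exponents to be 1.\<close>

lemma primitive_root_unique:
  assumes "primitive_path x" "primitive_path y" "concat (replicate m x) = concat (replicate n y)" "m \<ge> 1" "n \<ge> 1"
  shows "x = y \<and> m = n"
proof -
  have "x @ y = y @ x" using append_commute_of_powers assms by blast
  then obtain a b zs where "concat (replicate a zs) = x" "concat (replicate b zs) = y"
    using comm_append_are_replicate by metis
  then have "x = y" using assms(1,2) unfolding primitive_path_def
    by (metis)
  moreover have "m * length x = n * length y" using assms(3) by (metis length_concat_replicate)
  ultimately show ?thesis using primitive_not_Nil[OF assms(1)] by simp
qed

lemma primitive_root_exists:
  "p \<noteq> [] \<Longrightarrow> \<exists>q m. m \<ge> 1 \<and> primitive_path q \<and> p = concat (replicate m q)"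
proof (induction "length p" arbitrary: p rule: less_induct)
  case less
  show ?case
  proof (cases "primitive_path p")
    case True
    then show ?thesis by (intro exI[of _ p] exI[of _ 1]) simp
  next
    case False
    then obtain q m where q: "p = concat (replicate m q)" "m \<noteq> 1" unfolding primitive_path_def by auto
    have "m \<noteq> 0" "q \<noteq> []" using q less.prems by (auto simp: concat_eq_Nil_conv)
    then have "m \<ge> 2" using q by simp
    have "length q < length p" using \<open>m \<ge> 2\<close> \<open>q \<noteq> []\<close> q(1) by simp
    then obtain r k where "k \<ge> 1" "primitive_path r" "q = concat (replicate k r)"
      using less.hyps \<open>q \<noteq> []\<close> by blast
    then show ?thesis using q \<open>m \<ge> 2\<close>
      by (intro exI[of _ r] exI[of _ "m * k"]) (simp add: concat_replicate_mult)
  qed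
qed

lemma rotate_concat_replicate:
  "rotate j (concat (replicate m r)) = concat (replicate m (rotate j r))"
proof (induction j)
  case (Suc j)
  have "rotate1 (concat (replicate m s)) = concat (replicate m (rotate1 s))" for s :: "'a list"
  proof (cases s)
    case (Cons a u)
    have *: "concat (replicate m (a # u)) @ [a] = a # concat (replicate m (u @ [a]))" for m
      by (induction m) auto
    show ?thesis
    proof (cases m)
      case (Suc k)
      then show ?thesis using *[of k] Cons by simp
    qed simp
  qed simp
  then show ?case using Suc by (simp add: rotate_def)
qed simp

lemma primitive_rotate:
  assumes "primitive_path p" shows "primitive_path (rotate j p)"
  unfolding primitive_path_def
proof (intro allI impI)
  fix q m assume eq: "rotate j p = concat (replicate m q)"
  let ?i = "length p - j mod length p"
  have "(?i + j) mod length p = 0"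
    using primitive_not_Nil[OF assms] by (metis add.commute le_add_diff_inverse length_greater_0_conv less_imp_le_nat mod_add_left_eq mod_less_divisor mod_self)
  then have "rotate ?i (rotate j p) = p" by (simp add: rotate_rotate rotate_id)
  then have "p = concat (replicate m (rotate ?i q))" using eq rotate_concat_replicate by metis
  then show "m = 1" using assms unfolding primitive_path_def by blast
qed

text \<open>A rotation by i that fixes p makes the prefix of length i commute with the remaining
  suffix. Both are then powers of one word with exponents adding up to 1 by primitivity, so one of
  the two pieces would be empty.\<close>

lemma rotate_primitive_ne:
  assumes "primitive_path p" "0 < i" "i < length p" shows "rotate i p \<noteq> p"
proof
  assume "rotate i p = p"
  then have "drop i p @ take i p = take i p @ drop i p"
    using assms by (simp add: rotate_drop_take)
  then obtain a b zs where ab: "concat (replicate a zs) = drop i p" "concat (replicate b zs) = take i p"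
    using comm_append_are_replicate by metis
  then have "p = concat (replicate (b + a) zs)" by (simp add: replicate_add)
  then have "b + a = 1" using assms(1) unfolding primitive_path_def by blast
  then have "a = 0 \<or> b = 0" by auto
  then show False using ab assms by auto
qed

lemma cyclic_class_eq_image: "p \<noteq> [] \<Longrightarrow> cyclic_class p = (\<lambda>m. rotate m p) ` {..<length p}"
  unfolding cyclic_class_def
  by (auto simp: image_iff) (metis length_greater_0_conv lessThan_iff mod_less_divisor rotate_conv_mod)

lemma card_cyclic_class:
  assumes "primitive_path p" shows "card (cyclic_class p) = length p"
proof -
  have ne: "p \<noteq> []" using primitive_not_Nil assms by auto
  have *: False if "i < j" "j < length p" "rotate i p = rotate j p" for i j
  proof -
    have "rotate (length p - i) (rotate i p) = p"
      using that(1,2) by (simp only: rotate_rotate) simp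
    moreover have "rotate (length p - i) (rotate j p) = rotate (j - i) p"
    proof -
      have "length p - i + j = length p + (j - i)" using that by simp
      then have "rotate (length p - i) (rotate j p) = rotate (length p + (j - i)) p"
        by (simp only: rotate_rotate)
      also have "\<dots> = rotate (j - i) p"
        using rotate_conv_mod[of "length p + (j - i)" p] rotate_conv_mod[of "j - i" p] by simp
      finally show ?thesis .
    qed
    ultimately have "rotate (j - i) p = p" using that by simp
    then show False using rotate_primitive_ne[OF assms, of "j - i"] that by simp
  qed
  have "inj_on (\<lambda>m. rotate m p) {..<length p}"
    by (rule inj_onI) (metis * lessThan_iff linorder_neqE_nat)
  then show ?thesis by (simp add: cyclic_class_eq_image[OF ne] card_image)
qed

lemma cyclic_class_eqI: "q \<in> cyclic_class p \<Longrightarrow> cyclic_class q = cyclic_class p"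
proof -
  assume "q \<in> cyclic_class p"
  then obtain j where q: "q = rotate j p" by (auto simp: cyclic_class_def)
  show ?thesis
  proof (cases "p = []")
    case False
    let ?i = "length p - j mod length p"
    have "(?i + j) mod length p = 0"
      using False by (metis add.commute le_add_diff_inverse length_greater_0_conv less_imp_le_nat mod_add_left_eq mod_less_divisor mod_self)
    then have p: "rotate ?i q = p" by (simp add: q rotate_rotate rotate_id)
    show ?thesis
      unfolding cyclic_class_def
      by (auto simp: image_iff) (metis q rotate_rotate, metis p rotate_rotate)
  qed (simp add: q cyclic_class_def)
qed

lemma cycle_length_cyclic_class [simp]: "cycle_length (cyclic_class p) = length p"
proof -
  have "length ` cyclic_class p = {length p}" by (simp add: cyclic_class_def image_image)
  then show ?thesis by (simp add: cycle_length_def)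
qed

section \<open>The Euler product as a series over closed paths\<close>

lemma sums_Ln_series:
  fixes z :: complex
  assumes "norm z < 1"
  shows "(\<lambda>r. z ^ r / of_nat r) sums - Ln (1 - z)"
proof -
  have s: "(\<lambda>r. - ((-1) ^ Suc r / of_nat r * (- z) ^ r)) sums - Ln (1 + - z)"
    by (rule sums_minus, rule Ln_series) (use assms in simp)
  \<comment> \<open>At r = 0 both sides are quotients by \<open>of_nat 0\<close>, hence 0; the same
    convention removes the index 0 from the later series with t^m / m.\<close>
  have e: "- ((-1) ^ Suc r / of_nat r * (- z) ^ r) = z ^ r / of_nat r" for r
  proof -
    have "(-1) ^ r * (- z) ^ r = z ^ r" by (subst power_mult_distrib[symmetric]) simp
    then show ?thesis by (simp add: divide_inverse mult_ac)
  qed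
  show ?thesis using s by (simp only: e) simp
qed

lemma has_sum_Ln_series:
  fixes z :: complex
  assumes "norm z < 1"
  shows "((\<lambda>r. z ^ r / of_nat r) has_sum - Ln (1 - z)) {1..}"
proof -
  have "summable (\<lambda>r. norm (z ^ r / of_nat r))"
  proof (rule summable_comparison_test')
    show "summable (\<lambda>r. norm z ^ r)" using assms by (simp add: summable_geometric)
    show "norm (norm (z ^ r / of_nat r)) \<le> norm z ^ r" for r
      using divide_left_mono[of 1 "real r" "norm z ^ r"]
      by (cases "r = 0") (simp_all add: norm_divide norm_power)
  qed
  then have "((\<lambda>r. z ^ r / of_nat r) has_sum - Ln (1 - z)) UNIV"
    by (rule norm_summable_imp_has_sum) (rule sums_Ln_series[OF assms])
  then show ?thesis
    by (rule has_sum_cong_neutral[THEN iffD1, rotated -1]) (auto simp: not_less_eq_eq)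
qed

text \<open>P stands for the closed cyclically reduced paths, of which only stability under
  rotation, powers and roots matters. The absolutely convergent sum of t^|p| / |p| over P is
  arranged in two stages: the powers of a primitive q contribute - Ln (1 - t^|q|) / |q|, and the |q|
  rotations of q then add up to the term of its cyclic class.\<close>

theorem euler_product_has_sum:
  fixes t :: complex and P :: "'e list set"
  defines "N \<equiv> \<lambda>m. card {p \<in> P. length p = m}"
  assumes rot: "\<And>p j. p \<in> P \<Longrightarrow> rotate j p \<in> P"
    and pow: "\<And>p m. m \<ge> 1 \<Longrightarrow> p \<noteq> [] \<Longrightarrow> concat (replicate m p) \<in> P \<longleftrightarrow> p \<in> P"
    and Nil: "[] \<notin> P"
    and fin: "\<And>m. finite {p \<in> P. length p = m}"
    and sm: "summable (\<lambda>m. of_nat (N m) * norm t ^ m)" and t: "norm t < 1"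
  shows "((\<lambda>C. - Ln (1 - t ^ cycle_length C)) has_sum (\<Sum>m. of_nat (N m) * (t ^ m / of_nat m)))
           (cyclic_class ` {p \<in> P. primitive_path p})"
proof -
  define h where "h p = t ^ length p / of_nat (length p)" for p :: "'e list"
  let ?A = "\<lambda>m. {p \<in> P. length p = m}"
  have hsum: "(\<Sum>p\<in>?A m. h p) = of_nat (N m) * (t ^ m / of_nat m)" for m
    by (simp add: h_def N_def)
  have nsum: "(\<Sum>p\<in>?A m. norm (h p)) = of_nat (N m) * (norm t ^ m / of_nat m)" for m
    by (simp add: h_def N_def norm_divide norm_power)
  have abs: "(\<lambda>x. norm (case x of (m, p) \<Rightarrow> h p)) summable_on (Sigma UNIV ?A)"
    unfolding Infinite_Sum.abs_summable_on_Sigma_iff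
  proof (intro conjI ballI)
    show "(\<lambda>y. norm (case (x, y) of (m, p) \<Rightarrow> h p)) summable_on ?A x" for x
      by (rule summable_on_finite) (rule fin)
    have "summable (\<lambda>m. norm (of_nat (N m) * (norm t ^ m / of_nat m) :: real))"
    proof (rule summable_comparison_test'[OF sm, of 0])
      show "norm (norm (of_nat (N m) * (norm t ^ m / of_nat m) :: real)) \<le> real (N m) * norm t ^ m" for m
        using mult_left_mono[OF divide_left_mono[of 1 "real m" "norm t ^ m"], of "real (N m)"]
        by (cases "m = 0") simp_all
    qed
    then show "(\<lambda>x. norm (\<Sum>\<^sub>\<infinity>y\<in>?A x. norm (case (x, y) of (m, p) \<Rightarrow> h p))) summable_on UNIV"
      by (simp only: prod.case infsum_finite[OF fin] nsum) (rule norm_summable_imp_summable_on, simp)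
  qed
  define l where "l = infsum (\<lambda>(m, p). h p) (Sigma UNIV ?A)"
  have l: "((\<lambda>(m, p). h p) has_sum l) (Sigma UNIV ?A)"
    unfolding l_def by (rule has_sum_infsum) (rule abs_summable_summable[OF abs])
  have "((\<lambda>m. of_nat (N m) * (t ^ m / of_nat m)) has_sum l) UNIV"
  proof (rule has_sum_SigmaD[OF l])
    show "((\<lambda>y. case (m, y) of (m, p) \<Rightarrow> h p) has_sum of_nat (N m) * (t ^ m / of_nat m)) (?A m)" for m
      by (rule has_sum_finiteI[OF fin]) (simp only: prod.case hsum)
  qed
  then have lsum: "l = (\<Sum>m. of_nat (N m) * (t ^ m / of_nat m))"
    by (intro sums_unique has_sum_imp_sums)
  have "(h has_sum l) P \<longleftrightarrow> ((\<lambda>(m, p). h p) has_sum l) (Sigma UNIV ?A)"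
    by (rule has_sum_reindex_bij_witness[of _ snd "\<lambda>p. (length p, p)"]) auto
  then have hP: "(h has_sum l) P" using l by simp
  let ?Q = "{p \<in> P. primitive_path p}"
  \<comment> \<open>Unique factorization: each path of P is a power, with exponent at least 1, of a
    unique primitive path, which lies in P by \<open>pow\<close>.\<close>
  have bij: "bij_betw (\<lambda>(q, r). concat (replicate r q)) (?Q \<times> {1..}) P"
    unfolding bij_betw_def
  proof
    show "inj_on (\<lambda>(q, r). concat (replicate r q)) (?Q \<times> {1..})"
      using primitive_root_unique by (auto simp: inj_on_def)
    show "(\<lambda>(q, r). concat (replicate r q)) ` (?Q \<times> {1..}) = P"
    proof (intro equalityI subsetI)
      fix p assume "p \<in> (\<lambda>(q, r). concat (replicate r q)) ` (?Q \<times> {1..})"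
      then show "p \<in> P" using pow Nil primitive_not_Nil by auto
    next
      fix p assume p: "p \<in> P"
      then have "p \<noteq> []" using Nil by auto
      then obtain q m where "m \<ge> 1" "primitive_path q" "p = concat (replicate m q)"
        using primitive_root_exists by blast
      moreover from this have "q \<in> P" using pow[of m q] primitive_not_Nil p by blast
      ultimately show "p \<in> (\<lambda>(q, r). concat (replicate r q)) ` (?Q \<times> {1..})"
        by (force simp: image_iff)
    qed
  qed
  have "((\<lambda>x. h ((\<lambda>(q, r). concat (replicate r q)) x)) has_sum l) (?Q \<times> {1..})"
    using has_sum_reindex_bij_betw[OF bij] hP by blast
  then have hQ: "((\<lambda>(q, r). h (concat (replicate r q))) has_sum l) (Sigma ?Q (\<lambda>_. {1..}))"
    by (simp add: case_prod_unfold)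
  have "((\<lambda>q. - Ln (1 - t ^ length q) / of_nat (length q)) has_sum l) ?Q"
  proof (rule has_sum_SigmaD[OF hQ])
    fix q assume q: "q \<in> ?Q"
    then have ne: "q \<noteq> []" using Nil by auto
    then have "norm (t ^ length q) < 1" using t by (simp add: norm_power power_less_one_iff)
    from has_sum_cmult_left[OF has_sum_Ln_series[OF this], of "inverse (of_nat (length q))"]
    have "((\<lambda>r. (t ^ length q) ^ r / of_nat r * inverse (of_nat (length q))) has_sum
        (- Ln (1 - t ^ length q) / of_nat (length q))) {1..}"
      by (simp only: divide_inverse)
    then show "((\<lambda>r. case (q, r) of (q, r) \<Rightarrow> h (concat (replicate r q))) has_sum
        (- Ln (1 - t ^ length q) / of_nat (length q))) {1..}"
      by (rule has_sum_cong[THEN iffD1, rotated]) (simp add: h_def divide_inverse mult_ac flip: power_mult)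
  qed
  moreover have "((\<lambda>q. - Ln (1 - t ^ length q) / of_nat (length q)) has_sum l) ?Q \<longleftrightarrow>
      ((\<lambda>(C, q). - Ln (1 - t ^ length q) / of_nat (length q)) has_sum l) (Sigma (cyclic_class ` ?Q) (\<lambda>C. C))"
  proof (rule has_sum_reindex_bij_witness[of _ snd "\<lambda>q. (cyclic_class q, q)"], goal_cases)
    case (2 a)
    have "rotate 0 a = a" by simp
    then have "a \<in> cyclic_class a" unfolding cyclic_class_def by (metis rangeI)
    then show ?case using 2 by auto
  next
    case (3 b)
    then obtain p q where "b = (cyclic_class p, q)" "q \<in> cyclic_class p" by auto
    then show ?case using cyclic_class_eqI[of q p] by simp
  next
    case (4 b)
    then obtain p q where b: "b = (cyclic_class p, q)" "q \<in> cyclic_class p" and p: "p \<in> P" "primitive_path p" by auto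
    then obtain j where "q = rotate j p" by (auto simp: cyclic_class_def)
    then show ?case using b rot[OF p(1)] primitive_rotate[OF p(2)] by simp
  qed simp_all
  ultimately have hC: "((\<lambda>(C, q). - Ln (1 - t ^ length q) / of_nat (length q)) has_sum l) (Sigma (cyclic_class ` ?Q) (\<lambda>C. C))"
    by blast
  have "((\<lambda>C. - Ln (1 - t ^ cycle_length C)) has_sum l) (cyclic_class ` ?Q)"
  proof (rule has_sum_SigmaD[OF hC])
    fix C assume "C \<in> cyclic_class ` ?Q"
    then obtain p where p: "p \<in> P" "primitive_path p" "C = cyclic_class p" by auto
    have ne: "p \<noteq> []" using p Nil by auto
    have "finite C" using p ne by (simp add: cyclic_class_eq_image)
    moreover have len: "length q = length p" if "q \<in> C" for q using that p by (auto simp: cyclic_class_def)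
    have "(\<Sum>q\<in>C. - Ln (1 - t ^ length q) / of_nat (length q)) =
        (\<Sum>q\<in>C. - Ln (1 - t ^ length p) / of_nat (length p))"
      by (rule sum.cong) (simp_all only: len)
    then have "(\<Sum>q\<in>C. - Ln (1 - t ^ length q) / of_nat (length q)) = - Ln (1 - t ^ cycle_length C)"
      using card_cyclic_class[OF p(2)] ne by (simp add: p(3))
    ultimately show "((\<lambda>q. case (C, q) of (C, q) \<Rightarrow> - Ln (1 - t ^ length q) / of_nat (length q)) has_sum
        - Ln (1 - t ^ cycle_length C)) C"
      by (intro has_sum_finiteI) simp_all
  qed
  then show ?thesis by (simp add: lsum)
qed

section \<open>Non-backtracking walks\<close>

text \<open>At the adjacency operator of a \<open>d\<close>-regular graph, \<open>nb_poly d m\<close> yields the non-backtracking walks of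
  length \<open>m\<close>, while \<open>ihara_poly d m\<close> is the \<open>m\<close>-th power sum of the inverse roots of \<open>1 - x t + (d - 1) t\<^sup>2\<close>.\<close>

fun nb_poly :: "nat \<Rightarrow> nat \<Rightarrow> complex poly" where
  "nb_poly d 0 = 1"
| "nb_poly d (Suc 0) = [:0, 1:]"
| "nb_poly d (Suc (Suc m)) =
    pCons 0 (nb_poly d (Suc m)) - smult (if m = 0 then of_nat d else of_nat d - 1) (nb_poly d m)"

fun ihara_poly :: "nat \<Rightarrow> nat \<Rightarrow> complex poly" where
  "ihara_poly d 0 = 2"
| "ihara_poly d (Suc 0) = [:0, 1:]"
| "ihara_poly d (Suc (Suc m)) = pCons 0 (ihara_poly d (Suc m)) - smult (of_nat d - 1) (ihara_poly d m)"

text \<open>The letters are formal generators with a fixed-point-free inversion, so that identities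
  between sums over words serve both the finite levels and the wreath product.\<close>

locale free_letters =
  fixes S :: "'s set" and iv :: "'s \<Rightarrow> 's" and d :: nat
  assumes finS: "finite S" and cardS: "card S = d"
    and iv_in: "s \<in> S \<Longrightarrow> iv s \<in> S"
    and iv_iv: "s \<in> S \<Longrightarrow> iv (iv s) = s"
    and iv_ne: "s \<in> S \<Longrightarrow> iv s \<noteq> s"
begin

definition words :: "nat \<Rightarrow> 's list set" where
  "words m = {W. set W \<subseteq> S \<and> length W = m}"

definition reduced :: "'s list \<Rightarrow> bool" where
  "reduced = successively (\<lambda>s s'. s' \<noteq> iv s)"

definition rwords :: "nat \<Rightarrow> 's list set" where
  "rwords m = {W \<in> words m. reduced W}"

definition cwords :: "nat \<Rightarrow> 's list set" where
  "cwords m = {W \<in> words m. reduced W \<and> (W = [] \<or> hd W \<noteq> iv (last W))}"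

text \<open>\<open>cancels\<close> means that \<Phi> descends from words to the free group in which
  \<open>iv s\<close> is the inverse of s; \<open>class_fun\<close> asks in addition that it be a
  class function there.\<close>

definition cancels :: "('s list \<Rightarrow> complex) \<Rightarrow> bool" where
  "cancels \<Phi> \<longleftrightarrow> (\<forall>u v s. set u \<subseteq> S \<longrightarrow> set v \<subseteq> S \<longrightarrow> s \<in> S \<longrightarrow> \<Phi> (u @ s # iv s # v) = \<Phi> (u @ v))"

definition class_fun :: "('s list \<Rightarrow> complex) \<Rightarrow> bool" where
  "class_fun \<Phi> \<longleftrightarrow> cancels \<Phi> \<and> (\<forall>u v. set u \<subseteq> S \<longrightarrow> set v \<subseteq> S \<longrightarrow> \<Phi> (u @ v) = \<Phi> (v @ u))"

definition wsum :: "('s list \<Rightarrow> complex) \<Rightarrow> nat \<Rightarrow> complex" where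
  "wsum \<Phi> m = sum \<Phi> (words m)"

definition rsum :: "('s list \<Rightarrow> complex) \<Rightarrow> nat \<Rightarrow> complex" where
  "rsum \<Phi> m = sum \<Phi> (rwords m)"

definition csum :: "('s list \<Rightarrow> complex) \<Rightarrow> nat \<Rightarrow> complex" where
  "csum \<Phi> m = sum \<Phi> (cwords m)"

text \<open>The linear extension of \<Phi> to the monoid ring of words, applied to the polynomial p
  of the adjacency element, the sum of all letters. The ring itself need not be constructed.\<close>

definition walk_eval :: "('s list \<Rightarrow> complex) \<Rightarrow> complex poly \<Rightarrow> complex" where
  "walk_eval \<Phi> p = (\<Sum>i\<le>degree p. coeff p i * wsum \<Phi> i)"

lemma words_0 [simp]: "words 0 = {[]}"
  by (auto simp: words_def)

lemma words_Suc: "words (Suc m) = (\<lambda>(s, W). s # W) ` (S \<times> words m)"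
  by (auto simp: words_def length_Suc_conv image_iff)

lemma finite_words [simp]: "finite (words m)"
  unfolding words_def by (rule finite_lists_length_eq[OF finS])

lemma finite_rwords [simp]: "finite (rwords m)" and finite_cwords [simp]: "finite (cwords m)"
  by (auto simp: rwords_def cwords_def)

lemma card_words: "card (words m) = d ^ m"
  unfolding words_def using card_lists_length_eq[OF finS] cardS by metis

lemma wsum_0 [simp]: "wsum \<Phi> 0 = \<Phi> []"
  by (simp add: wsum_def)

lemma wsum_Suc: "wsum \<Phi> (Suc m) = (\<Sum>s\<in>S. wsum (\<lambda>W. \<Phi> (s # W)) m)"
  unfolding wsum_def words_Suc
  by (subst sum.reindex) (auto simp: inj_on_def sum.cartesian_product case_prod_unfold)

lemma cancels_Cons: "cancels \<Phi> \<Longrightarrow> s \<in> S \<Longrightarrow> cancels (\<lambda>W. \<Phi> (s # W))"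
  unfolding cancels_def
proof (intro allI impI, goal_cases)
  case (1 u v s')
  then show ?case using 1(1)[rule_format, of "s # u" v s'] by simp
qed

lemma walk_eval_le: "degree p \<le> N \<Longrightarrow> walk_eval \<Phi> p = (\<Sum>i\<le>N. coeff p i * wsum \<Phi> i)"
  unfolding walk_eval_def by (rule sum.mono_neutral_left) (auto simp: coeff_eq_0)

lemma walk_eval_0 [simp]: "walk_eval \<Phi> 0 = 0"
  by (simp add: walk_eval_def)

lemma walk_eval_add: "walk_eval \<Phi> (p + q) = walk_eval \<Phi> p + walk_eval \<Phi> q"
proof -
  let ?N = "max (degree p) (degree q)"
  show ?thesis
    using degree_add_le_max[of p q]
    by (simp add: walk_eval_le[of _ ?N] sum.distrib algebra_simps)
qed

lemma walk_eval_smult: "walk_eval \<Phi> (smult c p) = c * walk_eval \<Phi> p"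
  using degree_smult_le[of c p] by (simp add: walk_eval_le[of _ "degree p"] sum_distrib_left mult.assoc)

lemma walk_eval_minus: "walk_eval \<Phi> (p - q) = walk_eval \<Phi> p - walk_eval \<Phi> q"
  using walk_eval_add[of \<Phi> p "smult (-1) q"] walk_eval_smult[of \<Phi> "-1" q] by simp

lemma walk_eval_const: "walk_eval \<Phi> [:c:] = c * \<Phi> []"
  by (simp add: walk_eval_def)

lemma walk_eval_X: "walk_eval \<Phi> (pCons 0 p) = (\<Sum>s\<in>S. walk_eval (\<lambda>W. \<Phi> (s # W)) p)"
proof -
  have "walk_eval \<Phi> (pCons 0 p) = (\<Sum>i\<le>Suc (degree p). coeff (pCons 0 p) i * wsum \<Phi> i)"
    by (rule walk_eval_le) (simp add: degree_pCons_le)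
  also have "\<dots> = (\<Sum>i\<le>degree p. coeff p i * wsum \<Phi> (Suc i))"
    by (subst sum.atMost_Suc_shift) simp
  also have "\<dots> = (\<Sum>i\<le>degree p. \<Sum>s\<in>S. coeff p i * wsum (\<lambda>W. \<Phi> (s # W)) i)"
    by (simp add: wsum_Suc sum_distrib_left)
  finally show ?thesis
    unfolding walk_eval_def by (subst (asm) sum.swap)
qed

lemma rwords_0 [simp]: "rwords 0 = {[]}"
  by (auto simp: rwords_def reduced_def)

lemma rsum_0 [simp]: "rsum \<Phi> 0 = \<Phi> []"
  by (simp add: rsum_def)

lemma rwords_1: "rwords (Suc 0) = words (Suc 0)"
  by (auto simp: rwords_def reduced_def words_def length_Suc_conv)

lemma rsum_1: "rsum \<Phi> (Suc 0) = (\<Sum>s\<in>S. \<Phi> [s])"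
  using wsum_Suc[of \<Phi> 0] by (simp add: rsum_def rwords_1 wsum_def)

lemma reduced_Nil [simp]: "reduced []"
  by (simp add: reduced_def)

lemma reduced_Cons: "reduced (s # W) \<longleftrightarrow> W = [] \<or> hd W \<noteq> iv s \<and> reduced W"
  by (cases W) (auto simp: reduced_def)

lemma rwords_Suc_bij:
  "bij_betw (\<lambda>(s, W). s # W) {(s, W). s \<in> S \<and> W \<in> rwords (Suc m) \<and> hd W \<noteq> iv s} (rwords (Suc (Suc m)))"
  unfolding bij_betw_def
proof
  show "inj_on (\<lambda>(s, W). s # W) {(s, W). s \<in> S \<and> W \<in> rwords (Suc m) \<and> hd W \<noteq> iv s}"
    by (auto simp: inj_on_def)
  show "(\<lambda>(s, W). s # W) ` {(s, W). s \<in> S \<and> W \<in> rwords (Suc m) \<and> hd W \<noteq> iv s} = rwords (Suc (Suc m))"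
    by (auto simp: rwords_def words_def reduced_Cons length_Suc_conv image_iff)
qed

text \<open>Prefixing a letter to a reduced word of length m + 1 either gives a reduced word of
  length m + 2 or cancels the first letter. In the second case a reduced remainder W arises once for
  every letter s that is not its head, since \<open>iv s # W\<close> must be reduced: d times for
  the empty word, d - 1 times otherwise.\<close>

lemma sum_rsum_Cons:
  assumes c: "cancels \<Phi>"
  shows "(\<Sum>s\<in>S. rsum (\<lambda>W. \<Phi> (s # W)) (Suc m)) =
    rsum \<Phi> (Suc (Suc m)) + (if m = 0 then of_nat d else of_nat d - 1) * rsum \<Phi> m"
proof -
  let ?A = "{(s, W). s \<in> S \<and> W \<in> rwords (Suc m) \<and> hd W \<noteq> iv s}"
  let ?B = "{(s, W). s \<in> S \<and> W \<in> rwords (Suc m) \<and> hd W = iv s}"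
  let ?C = "{(W, s). W \<in> rwords m \<and> s \<in> S \<and> (W = [] \<or> hd W \<noteq> s)}"
  have finC: "finite ?C"
    by (rule finite_subset[of _ "rwords m \<times> S"]) (use finS in auto)
  have fin: "finite ?A" "finite ?B"
    by (rule finite_subset[of _ "S \<times> rwords (Suc m)"]; use finS in auto)+
  have "(\<Sum>s\<in>S. rsum (\<lambda>W. \<Phi> (s # W)) (Suc m)) = (\<Sum>(s, W)\<in>S \<times> rwords (Suc m). \<Phi> (s # W))"
    by (simp add: rsum_def sum.cartesian_product)
  also have "S \<times> rwords (Suc m) = ?A \<union> ?B" by auto
  also have "(\<Sum>(s, W)\<in>?A \<union> ?B. \<Phi> (s # W)) = (\<Sum>(s, W)\<in>?A. \<Phi> (s # W)) + (\<Sum>(s, W)\<in>?B. \<Phi> (s # W))"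
    by (rule sum.union_disjoint) (use fin in auto)
  also have "(\<Sum>(s, W)\<in>?A. \<Phi> (s # W)) = rsum \<Phi> (Suc (Suc m))"
    unfolding rsum_def using sum.reindex_bij_betw[OF rwords_Suc_bij, of \<Phi>]
    by (simp add: case_prod_unfold)
  also have "(\<Sum>(s, W)\<in>?B. \<Phi> (s # W)) = (\<Sum>(W, s)\<in>?C. \<Phi> W)"
  proof (rule sum.reindex_bij_witness[of _ "\<lambda>(W, s). (s, iv s # W)" "\<lambda>(s, W). (tl W, s)"], goal_cases)
    case (1 x)
    then obtain s W where x: "x = (s, W)" "s \<in> S" "W \<in> rwords (Suc m)" "hd W = iv s" by auto
    then show ?case by (cases W) (auto simp: rwords_def words_def)
  next
    case (2 x)
    then obtain s W where x: "x = (s, W)" "s \<in> S" "W \<in> rwords (Suc m)" "hd W = iv s" by auto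
    then show ?case by (cases W) (auto simp: rwords_def words_def reduced_Cons iv_iv)
  next
    case (3 y)
    then show ?case by auto
  next
    case (4 y)
    then show ?case by (auto simp: rwords_def words_def reduced_Cons iv_iv iv_in)
  next
    case (5 x)
    then obtain s W where x: "x = (s, W)" "s \<in> S" "W \<in> rwords (Suc m)" "hd W = iv s" by auto
    then obtain W' where W: "W = iv s # W'" by (cases W) (auto simp: rwords_def words_def)
    have "\<Phi> ([] @ s # iv s # W') = \<Phi> ([] @ W')"
      using c x unfolding cancels_def W by (intro c[unfolded cancels_def, rule_format]) (auto simp: rwords_def words_def)
    then show ?case using x W by simp
  qed
  also have "?C = Sigma (rwords m) (\<lambda>W. {s \<in> S. W = [] \<or> hd W \<noteq> s})" by auto
  also have "(\<Sum>(W, s)\<in>Sigma (rwords m) (\<lambda>W. {s \<in> S. W = [] \<or> hd W \<noteq> s}). \<Phi> W) =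
      (\<Sum>W\<in>rwords m. \<Sum>s\<in>{s \<in> S. W = [] \<or> hd W \<noteq> s}. \<Phi> W)"
    by (rule sum.Sigma[symmetric]) (use finS in auto)
  also have "\<dots> = (\<Sum>W\<in>rwords m. (if m = 0 then of_nat d else of_nat d - 1) * \<Phi> W)"
  proof (rule sum.cong[OF refl])
    fix W assume W: "W \<in> rwords m"
    show "(\<Sum>s\<in>{s \<in> S. W = [] \<or> hd W \<noteq> s}. \<Phi> W) = (if m = 0 then of_nat d else of_nat d - 1) * \<Phi> W"
    proof (cases "m = 0")
      case True
      then show ?thesis using W by (simp add: cardS)
    next
      case False
      then have ne: "W \<noteq> []" "hd W \<in> S" using W by (auto simp: rwords_def words_def)
      then have "{s \<in> S. W = [] \<or> hd W \<noteq> s} = S - {hd W}" by auto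
      moreover have "d \<ge> 1" using ne finS cardS by (metis One_nat_def Suc_leI card_gt_0_iff empty_iff)
      ultimately show ?thesis using ne finS False by (simp add: cardS of_nat_diff)
    qed
  qed
  also have "\<dots> = (if m = 0 then of_nat d else of_nat d - 1) * rsum \<Phi> m"
    by (simp add: rsum_def sum_distrib_left)
  finally show ?thesis .
qed

abbreviation "rpoly \<equiv> nb_poly d"

abbreviation "cpoly \<equiv> ihara_poly d"

lemma walk_eval_rpoly: "cancels \<Phi> \<Longrightarrow> walk_eval \<Phi> (rpoly m) = rsum \<Phi> m"
proof (induction m arbitrary: \<Phi> rule: induct_nat_012)
  case 0
  then show ?case using walk_eval_const[of \<Phi> 1] by (simp add: one_pCons)
next
  case 1
  have "walk_eval \<Phi> (pCons 0 [:1:]) = (\<Sum>s\<in>S. walk_eval (\<lambda>W. \<Phi> (s # W)) [:1:])"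
    by (rule walk_eval_X)
  then show ?case by (simp add: walk_eval_const rsum_1)
next
  case (ge2 m)
  then show ?case
    using sum_rsum_Cons[OF ge2(3), of m]
    by (simp add: walk_eval_minus walk_eval_smult walk_eval_X cancels_Cons)
qed

text \<open>Apart from the exceptional factor d in the polynomial of index 2, both families obey the
  same linear recursion, so the identity propagates from m = 0 and m = 1.\<close>

lemma cpoly_rpoly:
  "cpoly (m + 3) = cpoly (Suc m) + rpoly (m + 3) - smult (of_nat d - 1) (rpoly (Suc m))"
proof (induction m rule: less_induct)
  case (less m)
  consider "m = 0" | "m = 1" | k where "m = Suc (Suc k)" by (metis One_nat_def not0_implies_Suc)
  then show ?case
  proof cases
    case 1
    then show ?thesis by (simp add: numeral_3_eq_3 algebra_simps numeral_poly)
  next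
    case 2
    then show ?thesis by (simp add: numeral_3_eq_3 algebra_simps numeral_poly one_pCons)
  next
    case 3
    have a: "cpoly (k + 4) = cpoly (Suc (Suc k)) + rpoly (k + 4) - smult (of_nat d - 1) (rpoly (Suc (Suc k)))"
      using less.IH[of "Suc k"] 3 by (simp add: eval_nat_numeral)
    have b: "cpoly (k + 3) = cpoly (Suc k) + rpoly (k + 3) - smult (of_nat d - 1) (rpoly (Suc k))"
      using less.IH[of k] 3 by simp
    have c: "cpoly (m + 3) = pCons 0 (cpoly (k + 4)) - smult (of_nat d - 1) (cpoly (k + 3))"
      "rpoly (m + 3) = pCons 0 (rpoly (k + 4)) - smult (of_nat d - 1) (rpoly (k + 3))"
      "cpoly (Suc m) = pCons 0 (cpoly (Suc (Suc k))) - smult (of_nat d - 1) (cpoly (Suc k))"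
      "rpoly (Suc m) = pCons 0 (rpoly (Suc (Suc k))) - smult (of_nat d - 1) (rpoly (Suc k))"
      by (simp_all add: 3 eval_nat_numeral)
    have *: "pCons 0 (p + q - smult e r) - smult e (p' + q' - smult e r') =
        pCons 0 p - smult e p' + (pCons 0 q - smult e q') - smult e (pCons 0 r - smult e r')"
      for p q r p' q' r' :: "complex poly" and e
    proof -
      have X: "pCons 0 u = monom 1 1 * u" for u :: "complex poly" by (simp add: monom_altdef)
      have C: "smult e u = [:e:] * u" for u by simp
      show ?thesis unfolding X C by (simp only: algebra_simps)
    qed
    show ?thesis unfolding c a b by (rule *)
  qed
qed

lemma csum_1: "csum \<Phi> (Suc 0) = rsum \<Phi> (Suc 0)"
proof -
  have "cwords (Suc 0) = rwords (Suc 0)"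
    using iv_ne by (auto simp: cwords_def rwords_def words_def length_Suc_conv) (metis)+
  then show ?thesis by (simp add: csum_def rsum_def)
qed

lemma csum_2: "csum \<Phi> (Suc (Suc 0)) = rsum \<Phi> (Suc (Suc 0))"
proof -
  have "cwords (Suc (Suc 0)) = rwords (Suc (Suc 0))"
    using iv_iv by (auto simp: cwords_def rwords_def words_def length_Suc_conv reduced_def)
  then show ?thesis by (simp add: csum_def rsum_def)
qed

lemma reduced_snoc: "reduced (W @ [s]) \<longleftrightarrow> W = [] \<or> s \<noteq> iv (last W) \<and> reduced W"
  by (auto simp: reduced_def successively_append_iff)

text \<open>A reduced word of length m + 3 that is not cyclically reduced is s W s^(-1) with W
  reduced of length m + 1, and \<Phi> ignores the conjugation. The letter s must avoid
  \<open>iv (hd W)\<close> and \<open>last W\<close>; these coincide exactly when W is not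
  cyclically reduced, which leaves d - 1 choices in that case and d - 2 otherwise.\<close>

lemma csum_rec:
  assumes c: "class_fun \<Phi>"
  shows "csum \<Phi> (m + 3) = rsum \<Phi> (m + 3) - (of_nat d - 1) * rsum \<Phi> (Suc m) + csum \<Phi> (Suc m)"
proof -
  let ?D = "rwords (m + 3) - cwords (m + 3)"
  let ?A = "\<lambda>W. {s \<in> S. hd W \<noteq> iv s \<and> last W \<noteq> s}"
  have "rsum \<Phi> (m + 3) = csum \<Phi> (m + 3) + sum \<Phi> ?D"
    unfolding rsum_def csum_def
    by (subst sum.subset_diff[of "cwords (m + 3)"]) (auto simp: rwords_def cwords_def)
  also have "sum \<Phi> ?D = (\<Sum>(W, s)\<in>Sigma (rwords (Suc m)) ?A. \<Phi> W)"
  proof (rule sum.reindex_bij_witness[of _ "\<lambda>(W, s). s # W @ [iv s]" "\<lambda>W. (butlast (tl W), hd W)"], goal_cases)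
    case (1 V)
    then obtain s W s' where V: "V = s # W @ [s']"
      by (auto simp: rwords_def words_def length_Suc_conv numeral_3_eq_3) (metis append_butlast_last_id list.distinct(1))
    with 1 have "s \<in> S" "s' \<in> S" "s = iv s'"
      by (auto simp: rwords_def cwords_def words_def)
    then show ?case by (simp add: V iv_iv)
  next
    case (2 V)
    then obtain s W s' where V: "V = s # W @ [s']"
      by (auto simp: rwords_def words_def length_Suc_conv numeral_3_eq_3) (metis append_butlast_last_id list.distinct(1))
    with 2 have s: "s \<in> S" "s' \<in> S" "s = iv s'"
      by (auto simp: rwords_def cwords_def words_def)
    have "length W = Suc m" using 2 V by (auto simp: rwords_def words_def)
    then have "W \<noteq> []" by auto
    then show ?case using 2 s \<open>length W = Suc m\<close>
      by (auto simp: V rwords_def cwords_def words_def reduced_Cons reduced_snoc iv_iv)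
  next
    case (3 y)
    then show ?case by auto
  next
    case (4 y)
    then obtain W s where y: "y = (W, s)" "W \<in> rwords (Suc m)" "s \<in> S" "hd W \<noteq> iv s" "last W \<noteq> s" by auto
    then have "W \<noteq> []" "set W \<subseteq> S" by (auto simp: rwords_def words_def)
    then have "last W \<in> S" using last_in_set by blast
    with y have "iv s \<noteq> iv (last W)" by (metis iv_iv)
    with y \<open>W \<noteq> []\<close> show ?case
      by (auto simp: rwords_def cwords_def words_def reduced_Cons reduced_snoc iv_iv iv_in)
  next
    case (5 V)
    then obtain s W s' where V: "V = s # W @ [s']"
      by (auto simp: rwords_def words_def length_Suc_conv numeral_3_eq_3) (metis append_butlast_last_id list.distinct(1))
    with 5 have s: "s \<in> S" "s' \<in> S" "s = iv s'" "set W \<subseteq> S"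
      by (auto simp: rwords_def cwords_def words_def)
    have "\<Phi> (([s] @ W) @ [s']) = \<Phi> ([s'] @ ([s] @ W))"
      using s by (intro c[unfolded class_fun_def, THEN conjunct2, rule_format]) auto
    also have "\<dots> = \<Phi> ([] @ s' # iv s' # W)" using s by simp
    also have "\<dots> = \<Phi> ([] @ W)"
      using s by (intro c[unfolded class_fun_def cancels_def, THEN conjunct1, rule_format]) auto
    finally show ?case by (simp add: V)
  qed
  also have "\<dots> = (\<Sum>W\<in>rwords (Suc m). \<Sum>s\<in>?A W. \<Phi> W)"
    by (rule sum.Sigma[symmetric]) (use finS in auto)
  also have "\<dots> = (\<Sum>W\<in>rwords (Suc m). (of_nat d - 1) * \<Phi> W - (if W \<in> cwords (Suc m) then \<Phi> W else 0))"
  proof (rule sum.cong[OF refl])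
    fix W assume W: "W \<in> rwords (Suc m)"
    then have "W \<noteq> []" "set W \<subseteq> S" by (auto simp: rwords_def words_def)
    then have ne: "W \<noteq> []" "hd W \<in> S" "last W \<in> S" using last_in_set hd_in_set by blast+
    have A: "?A W = S - {iv (hd W), last W}" using ne iv_iv by auto
    have d1: "d \<ge> 1" using ne finS cardS by (metis One_nat_def Suc_leI card_gt_0_iff empty_iff)
    have cd: "W \<in> cwords (Suc m) \<longleftrightarrow> iv (hd W) \<noteq> last W"
      using W ne iv_iv[of "hd W"] iv_iv[of "last W"] by (auto simp: cwords_def rwords_def)
    show "(\<Sum>s\<in>?A W. \<Phi> W) = (of_nat d - 1) * \<Phi> W - (if W \<in> cwords (Suc m) then \<Phi> W else 0)"
    proof (cases "iv (hd W) = last W")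
      case True
      then have "card (?A W) = d - 1" unfolding A using ne finS by (simp add: cardS)
      then show ?thesis using True cd d1 by (simp add: of_nat_diff)
    next
      case False
      then have two: "card {iv (hd W), last W} = 2" by simp
      have sub: "{iv (hd W), last W} \<subseteq> S" using ne iv_in by auto
      have "d \<ge> 2" using card_mono[OF finS sub] two cardS by simp
      moreover have "card (?A W) = d - 2" unfolding A using card_Diff_subset[OF _ sub] two cardS by simp
      ultimately show ?thesis using False cd by (simp add: of_nat_diff algebra_simps)
    qed
  qed
  also have "\<dots> = (of_nat d - 1) * rsum \<Phi> (Suc m) - csum \<Phi> (Suc m)"
  proof -
    have "rwords (Suc m) \<inter> cwords (Suc m) = cwords (Suc m)" by (auto simp: rwords_def cwords_def)
    then have "csum \<Phi> (Suc m) = (\<Sum>W\<in>rwords (Suc m). if W \<in> cwords (Suc m) then \<Phi> W else 0)"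
      unfolding csum_def using sum.inter_restrict[OF finite_rwords, of \<Phi> "Suc m" "cwords (Suc m)"] by simp
    then show ?thesis by (simp add: sum_subtractf rsum_def sum_distrib_left)
  qed
  finally show ?thesis by (simp add: algebra_simps)
qed

text \<open>Ihara's formula coefficientwise: the power sums of the inverse roots come from the
  determinant, and d - 2 at even lengths is the coefficient of t^m / m in the logarithm of (1 -
  t^2)^(-(d - 2) / 2).\<close>

lemma csum_cpoly:
  assumes "class_fun \<Phi>"
  shows "csum \<Phi> (Suc m) = walk_eval \<Phi> (cpoly (Suc m)) + (if odd m then (of_nat d - 2) * \<Phi> [] else 0)"
proof (induction m rule: less_induct)
  case (less m)
  have c: "cancels \<Phi>" using assms by (simp add: class_fun_def)
  consider "m = 0" | "m = 1" | k where "m = Suc (Suc k)" by (metis One_nat_def not0_implies_Suc)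
  then show ?case
  proof cases
    case 1
    then show ?thesis using walk_eval_rpoly[OF c, of "Suc 0"] by (simp add: csum_1)
  next
    case 2
    have "cpoly (Suc (Suc 0)) = rpoly (Suc (Suc 0)) - [:of_nat d - 2:]"
      by (simp add: one_pCons numeral_poly)
    then show ?thesis using 2 walk_eval_rpoly[OF c, of "Suc (Suc 0)"]
      by (simp add: csum_2 walk_eval_minus walk_eval_const del: nb_poly.simps ihara_poly.simps)
  next
    case 3
    have "csum \<Phi> (Suc m) = rsum \<Phi> (k + 3) - (of_nat d - 1) * rsum \<Phi> (Suc k) + csum \<Phi> (Suc k)"
      using csum_rec[OF assms, of k] 3 by (simp add: numeral_3_eq_3)
    moreover have "walk_eval \<Phi> (cpoly (k + 3)) =
        walk_eval \<Phi> (cpoly (Suc k)) + rsum \<Phi> (k + 3) - (of_nat d - 1) * rsum \<Phi> (Suc k)"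
      by (simp only: cpoly_rpoly walk_eval_add walk_eval_minus walk_eval_smult walk_eval_rpoly[OF c])
    moreover have "cpoly (Suc m) = cpoly (k + 3)" using 3 by (simp add: numeral_3_eq_3)
    ultimately show ?thesis using less.IH[of k] 3 by simp
  qed
qed

text \<open>Expansion in reduced words, for the operator-norm estimate on the group: there \<Phi>
  evaluates a vector along a word, which respects cancellation but need not be a class
  function.\<close>

lemma walk_eval_cpoly:
  assumes c: "cancels \<Phi>"
  shows "walk_eval \<Phi> (cpoly (Suc m)) =
    rsum \<Phi> (Suc m) - (of_nat d - 2) * (\<Sum>l | l \<le> m \<and> even (m + 1 - l). rsum \<Phi> l)"
proof (induction m rule: less_induct)
  case (less m)
  consider "m = 0" | "m = 1" | k where "m = Suc (Suc k)" by (metis One_nat_def not0_implies_Suc)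
  then show ?case
  proof cases
    case 1
    have "{l. l \<le> (0::nat) \<and> even (1 - l)} = {}" by auto
    then show ?thesis using 1 walk_eval_rpoly[OF c, of "Suc 0"] by simp
  next
    case 2
    have e: "cpoly (Suc (Suc 0)) = rpoly (Suc (Suc 0)) - [:of_nat d - 2:]"
      by (simp add: one_pCons numeral_poly)
    have "{l. l \<le> Suc 0 \<and> (Suc (Suc 0) < l \<or> even l)} = {0}" by (auto simp: le_Suc_eq)
    then show ?thesis using 2 walk_eval_rpoly[OF c, of "Suc (Suc 0)"] e
      by (simp add: walk_eval_minus walk_eval_const del: nb_poly.simps ihara_poly.simps)
  next
    case 3
    have w: "walk_eval \<Phi> (cpoly (k + 3)) =
        walk_eval \<Phi> (cpoly (Suc k)) + rsum \<Phi> (k + 3) - (of_nat d - 1) * rsum \<Phi> (Suc k)"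
      by (simp only: cpoly_rpoly walk_eval_add walk_eval_minus walk_eval_smult walk_eval_rpoly[OF c])
    have e: "{l. l \<le> m \<and> even (m + 1 - l)} = insert (Suc k) {l. l \<le> k \<and> even (k + 1 - l)}"
      using 3 by (auto simp: le_Suc_eq Suc_diff_le)
    define z where "z = (\<Sum>l | l \<le> k \<and> even (k + 1 - l). rsum \<Phi> l)"
    have "(\<Sum>l | l \<le> m \<and> even (m + 1 - l). rsum \<Phi> l) = rsum \<Phi> (Suc k) + z"
      unfolding e z_def by (subst sum.insert) auto
    moreover have "walk_eval \<Phi> (cpoly (Suc k)) = rsum \<Phi> (Suc k) - (of_nat d - 2) * z"
      using less.IH[of k] 3 unfolding z_def by simp
    moreover have "Suc m = k + 3" using 3 by simp
    ultimately show ?thesis using w by (simp only: w) (simp add: algebra_simps)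
  qed
qed

lemma card_rwords: "card (rwords (Suc m)) = d * (d - 1) ^ m"
proof -
  \<comment> \<open>For the constant function 1 the recursion \<open>sum_rsum_Cons\<close> counts
    reduced words.\<close>
  let ?one = "\<lambda>_. 1 :: complex"
  have c: "cancels ?one" by (simp add: cancels_def)
  have r: "rsum ?one m = of_nat (card (rwords m))" for m by (simp add: rsum_def)
  have card1: "card (rwords (Suc 0)) = d" by (simp add: rwords_1 card_words)
  show ?thesis
  proof (cases "d = 0")
    case True
    then have "card (words (Suc m)) = 0" by (simp add: card_words)
    then have "words (Suc m) = {}" using finite_words[of "Suc m"] by simp
    then have "rwords (Suc m) = {}" unfolding rwords_def by blast
    then show ?thesis using True by simp
  next
    case False
    have step: "rsum ?one (Suc m) = of_nat d * (of_nat d - 1) ^ m" for m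
    proof (induction m rule: less_induct)
      case (less m)
      show ?case
      proof (cases m)
        case 0
        then show ?thesis using card1 r by simp
      next
        case (Suc k)
        have rec: "of_nat d * rsum ?one (Suc k) =
            rsum ?one (Suc (Suc k)) + (if k = 0 then of_nat d else of_nat d - 1) * rsum ?one k"
          using sum_rsum_Cons[OF c, of k] by (simp add: cardS)
        have "(if k = 0 then of_nat d else of_nat d - 1) * rsum ?one k = rsum ?one (Suc k)"
        proof (cases k)
          case 0
          then show ?thesis using card1 r by simp
        next
          case (Suc j)
          then show ?thesis using less.IH[of j] less.IH[of "Suc j"] \<open>m = Suc k\<close> by simp
        qed
        with rec have "rsum ?one (Suc (Suc k)) = (of_nat d - 1) * rsum ?one (Suc k)"
          by (simp add: algebra_simps)
        then show ?thesis using less.IH[of k] Suc by simp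
      qed
    qed
    have "(of_nat (card (rwords (Suc m))) :: complex) = of_nat (d * (d - 1) ^ m)"
      using step[of m] r[of "Suc m"] False by (simp add: of_nat_diff)
    then show ?thesis using of_nat_eq_iff by blast
  qed
qed

end

section \<open>Path graphs and the infinite product\<close>

lemma quadratic_root_bound:
  fixes u v :: complex and r x :: real
  assumes r: "r \<ge> 1" and x: "\<bar>x\<bar> \<le> 1"
    and s: "u + v = of_real ((r + 1) * x)" and p: "u * v = of_real r"
  shows "norm u \<le> r"
proof (cases "Im u = 0")
  case True
  then have "Im v = 0" using arg_cong[OF s, of Im] by simp
  with True obtain a b where ab: "u = of_real a" "v = of_real b"
    by (metis complex_is_Real_iff Reals_cases)
  have s': "a + b = (r + 1) * x" and p': "a * b = r"
    using s p unfolding ab by (metis of_real_add of_real_eq_iff, metis of_real_mult of_real_eq_iff)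
  \<comment> \<open>The quadratic with roots a and b takes the values (r + 1)(1 - x) at 1 and (r +
    1)(1 + x) at -1. Their signs rule out |a| > r, which would force |b| >= 1 and hence |a b| >
    r.\<close>
  have h1: "(a - 1) * (b - 1) \<ge> 0"
  proof -
    have "(a - 1) * (b - 1) = (r + 1) * (1 - x)" using s' p' by (simp add: algebra_simps)
    then show ?thesis using r x by simp
  qed
  have h2: "(a + 1) * (b + 1) \<ge> 0"
  proof -
    have "(a + 1) * (b + 1) = (r + 1) * (1 + x)" using s' p' by (simp add: algebra_simps)
    then show ?thesis using r x by simp
  qed
  have "\<bar>a\<bar> \<le> r"
  proof (rule ccontr)
    assume "\<not> \<bar>a\<bar> \<le> r"
    then consider "a > r" | "a < - r" by linarith
    then show False
    proof cases
      case 1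
      then have "b \<ge> 1" using h1 r by (simp add: zero_le_mult_iff)
      then have "a * 1 \<le> a * b" using 1 r by (intro mult_left_mono) auto
      then show False using p' 1 by simp
    next
      case 2
      then have "b \<le> -1" using h2 r by (simp add: zero_le_mult_iff)
      then have "- a * 1 \<le> - a * - b" using 2 r by (intro mult_left_mono) auto
      then show False using p' 2 by simp
    qed
  qed
  then show ?thesis by (simp add: ab)
next
  case False
  \<comment> \<open>Nonreal roots are conjugate, so both have modulus sqrt r, which is at most r
    because r >= 1.\<close>
  have "Im v = - Im u" using arg_cong[OF s, of Im] by simp
  moreover have "Re u * Im v + Im u * Re v = 0" using arg_cong[OF p, of Im] by simp
  ultimately have "Im u * (Re v - Re u) = 0" by (simp add: algebra_simps)
  then have "v = cnj u" using False \<open>Im v = - Im u\<close> by (simp add: complex_eq_iff)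
  then have "of_real ((norm u)\<^sup>2) = (of_real r :: complex)" using p complex_norm_square[of u] by simp
  then have "(norm u)\<^sup>2 = r" by (simp only: of_real_eq_iff)
  moreover have "r \<le> r\<^sup>2" using r self_le_power[of r 2] by simp
  ultimately have "(norm u)\<^sup>2 \<le> r\<^sup>2" by simp
  then show ?thesis using r power2_le_imp_le[of "norm u" r] by simp
qed

text \<open>u and v are the roots of z^2 - d x z + (d - 1), so that 1 - d x t + (d - 1) t^2 = (1 - u
  t)(1 - v t); the recursion of \<open>ihara_poly\<close> is the one satisfied by u^m + v^m.\<close>

lemma ihara_poly_roots:
  assumes d: "d \<ge> 2" and x: "\<bar>x\<bar> \<le> 1"
  obtains u v :: complex where
    "u + v = of_real (of_nat d * x)" "u * v = of_nat d - 1" "norm u \<le> real d - 1" "norm v \<le> real d - 1"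
    "\<And>m. poly (ihara_poly d m) (of_real (of_nat d * x)) = u ^ m + v ^ m"
proof -
  let ?s = "complex_of_real (of_nat d * x)"
  define w where "w = csqrt (?s\<^sup>2 - 4 * (of_nat d - 1))"
  define u where "u = (?s + w) / 2"
  define v where "v = (?s - w) / 2"
  have s: "u + v = ?s" by (simp add: u_def v_def field_simps)
  have "4 * (u * v) = (2 * u) * (2 * v)" by simp
  also have "2 * u = ?s + w" by (simp add: u_def)
  also have "2 * v = ?s - w" by (simp add: v_def)
  also have "(?s + w) * (?s - w) = ?s\<^sup>2 - w\<^sup>2" by (simp add: power2_eq_square algebra_simps)
  also have "\<dots> = 4 * (of_nat d - 1)" by (simp add: w_def)
  finally have p: "u * v = of_nat d - 1" by (simp only: mult_cancel_left) simp
  have r: "real d - 1 \<ge> 1" using d by simp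
  have s': "u + v = of_real ((real d - 1 + 1) * x)" "v + u = of_real ((real d - 1 + 1) * x)"
    using s by (simp_all add: add.commute)
  have p': "u * v = of_real (real d - 1)" "v * u = of_real (real d - 1)"
    using p by (simp_all add: mult.commute)
  have "poly (ihara_poly d m) ?s = u ^ m + v ^ m" for m :: nat
  proof (induction m rule: induct_nat_012)
    case (ge2 m)
    have "poly (ihara_poly d (Suc (Suc m))) ?s = (u + v) * (u ^ Suc m + v ^ Suc m) - (u * v) * (u ^ m + v ^ m)"
      unfolding s p using ge2 by simp
    also have "\<dots> = u ^ Suc (Suc m) + v ^ Suc (Suc m)" by (simp add: algebra_simps)
    finally show ?case .
  qed (use s in simp_all)
  then show ?thesis
    using that[OF s p quadratic_root_bound[OF r x s'(1) p'(1)] quadratic_root_bound[OF r x s'(2) p'(2)]] by simp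
qed

lemma norm_ihara_poly_le:
  assumes "d \<ge> 2" "\<bar>x\<bar> \<le> 1"
  shows "norm (poly (ihara_poly d m) (of_real (of_nat d * x))) \<le> 2 * (real d - 1) ^ m"
proof -
  obtain u v where uv: "norm u \<le> real d - 1" "norm v \<le> real d - 1"
    "\<And>m. poly (ihara_poly d m) (of_real (of_nat d * x)) = u ^ m + v ^ m"
    using ihara_poly_roots[OF assms] by metis
  have "norm (u ^ m + v ^ m) \<le> norm u ^ m + norm v ^ m" using norm_triangle_ineq[of "u ^ m" "v ^ m"] by (simp add: norm_power)
  also have "\<dots> \<le> (real d - 1) ^ m + (real d - 1) ^ m" using uv by (intro add_mono power_mono) auto
  finally show ?thesis using uv by simp
qed

lemma ihara_log_series:
  fixes t :: complex
  assumes d: "d \<ge> 2" and x: "\<bar>x\<bar> \<le> 1" and t: "norm t * (real d - 1) < 1"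
  shows "1 - t * of_nat d * of_real x + (of_nat d - 1) * t\<^sup>2 \<noteq> 0"
    and "(\<lambda>m. poly (ihara_poly d m) (of_real (of_nat d * x)) * (t ^ m / of_nat m)) sums
      - Ln (1 - t * of_nat d * of_real x + (of_nat d - 1) * t\<^sup>2)"
proof -
  obtain u v where uv: "u + v = of_real (of_nat d * x)" "u * v = of_nat d - 1"
    "norm u \<le> real d - 1" "norm v \<le> real d - 1"
    "\<And>m. poly (ihara_poly d m) (of_real (of_nat d * x)) = u ^ m + v ^ m"
    using ihara_poly_roots[OF d x] by metis
  have small: "norm (z * t) < 1" if "norm z \<le> real d - 1" for z
  proof -
    have "norm (z * t) \<le> (real d - 1) * norm t" unfolding norm_mult using that by (intro mult_right_mono) auto
    then show ?thesis using t by (simp add: mult.commute)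
  qed
  have nz: "Re (1 - z * t) > 0" if "norm z \<le> real d - 1" for z
    using small[OF that] complex_Re_le_cmod[of "z * t"] by simp
  have fac: "1 - t * of_nat d * of_real x + (of_nat d - 1) * t\<^sup>2 = (1 - u * t) * (1 - v * t)"
  proof -
    have "(1 - u * t) * (1 - v * t) = 1 - (u + v) * t + (u * v) * t\<^sup>2"
      by (simp add: algebra_simps power2_eq_square)
    then show ?thesis unfolding uv(1,2) by (simp add: algebra_simps)
  qed
  have ne: "1 - u * t \<noteq> 0" "1 - v * t \<noteq> 0" using nz[OF uv(3)] nz[OF uv(4)] by (metis order_less_irrefl zero_complex.simps(1))+
  then show "1 - t * of_nat d * of_real x + (of_nat d - 1) * t\<^sup>2 \<noteq> 0" unfolding fac by simp
  \<comment> \<open>Both factors lie in the right half-plane, so their arguments add up to less than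
    pi in absolute value and the principal logarithms are additive.\<close>
  have "\<bar>Im (Ln (1 - u * t))\<bar> < pi / 2" "\<bar>Im (Ln (1 - v * t))\<bar> < pi / 2"
    using Re_Ln_pos_lt[OF ne(1)] Re_Ln_pos_lt[OF ne(2)] nz[OF uv(3)] nz[OF uv(4)] by auto
  then have Ln: "Ln ((1 - u * t) * (1 - v * t)) = Ln (1 - u * t) + Ln (1 - v * t)"
    using ne by (intro Ln_times_simple) (auto simp: abs_less_iff)
  have "(\<lambda>m. (u * t) ^ m / of_nat m + (v * t) ^ m / of_nat m) sums (- Ln (1 - u * t) + - Ln (1 - v * t))"
    by (intro sums_add sums_Ln_series small uv)
  then show "(\<lambda>m. poly (ihara_poly d m) (of_real (of_nat d * x)) * (t ^ m / of_nat m)) sums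
      - Ln (1 - t * of_nat d * of_real x + (of_nat d - 1) * t\<^sup>2)"
    unfolding fac Ln uv(5) by (simp add: power_mult_distrib distrib_right add_divide_distrib)
qed

section \<open>Spectrum of the path graph by discrete sine vectors\<close>

lemma sum_cos_arith:
  fixes z :: int
  assumes "Q > 0" "z \<noteq> 0" "\<bar>z\<bar> < 2 * int Q"
  shows "(\<Sum>p<Q. cos (real p * pi * of_int z / real Q)) = (if even z then 0 else 1)"
proof -
  define \<theta> where "\<theta> = pi * of_int z / real Q"
  \<comment> \<open>Multiplication by 2 sin (\<theta> / 2) makes the cosine sum telescope; the
    bounds on z exclude the multiples of 2 Q, where this sine vanishes.\<close>
  have tel: "2 * sin (\<theta> / 2) * (\<Sum>p<N. cos (real p * \<theta>)) = sin ((real N - 1 / 2) * \<theta>) + sin (\<theta> / 2)" for N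
  proof (induction N)
    case (Suc N)
    have "sin (\<theta> / 2) * cos (real N * \<theta>) = (sin (\<theta> / 2 + real N * \<theta>) + sin (\<theta> / 2 - real N * \<theta>)) / 2"
      by (simp add: sin_times_cos)
    moreover have "\<theta> / 2 - real N * \<theta> = - ((real N - 1 / 2) * \<theta>)" "\<theta> / 2 + real N * \<theta> = (real (Suc N) - 1 / 2) * \<theta>"
      by (simp_all add: algebra_simps)
    ultimately show ?case using Suc by (simp only: sin_minus sum.lessThan_Suc) (simp add: algebra_simps)
  qed (simp add: sin_minus)
  have "sin (\<theta> / 2) \<noteq> 0"
  proof
    assume "sin (\<theta> / 2) = 0"
    then obtain i :: int where i: "\<theta> / 2 = of_int i * pi" using sin_zero_iff_int2 by auto
    then have "of_int z = real_of_int (2 * i * int Q)" using assms(1) by (simp add: \<theta>_def field_simps)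
    then have "z = 2 * i * int Q" using of_int_eq_iff by blast
    then show False using assms by (auto simp: abs_mult)
  qed
  moreover have "sin ((real Q - 1 / 2) * \<theta>) = - cos (pi * of_int z) * sin (\<theta> / 2)"
  proof -
    have e: "(real Q - 1 / 2) * \<theta> = pi * of_int z - \<theta> / 2" using assms(1) by (simp add: \<theta>_def field_simps)
    have "sin (pi * of_int z) = 0" by (metis mult.commute sin_zero_iff_int2)
    then show ?thesis unfolding e by (simp add: sin_diff)
  qed
  moreover have "cos (pi * of_int z) = (if even z then 1 else - 1)" 
    using cos_npi_int[of z] by (simp add: mult.commute)
  ultimately have "2 * (\<Sum>p<Q. cos (real p * \<theta>)) = (if even z then 0 else 2)"
    using tel[of Q] by (auto split: if_splits simp: algebra_simps)
  then show ?thesis by (simp add: \<theta>_def mult.assoc split: if_splits)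
qed

lemma sin_orthogonality:
  assumes "0 < x" "x < Q" "0 < y" "y < Q"
  shows "(\<Sum>p=1..<Q. sin (real p * pi * real x / real Q) * sin (real p * pi * real y / real Q)) =
    (if x = y then real Q / 2 else 0)"
proof -
  let ?C = "\<lambda>z::int. \<Sum>p<Q. cos (real p * pi * of_int z / real Q)"
  have "(\<Sum>p=1..<Q. sin (real p * pi * real x / real Q) * sin (real p * pi * real y / real Q)) =
      (\<Sum>p<Q. sin (real p * pi * real x / real Q) * sin (real p * pi * real y / real Q))"
    by (rule sum.mono_neutral_left) (auto simp: not_less_eq_eq)
  also have "\<dots> = (\<Sum>p<Q. (cos (real p * pi * of_int (int x - int y) / real Q) - cos (real p * pi * of_int (int x + int y) / real Q)) / 2)"
    by (rule sum.cong) (simp_all add: sin_times_sin algebra_simps add_divide_distrib diff_divide_distrib)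
  also have "\<dots> = (?C (int x - int y) - ?C (int x + int y)) / 2"
    by (simp only: sum_subtractf sum_divide_distrib[symmetric])
  \<comment> \<open>x + y and x - y have the same parity, so the two cosine sums cancel unless x =
    y.\<close>
  also have "?C (int x + int y) = (if even (int x + int y) then 0 else 1)"
    by (rule sum_cos_arith) (use assms in auto)
  also have "?C (int x - int y) = (if x = y then real Q else if even (int x - int y) then 0 else 1)"
  proof (cases "x = y")
    case False
    then show ?thesis using sum_cos_arith[of Q "int x - int y"] assms by auto
  qed simp
  finally show ?thesis by auto
qed

text \<open>Walks on the path graph with vertices \<open>1, \<dots>, Q - 1\<close>; \<open>True\<close> is a step to the left.\<close>

fun path_walk :: "nat \<Rightarrow> bool list \<Rightarrow> nat \<Rightarrow> nat \<Rightarrow> bool" where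
  "path_walk Q [] x y \<longleftrightarrow> 0 < x \<and> x < Q \<and> x = y"
| "path_walk Q (b # bs) x y \<longleftrightarrow> 0 < x \<and> x < Q \<and> path_walk Q bs (if b then x - 1 else x + 1) y"

definition sgn_words :: "nat \<Rightarrow> bool list set" where
  "sgn_words j = {bs. length bs = j}"

lemma sgn_words_0 [simp]: "sgn_words 0 = {[]}"
  by (auto simp: sgn_words_def)

lemma finite_sgn_words [simp]: "finite (sgn_words j)"
  using finite_lists_length_eq[of "UNIV :: bool set" j] by (simp add: sgn_words_def)

lemma sum_sgn_words_Suc:
  "(\<Sum>bs\<in>sgn_words (Suc j). f bs) = (\<Sum>bs\<in>sgn_words j. f (True # bs)) + (\<Sum>bs\<in>sgn_words j. f (False # bs))"
    for f :: "bool list \<Rightarrow> 'b::comm_monoid_add"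
proof -
  have "sgn_words (Suc j) = (\<lambda>bs. True # bs) ` sgn_words j \<union> (\<lambda>bs. False # bs) ` sgn_words j"
    by (auto simp: sgn_words_def length_Suc_conv image_iff)
  moreover have "(\<Sum>bs\<in>(\<lambda>bs. True # bs) ` sgn_words j \<union> (\<lambda>bs. False # bs) ` sgn_words j. f bs) =
      (\<Sum>bs\<in>(\<lambda>bs. True # bs) ` sgn_words j. f bs) + (\<Sum>bs\<in>(\<lambda>bs. False # bs) ` sgn_words j. f bs)"
    by (rule sum.union_disjoint) auto
  ultimately show ?thesis by (simp add: sum.reindex)
qed

lemma path_walk_boundary: "x = 0 \<or> x = Q \<Longrightarrow> \<not> path_walk Q bs x y"
  by (cases bs) auto

lemma path_walk_spectral:
  assumes "x \<le> Q" "0 < y" "y < Q"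
  shows "(\<Sum>bs\<in>sgn_words j. of_bool (path_walk Q bs x y)) =
    2 / real Q * (\<Sum>p=1..<Q. (2 * cos (real p * pi / real Q)) ^ j *
       (sin (real p * pi * real x / real Q) * sin (real p * pi * real y / real Q)))"
  using assms(1)
proof (induction j arbitrary: x)
  case 0
  show ?case
  proof (cases "x = 0 \<or> x = Q")
    case True
    have "sin (real p * pi * real x / real Q) = 0" for p
      using True assms by (auto simp: mult.commute sin_npi2)
    then show ?thesis using True by auto
  next
    case False
    then show ?thesis using sin_orthogonality[of x Q y] 0 assms by auto
  qed
next
  case (Suc j)
  show ?case
  proof (cases "x = 0 \<or> x = Q")
    case True
    have "sin (real p * pi * real x / real Q) = 0" for p
      using True assms by (auto simp: mult.commute sin_npi2)
    then show ?thesis using path_walk_boundary[OF True] by simp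
  next
    case False
    then have x: "0 < x" "x < Q" using Suc.prems by auto
    let ?S = "\<lambda>p x. sin (real p * pi * real x / real Q)"
    have trig: "2 * cos (real p * pi / real Q) * ?S p x = ?S p (x - 1) + ?S p (x + 1)" for p
    proof -
      have "real p * pi * real (x - 1) / real Q = real p * pi * real x / real Q - real p * pi / real Q"
        "real p * pi * real (x + 1) / real Q = real p * pi * real x / real Q + real p * pi / real Q"
        using x by (simp_all add: of_nat_diff field_simps)
      then show ?thesis by (simp only: sin_add sin_diff) simp
    qed
    have "(\<Sum>bs\<in>sgn_words (Suc j). of_bool (path_walk Q bs x y)) =
        (\<Sum>bs\<in>sgn_words j. of_bool (path_walk Q bs (x - 1) y)) + (\<Sum>bs\<in>sgn_words j. of_bool (path_walk Q bs (x + 1) y) :: real)"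
      using x by (simp add: sum_sgn_words_Suc)
    also have "\<dots> = 2 / real Q * (\<Sum>p=1..<Q. (2 * cos (real p * pi / real Q)) ^ j * (?S p (x - 1) * ?S p y)) +
        2 / real Q * (\<Sum>p=1..<Q. (2 * cos (real p * pi / real Q)) ^ j * (?S p (x + 1) * ?S p y))"
      using x by (intro arg_cong2[where f = "(+)"] Suc.IH) auto
    also have "\<dots> = 2 / real Q * (\<Sum>p=1..<Q. (2 * cos (real p * pi / real Q)) ^ j * ((?S p (x - 1) + ?S p (x + 1)) * ?S p y))"
      by (simp only: distrib_left[symmetric] sum.distrib[symmetric] distrib_right[symmetric])
    finally show ?thesis unfolding trig[symmetric] by (simp only: power_Suc mult_ac)
  qed
qed

lemma path_closed_walks:
  "(\<Sum>bs\<in>sgn_words j. \<Sum>x=1..<Q. of_bool (path_walk Q bs x x)) =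
    (\<Sum>p=1..<Q. (2 * cos (real p * pi / real Q)) ^ j)"
proof -
  have "(\<Sum>bs\<in>sgn_words j. \<Sum>x=1..<Q. of_bool (path_walk Q bs x x) :: real) =
      (\<Sum>x=1..<Q. \<Sum>bs\<in>sgn_words j. of_bool (path_walk Q bs x x))" by (rule sum.swap)
  also have "\<dots> = (\<Sum>x=1..<Q. 2 / real Q * (\<Sum>p=1..<Q. (2 * cos (real p * pi / real Q)) ^ j *
       (sin (real p * pi * real x / real Q) * sin (real p * pi * real x / real Q))))"
    by (rule sum.cong[OF refl], rule path_walk_spectral) auto
  \<comment> \<open>The sine matrix is symmetric in p and x, so \<open>sin_orthogonality\<close> may
    be used for the sum over x.\<close>
  also have "\<dots> = (\<Sum>p=1..<Q. (2 * cos (real p * pi / real Q)) ^ j * (2 / real Q *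
       (\<Sum>x=1..<Q. sin (real x * pi * real p / real Q) * sin (real x * pi * real p / real Q))))"
    unfolding sum_distrib_left by (subst sum.swap) (simp add: mult_ac)
  also have "\<dots> = (\<Sum>p=1..<Q. (2 * cos (real p * pi / real Q)) ^ j)"
  proof (rule sum.cong)
    fix p assume "p \<in> {1..<Q}"
    then have p: "0 < p" "p < Q" by auto
    show "(2 * cos (real p * pi / real Q)) ^ j * (2 / real Q *
       (\<Sum>x=1..<Q. sin (real x * pi * real p / real Q) * sin (real x * pi * real p / real Q))) =
       (2 * cos (real p * pi / real Q)) ^ j"
      unfolding sin_orthogonality[OF p p] using p by simp
  qed simp
  finally show ?thesis .
qed

text \<open>For the walk \<open>bs\<close> on the integers starting at \<open>0\<close>, \<open>walk_shape bs = (m, w, q)\<close> says that it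
  reaches the height \<open>m\<close> and no more, visits \<open>w + 1\<close> points and ends at \<open>m - q\<close>.\<close>

fun walk_shape :: "bool list \<Rightarrow> nat \<times> nat \<times> nat" where
  "walk_shape [] = (0, 0, 0)"
| "walk_shape (True # bs) =
    (case walk_shape bs of (m, w, q) \<Rightarrow> if m = 0 then (0, w + 1, q + 1) else (m - 1, w, q))"
| "walk_shape (False # bs) =
    (case walk_shape bs of (m, w, q) \<Rightarrow> if m < w then (m + 1, w, q) else (m + 1, w + 1, q))"

lemma walk_shape_le: "walk_shape bs = (m, w, q) \<Longrightarrow> m \<le> w \<and> q \<le> w"
  by (induction bs arbitrary: m w q rule: walk_shape.induct) (auto split: prod.splits if_splits)

text \<open>The walk from x sweeps exactly the interval from x + m - w to x + m, so it stays in the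
  path graph precisely when both ends do. The conditions are written with sums to avoid truncated
  subtraction.\<close>

lemma path_walk_shape:
  "walk_shape bs = (m, w, q) \<Longrightarrow> path_walk Q bs x y \<longleftrightarrow> w < x + m \<and> x + m < Q \<and> y + q = x + m"
proof (induction bs arbitrary: m w q x rule: walk_shape.induct)
  case 1
  then show ?case by auto
next
  case (2 bs)
  obtain m' w' q' where s: "walk_shape bs = (m', w', q')" by (metis prod_cases3)
  show ?case using 2(1)[OF s, of "x - 1"] 2(2) walk_shape_le[OF s] s by (auto split: if_splits)
next
  case (3 bs)
  obtain m' w' q' where s: "walk_shape bs = (m', w', q')" by (metis prod_cases3)
  show ?case using 3(1)[OF s, of "x + 1"] 3(2) walk_shape_le[OF s] s by (auto split: if_splits)
qed

text \<open>For c = n this is the limit, as the level grows, of the normalized trace of the averaged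
  product of generators with signs \<open>bs\<close>.\<close>

definition closed_weight :: "real \<Rightarrow> bool list \<Rightarrow> real" where
  "closed_weight c bs = (case walk_shape bs of (m, w, q) \<Rightarrow> if m = q then inverse c ^ w else 0)"

lemma card_closed_path_walks:
  assumes "walk_shape bs = (m, w, q)"
  shows "(\<Sum>x=1..<Q. of_bool (path_walk Q bs x x) :: real) = (if m = q then real (Q - 1 - w) else 0)"
proof (cases "m = q")
  case True
  have "(\<Sum>x=1..<Q. of_bool (path_walk Q bs x x) :: real) = real (card {x \<in> {1..<Q}. path_walk Q bs x x})"
    by (simp add: sum.If_cases of_bool_def Int_def)
  also have "{x \<in> {1..<Q}. path_walk Q bs x x} = {Suc w - m..<Q - m}"
    using path_walk_shape[OF assms] walk_shape_le[OF assms] True by auto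
  also have "card \<dots> = Q - 1 - w" using walk_shape_le[OF assms] by auto
  finally show ?thesis using True by simp
next
  case False
  then show ?thesis using path_walk_shape[OF assms] by auto
qed

text \<open>Truncated subtraction makes the terms with Q < w + 2 vanish; from there on the series is
  the derivative of a geometric series, and (n - 1)^2 is the constant that gives it the value
  n^(-w).\<close>

lemma width_weights_sums:
  fixes n :: real
  assumes n: "n > 1"
  shows "(\<lambda>Q. (n - 1)\<^sup>2 / n ^ Q * real (Q - 1 - w)) sums (inverse n ^ w)"
proof -
  have g: "(\<lambda>i. of_nat (Suc i) * inverse n ^ i) sums (1 / (1 - inverse n)\<^sup>2)"
    by (rule geometric_deriv_sums) (use n in \<open>simp add: field_simps\<close>)
  have "(\<lambda>i. (n - 1)\<^sup>2 / n ^ (w + 2) * (of_nat (Suc i) * inverse n ^ i)) sums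
      ((n - 1)\<^sup>2 / n ^ (w + 2) * (1 / (1 - inverse n)\<^sup>2))"
    by (rule sums_mult[OF g])
  also have "(n - 1)\<^sup>2 / n ^ (w + 2) * (1 / (1 - inverse n)\<^sup>2) = inverse n ^ w"
  proof -
    have "1 - inverse n = (n - 1) / n" using n by (simp add: field_simps)
    then show ?thesis using n by (simp add: power_divide power_add divide_simps power2_eq_square)
  qed
  also have "(\<lambda>i. (n - 1)\<^sup>2 / n ^ (w + 2) * (of_nat (Suc i) * inverse n ^ i)) =
      (\<lambda>i. (n - 1)\<^sup>2 / n ^ (i + (w + 2)) * real (i + (w + 2) - 1 - w))"
    using n by (auto simp: fun_eq_iff power_add field_simps)
  finally show ?thesis
    by (subst (asm) sums_iff_shift) (simp add: numeral_2_eq_2)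
qed


section \<open>The limit measure as a mixture of path spectra\<close>

definition path_pairs :: "(nat \<times> nat) set" where
  "path_pairs = Sigma UNIV (\<lambda>Q. {1..<Q})"

lemma has_sum_sum_finite:
  fixes f :: "'i \<Rightarrow> 'b \<Rightarrow> 'c :: topological_comm_monoid_add"
  assumes "finite I" "\<And>i. i \<in> I \<Longrightarrow> (f i has_sum g i) A"
  shows "((\<lambda>x. \<Sum>i\<in>I. f i x) has_sum (\<Sum>i\<in>I. g i)) A"
  using assms by (induction I rule: finite_induct) (auto intro: has_sum_add)

locale path_weights =
  fixes n :: nat
  assumes n2: "n \<ge> 2"
begin

definition wt :: "nat \<Rightarrow> real" where
  "wt Q = (real n - 1)\<^sup>2 / real n ^ Q"

text \<open>Moments are taken for the adjacency operator, 2 n times the Markov operator; the factor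
  n^j arises because every sign pattern of length j stands for n^j words. \<open>lim_coeff m\<close>
  is the integral of the m-th Ihara polynomial against the same measure.\<close>

definition lim_moment :: "nat \<Rightarrow> real" where
  "lim_moment j = real n ^ j * (\<Sum>bs\<in>sgn_words j. closed_weight (real n) bs)"

definition lim_coeff :: "nat \<Rightarrow> complex" where
  "lim_coeff m = (\<Sum>i\<le>degree (ihara_poly (2 * n) m). coeff (ihara_poly (2 * n) m) i * of_real (lim_moment i))"

lemma wt_nonneg [simp]: "wt Q \<ge> 0"
  by (simp add: wt_def)

lemma summable_wt: "(\<lambda>(Q, p). wt Q) summable_on path_pairs"
proof -
  have "(\<lambda>x. norm ((\<lambda>(Q, p). wt Q) x)) summable_on path_pairs"
    unfolding path_pairs_def Infinite_Sum.abs_summable_on_Sigma_iff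
  proof (intro conjI ballI)
    show "(\<lambda>p. norm (case (Q, p) of (Q, p) \<Rightarrow> wt Q)) summable_on {1..<Q}" for Q
      by (rule summable_on_finite) simp
    have "(\<lambda>Q. wt Q * real (Q - 1)) sums (inverse (real n) ^ 0)"
      unfolding wt_def using width_weights_sums[of "real n" 0] n2 by simp
    then have "summable (\<lambda>Q. norm (wt Q * real (Q - 1)))" by (auto dest: sums_summable simp: abs_mult)
    then have "(\<lambda>Q. norm (wt Q * real (Q - 1))) summable_on UNIV"
      by (intro norm_summable_imp_summable_on) simp
    then show "(\<lambda>Q. norm (\<Sum>\<^sub>\<infinity>p\<in>{1..<Q}. norm (case (Q, p) of (Q, p) \<Rightarrow> wt Q))) summable_on UNIV"
      by (rule summable_on_cong[THEN iffD1, rotated]) (simp add: abs_mult mult.commute)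
  qed
  then show ?thesis by (simp add: case_prod_unfold)
qed

lemma summable_wt_mult:
  fixes f :: "nat \<Rightarrow> nat \<Rightarrow> complex"
  assumes "\<And>Q p. p \<in> {1..<Q} \<Longrightarrow> norm (f Q p) \<le> B"
  shows "(\<lambda>x. norm (case x of (Q, p) \<Rightarrow> of_real (wt Q) * f Q p)) summable_on path_pairs"
proof (rule summable_on_comparison_test)
  show "(\<lambda>x. B * (case x of (Q, p) \<Rightarrow> wt Q)) summable_on path_pairs"
    by (rule summable_on_cmult_right[OF summable_wt])
  show "norm (case x of (Q, p) \<Rightarrow> of_real (wt Q) * f Q p) \<le> B * (case x of (Q, p) \<Rightarrow> wt Q)"
    if "x \<in> path_pairs" for x
  proof -
    obtain Q p where x: "x = (Q, p)" by (cases x)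
    then have x2: "p \<in> {1..<Q}" using that by (simp add: path_pairs_def)
    show ?thesis using mult_left_mono[OF assms[OF x2] wt_nonneg[of Q]] by (simp add: x norm_mult mult.commute)
  qed
qed simp

text \<open>For fixed Q the sum over p counts closed walks of length j in the path graph, up to n^j.
  Sorted by sign pattern, the sum over Q then produces \<open>closed_weight\<close> for each
  pattern.\<close>

lemma moment_has_sum:
  "((\<lambda>(Q, p). of_real (wt Q) * of_real (2 * real n * cos (real p / real Q * pi)) ^ j) has_sum
     (of_real (lim_moment j) :: complex)) path_pairs"
proof -
  let ?f = "\<lambda>Q p. (of_real (2 * real n * cos (real p / real Q * pi)) ^ j :: complex)"
  have bound: "norm (?f Q p) \<le> (2 * real n) ^ j" for Q p
    unfolding norm_power by (rule power_mono) (simp_all add: norm_mult abs_mult mult_left_le)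
  define Z where "Z = infsum (\<lambda>(Q, p). of_real (wt Q) * ?f Q p) path_pairs"
  have Z: "((\<lambda>(Q, p). of_real (wt Q) * ?f Q p) has_sum Z) (Sigma UNIV (\<lambda>Q. {1..<Q}))"
    using has_sum_infsum[OF abs_summable_summable[OF summable_wt_mult[of ?f, OF bound]]]
    unfolding Z_def path_pairs_def by simp
  have "((\<lambda>Q. of_real (wt Q * (\<Sum>p=1..<Q. (2 * real n * cos (real p / real Q * pi)) ^ j))) has_sum Z) UNIV"
  proof (rule has_sum_SigmaD[OF Z])
    show "((\<lambda>p. case (Q, p) of (Q, p) \<Rightarrow> of_real (wt Q) * ?f Q p) has_sum
        of_real (wt Q * (\<Sum>p=1..<Q. (2 * real n * cos (real p / real Q * pi)) ^ j))) {1..<Q}" for Q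
      by (rule has_sum_finiteI) (simp_all add: sum_distrib_left)
  qed
  then have s1: "(\<lambda>Q. of_real (wt Q * (\<Sum>p=1..<Q. (2 * real n * cos (real p / real Q * pi)) ^ j))) sums Z"
    by (rule has_sum_imp_sums)
  have "(\<lambda>Q. \<Sum>bs\<in>sgn_words j. wt Q * (\<Sum>x=1..<Q. of_bool (path_walk Q bs x x))) sums
      (\<Sum>bs\<in>sgn_words j. closed_weight (real n) bs)"
  proof (rule sums_sum)
    fix bs
    obtain m w q where s: "walk_shape bs = (m, w, q)" by (metis prod_cases3)
    show "(\<lambda>Q. wt Q * (\<Sum>x=1..<Q. of_bool (path_walk Q bs x x))) sums closed_weight (real n) bs"
    proof (cases "m = q")
      case True
      then show ?thesis using width_weights_sums[of "real n" w] n2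
        unfolding card_closed_path_walks[OF s] closed_weight_def s wt_def by simp
    next
      case False
      then show ?thesis unfolding card_closed_path_walks[OF s] closed_weight_def s by simp
    qed
  qed
  then have "(\<lambda>Q. real n ^ j * (wt Q * (\<Sum>p=1..<Q. (2 * cos (real p * pi / real Q)) ^ j))) sums lim_moment j"
    unfolding lim_moment_def by (simp only: sum_distrib_left[symmetric] path_closed_walks) (rule sums_mult)
  moreover have "real n ^ j * (wt Q * (\<Sum>p=1..<Q. (2 * cos (real p * pi / real Q)) ^ j)) =
      wt Q * (\<Sum>p=1..<Q. (2 * real n * cos (real p / real Q * pi)) ^ j)" for Q
  proof -
    have "real n ^ j * (2 * cos (real p * pi / real Q)) ^ j = (2 * real n * cos (real p / real Q * pi)) ^ j" for p
      by (simp only: power_mult_distrib[symmetric]) (simp add: mult_ac)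
    then show ?thesis by (simp only: mult.left_commute[of _ "wt Q"] sum_distrib_left)
  qed
  ultimately have "(\<lambda>Q. wt Q * (\<Sum>p=1..<Q. (2 * real n * cos (real p / real Q * pi)) ^ j)) sums lim_moment j"
    by (simp only:)
  then have "(\<lambda>Q. of_real (wt Q * (\<Sum>p=1..<Q. (2 * real n * cos (real p / real Q * pi)) ^ j))) sums (of_real (lim_moment j) :: complex)"
    by (rule sums_of_real)
  with s1 have "Z = of_real (lim_moment j)" by (rule sums_unique2)
  then show ?thesis using Z by (simp add: path_pairs_def)
qed

text \<open>With r the greatest common divisor, the pairs are multiples (q r, p r) of reduced
  fractions, along which f is constant by \<open>hom\<close>. The geometric series of n^(-q r) over
  r >= 1 is 1 / (n^q - 1), whence the exponents of the product.\<close>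

lemma coprime_reindex:
  fixes f :: "nat \<Rightarrow> nat \<Rightarrow> complex"
  assumes Z: "((\<lambda>(Q, p). of_real (wt Q) * f Q p) has_sum Z) path_pairs"
    and hom: "\<And>q p r. r \<ge> 1 \<Longrightarrow> f (q * r) (p * r) = f q p"
  shows "(\<lambda>q. \<Sum>p | 1 \<le> p \<and> p < q \<and> coprime p q. (of_nat n - 1)\<^sup>2 / (of_nat n ^ q - 1) * f q p) sums Z"
proof -
  let ?C = "\<lambda>q. {p. 1 \<le> p \<and> p < q \<and> coprime p q}"
  let ?E = "Sigma (Sigma UNIV ?C) (\<lambda>_. {1::nat..})"
  let ?j = "\<lambda>((q, p), r). (q * r, p * r)"
  have bij: "bij_betw ?j ?E path_pairs"
    unfolding bij_betw_def
  proof
    show "inj_on ?j ?E"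
    proof (rule inj_onI, clarsimp)
      fix q p r q' p' r' :: nat
      assume h: "Suc 0 \<le> p" "p < q" "coprime p q" "Suc 0 \<le> r" "Suc 0 \<le> p'" "p' < q'" "coprime p' q'" "Suc 0 \<le> r'"
        "q * r = q' * r'" "p * r = p' * r'"
      have "gcd (p * r) (q * r) = r" "gcd (p' * r') (q' * r') = r'"
        using gcd_mult_distrib_nat[of r p q] gcd_mult_distrib_nat[of r' p' q'] h(3,7) by (simp_all add: mult.commute)
      then have "r = r'" using h by simp
      then show "q = q' \<and> p = p' \<and> r = r'" using h by simp
    qed
    show "?j ` ?E = path_pairs"
    proof (intro equalityI subsetI)
      fix x assume "x \<in> ?j ` ?E"
      then show "x \<in> path_pairs" by (auto simp: path_pairs_def)
    next
      fix x assume "x \<in> path_pairs"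
      then obtain Q P where x: "x = (Q, P)" "1 \<le> P" "P < Q" by (auto simp: path_pairs_def)
      define r where "r = gcd P Q"
      have r: "r \<ge> 1" using x by (simp add: r_def Suc_le_eq)
      have "P = (P div r) * r" "Q = (Q div r) * r" by (simp_all add: r_def)
      moreover have "coprime (P div r) (Q div r)" unfolding r_def using x by (intro div_gcd_coprime) auto
      moreover have "1 \<le> P div r" "P div r < Q div r"
        using calculation x r by (metis Suc_le_eq One_nat_def mult_0 not_gr_zero, metis mult_less_cancel2)
      ultimately show "x \<in> ?j ` ?E"
        by (intro image_eqI[of _ _ "((Q div r, P div r), r)"]) (use r x in auto)
    qed
  qed
  have "((\<lambda>x. (\<lambda>(Q, p). of_real (wt Q) * f Q p) (?j x)) has_sum Z) ?E"
    using has_sum_reindex_bij_betw[OF bij, of "\<lambda>(Q, p). of_real (wt Q) * f Q p"] Z by simp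
  then have E: "((\<lambda>((q, p), r). of_real (wt (q * r)) * f (q * r) (p * r)) has_sum Z) ?E"
    by (simp add: case_prod_unfold)
  have "((\<lambda>(q, p). (of_nat n - 1)\<^sup>2 / (of_nat n ^ q - 1) * f q p) has_sum Z) (Sigma UNIV ?C)"
  proof (rule has_sum_SigmaD[OF E], goal_cases)
    case (1 y)
    then obtain q p where y: "y = (q, p)" and h: "1 \<le> p" "p < q" by (cases y) simp
    define x where "x = 1 / (of_nat n ^ q :: complex)"
    have big: "real n ^ q > 1" using n2 h by (intro one_less_power) auto
    then have x1: "norm x < 1" by (simp add: x_def norm_divide norm_power divide_less_eq)
    have "n ^ q \<noteq> 1" using n2 h by simp
    then have nz: "(of_nat n ^ q :: complex) \<noteq> 1" "(of_nat n ^ q :: complex) \<noteq> 0"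
      using n2 by (simp_all flip: of_nat_power)
    have "((\<lambda>r. (of_nat n - 1)\<^sup>2 * f q p * x ^ r) has_sum (of_nat n - 1)\<^sup>2 * f q p * (x / (1 - x))) {1..}"
      by (intro has_sum_cmult_right has_sum_geometric_from_1 x1)
    also have "x / (1 - x) = 1 / (of_nat n ^ q - 1)" using nz by (simp add: x_def field_simps)
    finally have "((\<lambda>r. (of_nat n - 1)\<^sup>2 * f q p * x ^ r) has_sum (of_nat n - 1)\<^sup>2 / (of_nat n ^ q - 1) * f q p) {1..}"
      by simp
    then show ?case
      unfolding y prod.case
      by (rule has_sum_cong[THEN iffD1, rotated]) (simp add: hom wt_def x_def power_mult power_one_over)
  qed
  then have "((\<lambda>q. \<Sum>p\<in>?C q. (of_nat n - 1)\<^sup>2 / (of_nat n ^ q - 1) * f q p) has_sum Z) UNIV"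
  proof (rule has_sum_SigmaD)
    fix q :: nat
    have "finite (?C q)" by simp
    then show "((\<lambda>p. case (q, p) of (q, p) \<Rightarrow> (of_nat n - 1)\<^sup>2 / (of_nat n ^ q - 1) * f q p) has_sum
        (\<Sum>p\<in>?C q. (of_nat n - 1)\<^sup>2 / (of_nat n ^ q - 1) * f q p)) (?C q)"
      by (intro has_sum_finiteI) simp_all
  qed
  then show ?thesis by (rule has_sum_imp_sums)
qed

lemma lim_coeff_has_sum:
  "((\<lambda>(Q, p). of_real (wt Q) * poly (ihara_poly (2 * n) m) (of_real (of_nat (2 * n) * cos (real p / real Q * pi))))
      has_sum lim_coeff m) path_pairs"
proof -
  let ?c = "coeff (ihara_poly (2 * n) m)"
  have "((\<lambda>x. \<Sum>i\<le>degree (ihara_poly (2 * n) m). ?c i *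
       (case x of (Q, p) \<Rightarrow> of_real (wt Q) * of_real (2 * real n * cos (real p / real Q * pi)) ^ i))
      has_sum lim_coeff m) path_pairs"
    unfolding lim_coeff_def by (intro has_sum_sum_finite has_sum_cmult_right moment_has_sum) simp
  then show ?thesis
    by (rule has_sum_cong[THEN iffD1, rotated])
       (auto simp: poly_altdef sum_distrib_left mult_ac)
qed

text \<open>A double series over m and the pairs (Q, p), dominated by the weights times 2 r^m with r
  < 1, is summed in both orders. Over the pairs first it gives the series of
  \<open>lim_coeff\<close>; over m first it gives weighted logarithms, which regrouped by reduced
  fractions exponentiate to the product.\<close>

theorem zeta_product:
  fixes t :: complex
  assumes t: "norm t * (2 * real n - 1) < 1"
  defines "F \<equiv> \<lambda>q. \<Prod>p | 1 \<le> p \<and> p < q \<and> coprime p q.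
               (1 - 2 * of_nat n * t * of_real (cos (real p / real q * pi)) + (2 * of_nat n - 1) * t\<^sup>2)
                 powr (- ((of_nat n - 1)\<^sup>2 / (of_nat n ^ q - 1)))"
  shows "convergent_prod (\<lambda>j. F (j + 2))"
    and "(\<Prod>j. F (j + 2)) = exp (\<Sum>m. lim_coeff m * (t ^ m / of_nat m))"
proof -
  define d where "d = 2 * n"
  have d: "d \<ge> 2" using n2 by (simp add: d_def)
  have t': "norm t * (real d - 1) < 1" using t by (simp add: d_def)
  define c where "c Q p = cos (real p / real Q * pi)" for Q p :: nat
  define g where "g Q p = - Ln (1 - t * of_nat d * of_real (c Q p) + (of_nat d - 1) * t\<^sup>2)" for Q p
  define h where "h m Q p = poly (ihara_poly d m) (of_real (of_nat d * c Q p)) * (t ^ m / of_nat m)" for m Q p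
  have c1: "\<bar>c Q p\<bar> \<le> 1" for Q p by (simp add: c_def)
  have nz: "1 - t * of_nat d * of_real (c Q p) + (of_nat d - 1) * t\<^sup>2 \<noteq> 0" for Q p
    by (rule ihara_log_series[OF d c1 t'])
  have hs: "(\<lambda>m. h m Q p) sums g Q p" for Q p
    unfolding h_def g_def by (rule ihara_log_series[OF d c1 t'])
  define r where "r = norm t * (real d - 1)"
  have r: "0 \<le> r" "r < 1" using t' d by (simp_all add: r_def)
  have hb: "norm (h m Q p) \<le> 2 * r ^ m" for m Q p
  proof -
    have "norm (t ^ m / of_nat m) \<le> norm t ^ m"
      using divide_left_mono[of 1 "real m" "norm t ^ m"]
      by (cases "m = 0") (simp_all add: norm_divide norm_power)
    then have "norm (h m Q p) \<le> 2 * (real d - 1) ^ m * norm t ^ m"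
      unfolding h_def norm_mult using norm_ihara_poly_le[OF d c1] d by (intro mult_mono) auto
    then show ?thesis by (simp add: r_def power_mult_distrib mult_ac)
  qed
  have rsum: "summable (\<lambda>m. 2 * r ^ m)" using r by (intro summable_mult summable_geometric) simp
  have hsm: "summable (\<lambda>m. norm (h m Q p))" for Q p
    by (rule summable_comparison_test'[OF rsum, of 0]) (use hb in simp)
  have hhs: "((\<lambda>m. h m Q p) has_sum g Q p) UNIV" for Q p
    by (rule norm_summable_imp_has_sum[OF hsm hs])
  let ?G = "\<lambda>(m::nat, Q, p). of_real (wt Q) * h m Q p"
  have abs: "(\<lambda>x. norm (?G x)) summable_on (Sigma UNIV (\<lambda>_. path_pairs))"
    unfolding Infinite_Sum.abs_summable_on_Sigma_iff
  proof (intro conjI ballI)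
    fix m :: nat
    show "(\<lambda>x. norm (?G (m, x))) summable_on path_pairs"
      using summable_wt_mult[of "h m", OF hb] by (simp add: case_prod_unfold)
  next
    define W where "W = infsum (\<lambda>(Q, p). wt Q) path_pairs"
    have "norm (\<Sum>\<^sub>\<infinity>x\<in>path_pairs. norm (?G (m, x))) \<le> norm (W * (2 * r ^ m))" for m
    proof -
      have "(\<Sum>\<^sub>\<infinity>x\<in>path_pairs. norm (?G (m, x))) \<le> (\<Sum>\<^sub>\<infinity>x\<in>path_pairs. (case x of (Q, p) \<Rightarrow> wt Q) * (2 * r ^ m))"
      proof (rule infsum_mono)
        show "(\<lambda>x. norm (?G (m, x))) summable_on path_pairs"
          using summable_wt_mult[of "h m", OF hb] by (simp add: case_prod_unfold)
        show "(\<lambda>x. (case x of (Q, p) \<Rightarrow> wt Q) * (2 * r ^ m)) summable_on path_pairs"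
          by (rule summable_on_cmult_left[OF summable_wt])
        show "norm (?G (m, x)) \<le> (case x of (Q, p) \<Rightarrow> wt Q) * (2 * r ^ m)" for x
          using hb by (cases x) (auto simp: norm_mult intro!: mult_left_mono)
      qed
      also have "\<dots> = W * (2 * r ^ m)"
        unfolding W_def by (rule infsum_cmult_left) (rule summable_wt)
      finally show ?thesis by (simp add: infsum_nonneg)
    qed
    moreover have "(\<lambda>m. norm (W * (2 * r ^ m))) summable_on (UNIV :: nat set)"
    proof (rule norm_summable_imp_summable_on)
      have "summable (\<lambda>m. \<bar>W\<bar> * (2 * r ^ m))" using rsum by (rule summable_mult)
      then show "summable (\<lambda>m. norm (norm (W * (2 * r ^ m))))" using r by (simp add: abs_mult)
    qed
    ultimately show "(\<lambda>m. norm (\<Sum>\<^sub>\<infinity>x\<in>path_pairs. norm (?G (m, x)))) summable_on UNIV"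
      by (rule Infinite_Sum.abs_summable_on_comparison_test[rotated])
  qed
  define Z where "Z = infsum ?G (UNIV \<times> path_pairs)"
  have Z: "(?G has_sum Z) (Sigma UNIV (\<lambda>_. path_pairs))"
    unfolding Z_def by (rule has_sum_infsum) (rule abs_summable_summable[OF abs])
  have "((\<lambda>m. lim_coeff m * (t ^ m / of_nat m)) has_sum Z) UNIV"
  proof (rule has_sum_SigmaD[OF Z])
    fix m :: nat
    have "((\<lambda>x. (case x of (Q, p) \<Rightarrow> of_real (wt Q) * poly (ihara_poly d m) (of_real (of_nat d * c Q p))) * (t ^ m / of_nat m))
        has_sum lim_coeff m * (t ^ m / of_nat m)) path_pairs"
      unfolding d_def c_def by (intro has_sum_cmult_left lim_coeff_has_sum)
    then show "((\<lambda>x. ?G (m, x)) has_sum lim_coeff m * (t ^ m / of_nat m)) path_pairs"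
      by (simp add: case_prod_unfold h_def mult.assoc)
  qed
  then have Z1: "(\<lambda>m. lim_coeff m * (t ^ m / of_nat m)) sums Z" by (rule has_sum_imp_sums)
  have Z': "((\<lambda>(x, m). ?G (m, x)) has_sum Z) (Sigma path_pairs (\<lambda>_. UNIV))"
    using Z has_sum_swap[where f = ?G and S = Z and A = UNIV and B = path_pairs] by blast
  have "((\<lambda>(Q, p). of_real (wt Q) * g Q p) has_sum Z) path_pairs"
  proof (rule has_sum_SigmaD[OF Z'])
    fix x :: "nat \<times> nat"
    obtain Q p where x: "x = (Q, p)" by (cases x)
    show "((\<lambda>m. case (x, m) of (x, m) \<Rightarrow> ?G (m, x)) has_sum (case x of (Q, p) \<Rightarrow> of_real (wt Q) * g Q p)) UNIV"
      using has_sum_cmult_right[OF hhs[of Q p], of "of_real (wt Q)"] by (simp add: x)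
  qed
  then have sums: "(\<lambda>q. \<Sum>p | 1 \<le> p \<and> p < q \<and> coprime p q. (of_nat n - 1)\<^sup>2 / (of_nat n ^ q - 1) * g q p) sums Z"
    by (rule coprime_reindex) (simp add: g_def c_def)
  let ?H = "\<lambda>q. \<Sum>p | 1 \<le> p \<and> p < q \<and> coprime p q. (of_nat n - 1)\<^sup>2 / (of_nat n ^ q - 1) * g q p"
  \<comment> \<open>For q = 0 and q = 1 there is no admissible p, so the product may start at q =
    2.\<close>
  have "{p. 1 \<le> p \<and> p < q \<and> coprime p q} = {}" if "q < 2" for q :: nat using that by auto
  then have "?H q = 0" if "q < 2" for q using that by (simp only: sum.empty)
  then have "(\<Sum>q<2. ?H q) = 0" by (intro sum.neutral) simp
  then have sums2: "(\<lambda>j. ?H (j + 2)) sums Z" using sums by (subst sums_iff_shift) simp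
  have F: "F q = exp (?H q)" for q :: nat
  proof -
    have "finite {p. 1 \<le> p \<and> p < q \<and> coprime p q}" by simp
    then have "exp (?H q) = (\<Prod>p | 1 \<le> p \<and> p < q \<and> coprime p q. exp ((of_nat n - 1)\<^sup>2 / (of_nat n ^ q - 1) * g q p))"
      by (rule exp_sum)
    also have "\<dots> = F q"
      unfolding F_def
    proof (rule prod.cong)
      fix p
      have e: "1 - 2 * of_nat n * t * of_real (cos (real p / real q * pi)) + (2 * of_nat n - 1) * t\<^sup>2 =
          1 - t * of_nat d * of_real (c q p) + (of_nat d - 1) * t\<^sup>2"
        by (simp add: d_def c_def mult_ac)
      show "exp ((of_nat n - 1)\<^sup>2 / (of_nat n ^ q - 1) * g q p) =
          (1 - 2 * of_nat n * t * of_real (cos (real p / real q * pi)) + (2 * of_nat n - 1) * t\<^sup>2)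
                 powr (- ((of_nat n - 1)\<^sup>2 / (of_nat n ^ q - 1)))"
        unfolding e powr_def g_def using nz[of q p] by simp
    qed simp
    finally show ?thesis by simp
  qed
  show "convergent_prod (\<lambda>j. F (j + 2))"
    unfolding F by (rule convergent_prod_exp) (rule sums_summable[OF sums2])
  show "(\<Prod>j. F (j + 2)) = exp (\<Sum>m. lim_coeff m * (t ^ m / of_nat m))"
    unfolding F prodinf_exp[OF sums_summable[OF sums2]]
    using sums_unique[OF sums2] sums_unique[OF Z1] by simp
qed

end

section \<open>Cayley machines\<close>

subsection \<open>Averaged products of generators\<close>

definition agree_from :: "nat \<Rightarrow> (nat \<Rightarrow> 'a) \<Rightarrow> (nat \<Rightarrow> 'a) \<Rightarrow> bool" where
  "agree_from j a b \<longleftrightarrow> (\<forall>i\<ge>j. a i = b i)"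

definition agree_below :: "nat \<Rightarrow> (nat \<Rightarrow> 'a) \<Rightarrow> (nat \<Rightarrow> 'a) \<Rightarrow> bool" where
  "agree_below k a b \<longleftrightarrow> (\<forall>i<k. a i = b i)"

definition splice :: "nat \<Rightarrow> (nat \<Rightarrow> 'a) \<Rightarrow> (nat \<Rightarrow> 'a) \<Rightarrow> nat \<Rightarrow> 'a" where
  "splice w c a = (\<lambda>i. if i < w then c i else a i)"

lemma agree_from_0: "agree_from 0 a b \<longleftrightarrow> a = b"
  by (auto simp: agree_from_def)

lemma agree_from_mono: "agree_from i a b \<Longrightarrow> i \<le> j \<Longrightarrow> agree_from j a b"
  by (auto simp: agree_from_def)

lemma agree_from_splice: "agree_from w (splice w c a) a"
  by (auto simp: agree_from_def splice_def)

lemma splice_eq: "agree_from w a b \<Longrightarrow> splice w c a = splice w c b"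
  by (auto simp: agree_from_def splice_def)

lemma splice_restrict: "agree_from w b a \<Longrightarrow> b = splice w (restrict b {..<w}) a"
proof
  fix i assume "agree_from w b a"
  then show "b i = splice w (restrict b {..<w}) a i"
    by (cases "i < w") (simp_all add: agree_from_def splice_def)
qed

lemma agree_from_trans: "agree_from i a b \<Longrightarrow> agree_from i b c \<Longrightarrow> agree_from i a c"
  by (auto simp: agree_from_def)

lemma agree_from_sym: "agree_from i a b \<Longrightarrow> agree_from i b a"
  by (auto simp: agree_from_def)

lemma agree_below_sym: "agree_below i a b \<Longrightarrow> agree_below i b a"
  by (auto simp: agree_below_def)

lemma agree_below_trans: "agree_below i a b \<Longrightarrow> agree_below i b c \<Longrightarrow> agree_below i a c"
  by (auto simp: agree_below_def)

lemma inj_on_pairI: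
  "(\<And>g c g' c'. g \<in> A \<Longrightarrow> g' \<in> A \<Longrightarrow> c \<in> B \<Longrightarrow> c' \<in> B \<Longrightarrow> \<phi> g c = \<phi> g' c' \<Longrightarrow> g = g' \<and> c = c') \<Longrightarrow>
    inj_on (\<lambda>(g, c). \<phi> g c) (A \<times> B)"
  by (auto simp: inj_on_def)

locale cayley_group = group G for G :: "('a, 'm) monoid_scheme" (structure) +
  fixes n :: nat
  assumes fin: "finite (carrier G)" and order: "n = Coset.order G" and nontrivial: "carrier G \<noteq> {\<one>}"
begin

lemma card_carrier: "card (carrier G) = n"
  using order by (simp add: Coset.order_def)

lemma n_ge2: "n \<ge> 2"
proof -
  obtain x where "x \<in> carrier G" "x \<noteq> \<one>" using nontrivial one_closed by blast
  then have "card {\<one>, x} \<le> card (carrier G)" using fin by (intro card_mono) auto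
  then show ?thesis using \<open>x \<noteq> \<one>\<close> by (simp add: card_carrier)
qed

sublocale path_weights n
  by unfold_locales (rule n_ge2)

section \<open>The generators as maps of infinite words\<close>

primrec cay :: "'a \<Rightarrow> (nat \<Rightarrow> 'a) \<Rightarrow> nat \<Rightarrow> 'a" where
  "cay g a 0 = g \<otimes> a 0"
| "cay g a (Suc i) = cay g a i \<otimes> a (Suc i)"

primrec icay :: "'a \<Rightarrow> (nat \<Rightarrow> 'a) \<Rightarrow> nat \<Rightarrow> 'a" where
  "icay g b 0 = inv g \<otimes> b 0"
| "icay g b (Suc i) = inv (b i) \<otimes> b (Suc i)"

abbreviation "iwords \<equiv> infinite_words (carrier G)"

abbreviation "T \<equiv> cay \<one>"

abbreviation "V \<equiv> icay \<one>"

lemma iwordsD [simp]: "a \<in> iwords \<Longrightarrow> a i \<in> carrier G"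
  by (auto simp: infinite_words_def)

lemma iwordsI: "(\<And>i. a i \<in> carrier G) \<Longrightarrow> a \<in> iwords"
  by (auto simp: infinite_words_def)

lemma cay_closed [simp]: "g \<in> carrier G \<Longrightarrow> a \<in> iwords \<Longrightarrow> cay g a \<in> iwords"
proof (rule iwordsI)
  fix i assume "g \<in> carrier G" "a \<in> iwords"
  then show "cay g a i \<in> carrier G" by (induction i) auto
qed

lemma icay_closed [simp]: "g \<in> carrier G \<Longrightarrow> a \<in> iwords \<Longrightarrow> icay g a \<in> iwords"
proof (rule iwordsI)
  fix i assume "g \<in> carrier G" "a \<in> iwords"
  then show "icay g a i \<in> carrier G" by (cases i) auto
qed

lemma icay_cay [simp]:
  assumes "g \<in> carrier G" "a \<in> iwords" shows "icay g (cay g a) = a"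
proof
  fix i show "icay g (cay g a) i = a i"
    using assms cay_closed[OF assms] by (cases i) (simp_all add: m_assoc[symmetric])
qed

lemma cay_icay [simp]:
  assumes "g \<in> carrier G" "a \<in> iwords" shows "cay g (icay g a) = a"
proof
  fix i show "cay g (icay g a) i = a i"
    using assms by (induction i) (simp_all add: m_assoc[symmetric])
qed

lemma upd_closed [simp]: "a \<in> iwords \<Longrightarrow> x \<in> carrier G \<Longrightarrow> a(i := x) \<in> iwords"
  by (auto simp: infinite_words_def)

text \<open>Only the first letter sees g: the generator is T after a left multiplication of the
  first letter, and by \<open>icay_upd\<close> its inverse is V followed by a change of the first
  letter. Summing over g thus averages over the first letter, before T or after V.\<close>

lemma cay_upd:
  assumes "g \<in> carrier G" "a \<in> iwords" shows "cay g a = T (a(0 := g \<otimes> a 0))"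
proof
  fix i show "cay g a i = T (a(0 := g \<otimes> a 0)) i"
    using assms by (induction i) auto
qed

lemma icay_upd:
  assumes "g \<in> carrier G" "a \<in> iwords" shows "icay g a = (V a)(0 := inv g \<otimes> a 0)"
proof
  fix i show "icay g a i = ((V a)(0 := inv g \<otimes> a 0)) i" by (cases i) auto
qed

lemma cay_below: "agree_below k a b \<Longrightarrow> agree_below k (cay g a) (cay g b)"
  unfolding agree_below_def
proof (intro allI impI)
  fix i assume ab: "\<forall>i<k. a i = b i" and "i < k"
  then show "cay g a i = cay g b i" by (induction i) auto
qed

lemma icay_below: "agree_below k a b \<Longrightarrow> agree_below k (icay g a) (icay g b)"
  unfolding agree_below_def
proof (intro allI impI)
  fix i assume "\<forall>i<k. a i = b i" and "i < k"
  then show "icay g a i = icay g b i" by (cases i) auto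
qed

lemma funpow_closed [simp]:
  "a \<in> iwords \<Longrightarrow> (T ^^ i) a \<in> iwords" "a \<in> iwords \<Longrightarrow> (V ^^ i) a \<in> iwords"
  by (induction i) auto

lemma V_T_funpow [simp]: "a \<in> iwords \<Longrightarrow> (V ^^ i) ((T ^^ i) a) = a"
proof (induction i)
  case (Suc i)
  have "(V ^^ Suc i) ((T ^^ Suc i) a) = (V ^^ i) (V (T ((T ^^ i) a)))"
    by (simp only: funpow_Suc_right[of i V] funpow.simps(2)[of i T] o_apply)
  then show ?case using Suc by simp
qed simp

lemma T_V_funpow [simp]: "a \<in> iwords \<Longrightarrow> (T ^^ i) ((V ^^ i) a) = a"
proof (induction i)
  case (Suc i)
  have "(T ^^ Suc i) ((V ^^ Suc i) a) = (T ^^ i) (T (V ((V ^^ i) a)))"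
    by (simp only: funpow_Suc_right[of i T] funpow.simps(2)[of i V] o_apply)
  then show ?case using Suc by simp
qed simp

lemma T_funpow_below: "agree_below k a b \<Longrightarrow> agree_below k ((T ^^ i) a) ((T ^^ i) b)"
  by (induction i) (auto intro: cay_below)

lemma V_funpow_below: "agree_below k a b \<Longrightarrow> agree_below k ((V ^^ i) a) ((V ^^ i) b)"
  by (induction i) (auto intro: icay_below)

lemma V_from: "agree_from j a b \<Longrightarrow> agree_from (Suc j) (V a) (V b)"
  unfolding agree_from_def
proof (intro allI impI)
  fix i assume h: "\<forall>i\<ge>j. a i = b i" "Suc j \<le> i"
  then obtain i' where "i = Suc i'" "j \<le> i'" by (metis Suc_le_D Suc_le_mono)
  then show "V a i = V b i" using h by simp
qed

lemma V_funpow_from: "agree_from j a b \<Longrightarrow> agree_from (j + i) ((V ^^ i) a) ((V ^^ i) b)"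
  by (induction i) (simp_all add: V_from)

text \<open>The letter of V a at j + 1 is the quotient of two neighbouring letters of a, so a letter
  is recovered from the next one and from V a. All reconstructions from right to left rest on
  this.\<close>

lemma letter_from_next:
  assumes "a \<in> iwords" shows "a j = a (Suc j) \<otimes> inv (V a (Suc j))"
  using assms by (simp add: inv_mult_group m_assoc[symmetric])

lemma agree_from_step:
  assumes "a \<in> iwords" "b \<in> iwords" "agree_from (Suc j) a b" "agree_from (Suc j) (V a) (V b)"
  shows "agree_from j a b"
proof -
  have "a j = b j"
    using letter_from_next[OF assms(1), of j] letter_from_next[OF assms(2), of j] assms(3,4)
    unfolding agree_from_def by (metis order_refl)
  then show ?thesis using assms(3) unfolding agree_from_def by (metis le_antisym not_less_eq_eq)
qed

text \<open>Read contrapositively: V moves the last position at which two words differ exactly one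
  place to the right, so a last difference at j reappears after i steps at j + i.\<close>

lemma agree_from_V_funpow:
  "a \<in> iwords \<Longrightarrow> b \<in> iwords \<Longrightarrow> agree_from (Suc j) a b \<Longrightarrow>
    agree_from (j + i) ((V ^^ i) a) ((V ^^ i) b) \<Longrightarrow> agree_from j a b"
proof (induction i arbitrary: a b j)
  case (Suc i)
  have "agree_from (Suc (Suc j)) (V a) (V b)" using Suc.prems by (intro V_from)
  moreover have "agree_from (Suc j + i) ((V ^^ i) (V a)) ((V ^^ i) (V b))"
    using Suc.prems(4) by (simp add: funpow_swap1)
  ultimately have "agree_from (Suc j) (V a) (V b)"
    by (rule Suc.IH[rotated 2]) (use Suc.prems in simp_all)
  then show ?case by (rule agree_from_step[OF Suc.prems(1-3)])
qed simp

abbreviation pwords :: "nat \<Rightarrow> (nat \<Rightarrow> 'a) set" where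
  "pwords k \<equiv> PiE {..<k} (\<lambda>_. carrier G)"

lemma finite_pwords [simp]: "finite (pwords k)"
  using fin by (intro finite_PiE) simp_all

lemma card_pwords: "card (pwords k) = n ^ k"
  using card_PiE[of "{..<k}" "\<lambda>_. carrier G"] by (simp only: finite_lessThan card_carrier prod_constant card_lessThan)

lemma splice_closed [simp]: "c \<in> pwords w \<Longrightarrow> a \<in> iwords \<Longrightarrow> splice w c a \<in> iwords"
  by (rule iwordsI) (auto simp: splice_def dest: PiE_mem)

lemma pwords_restrict: "a \<in> iwords \<Longrightarrow> restrict a {..<k} \<in> pwords k"
  by (simp add: restrict_PiE_iff)

lemma pwords_eqI: "c \<in> pwords k \<Longrightarrow> c' \<in> pwords k \<Longrightarrow> agree_below k c c' \<Longrightarrow> c = c'"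
  unfolding agree_below_def by (rule PiE_ext) auto

definition avg0 :: "((nat \<Rightarrow> 'a) \<Rightarrow> real) \<Rightarrow> (nat \<Rightarrow> 'a) \<Rightarrow> real" where
  "avg0 f a = (\<Sum>g\<in>carrier G. f (a(0 := g))) / real n"

definition avg :: "nat \<Rightarrow> ((nat \<Rightarrow> 'a) \<Rightarrow> real) \<Rightarrow> (nat \<Rightarrow> 'a) \<Rightarrow> real" where
  "avg w f a = (\<Sum>c\<in>pwords w. f (splice w c a)) / real n ^ w"

text \<open>The average of \<open>f\<close> over the images of \<open>a\<close> under all words of generators with the signs \<open>bs\<close>.\<close>

primrec wop :: "bool list \<Rightarrow> ((nat \<Rightarrow> 'a) \<Rightarrow> real) \<Rightarrow> (nat \<Rightarrow> 'a) \<Rightarrow> real" where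
  "wop [] f a = f a"
| "wop (b # bs) f a = (if b then avg0 (\<lambda>x. wop bs f (T x)) a else avg0 (wop bs f) (V a))"

lemma avg_cong_from: "agree_from w a b \<Longrightarrow> avg w f a = avg w f b"
  unfolding avg_def by (simp add: splice_eq)

lemma avg0_cong: "a \<in> iwords \<Longrightarrow> (\<And>x. x \<in> iwords \<Longrightarrow> f x = g x) \<Longrightarrow> avg0 f a = avg0 g a"
  unfolding avg0_def by simp

lemma avg0_const: "(\<And>g. g \<in> carrier G \<Longrightarrow> f (a(0 := g)) = r) \<Longrightarrow> avg0 f a = r"
  using n_ge2 by (simp add: avg0_def card_carrier)

text \<open>A counting argument: \<phi> injects n^(w + 1) pairs into the image of \<psi>, which has
  at most n^(w + 1) points. Hence both maps are bijections onto the same set, and no inverse has to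
  be written down.\<close>

lemma avg0_avg:
  assumes inj: "inj_on (\<lambda>(g, c). \<phi> g c) (carrier G \<times> pwords w)"
    and sub: "\<And>g c. g \<in> carrier G \<Longrightarrow> c \<in> pwords w \<Longrightarrow> \<phi> g c \<in> \<psi> ` pwords (Suc w)"
  shows "(\<Sum>g\<in>carrier G. (\<Sum>c\<in>pwords w. f (\<phi> g c)) / real n ^ w) / real n =
    (\<Sum>c\<in>pwords (Suc w). f (\<psi> c)) / real n ^ Suc w"
proof -
  let ?A = "carrier G \<times> pwords w" and ?\<phi> = "\<lambda>(g, c). \<phi> g c"
  have cA: "card ?A = n ^ Suc w" by (simp add: card_cartesian_product card_carrier card_pwords)
  have s: "?\<phi> ` ?A \<subseteq> \<psi> ` pwords (Suc w)" using sub by auto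
  have c1: "card (?\<phi> ` ?A) = n ^ Suc w" using card_image[OF inj] cA by simp
  have "card (\<psi> ` pwords (Suc w)) \<le> n ^ Suc w"
    using card_image_le[OF finite_pwords, of \<psi> "Suc w"] by (simp add: card_pwords)
  moreover have "card (?\<phi> ` ?A) \<le> card (\<psi> ` pwords (Suc w))" by (rule card_mono[OF _ s]) simp
  ultimately have c2: "card (\<psi> ` pwords (Suc w)) = n ^ Suc w" using c1 by simp
  have eq: "?\<phi> ` ?A = \<psi> ` pwords (Suc w)" by (rule card_subset_eq[OF _ s]) (simp_all add: c1 c2)
  have inj2: "inj_on \<psi> (pwords (Suc w))" by (rule eq_card_imp_inj_on) (simp_all add: c2 card_pwords)
  have "(\<Sum>g\<in>carrier G. \<Sum>c\<in>pwords w. f (\<phi> g c)) = (\<Sum>x\<in>?A. f (?\<phi> x))"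
    by (simp add: sum.cartesian_product case_prod_unfold)
  also have "\<dots> = sum f (?\<phi> ` ?A)" using inj by (simp add: sum.reindex)
  also have "\<dots> = (\<Sum>c\<in>pwords (Suc w). f (\<psi> c))" unfolding eq using inj2 by (simp add: sum.reindex)
  finally show ?thesis by (simp add: sum_divide_distrib[symmetric])
qed

lemma splice_inj:
  assumes "splice w c a = splice w c' a'" "c \<in> pwords w" "c' \<in> pwords w"
  shows "c = c' \<and> agree_from w a a'"
proof
  have eq: "(if i < w then c i else a i) = (if i < w then c' i else a' i)" for i
    using fun_cong[OF assms(1), of i] by (simp add: splice_def)
  show "c = c'" using assms(2,3) eq by (intro pwords_eqI) (auto simp: agree_below_def dest: spec, metis)
  show "agree_from w a a'" unfolding agree_from_def using eq by (metis not_le)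
qed

text \<open>The first letter g multiplies every letter of the T-image from the left, so g can be
  read off at position w, which the splice leaves untouched; this gives injectivity. The V-images of
  the results agree with a from position w + 1 on, which gives the inclusion.\<close>

lemma avg0_T_avg:
  assumes a: "a \<in> iwords"
  shows "avg0 (\<lambda>x. avg w f (T x)) a = avg (Suc w) (\<lambda>b. f (T b)) a"
  unfolding avg0_def avg_def
proof (rule avg0_avg[where f = f and \<phi> = "\<lambda>g c. splice w c (T (a(0 := g)))" and \<psi> = "\<lambda>c. T (splice (Suc w) c a)"])
  show "inj_on (\<lambda>(g, c). splice w c (T (a(0 := g)))) (carrier G \<times> pwords w)"
  proof (rule inj_on_pairI)
    fix g c g' c' assume g: "g \<in> carrier G" "g' \<in> carrier G" and c: "c \<in> pwords w" "c' \<in> pwords w"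
      and eq: "splice w c (T (a(0 := g))) = splice w c' (T (a(0 := g')))"
    have "agree_from w (T (a(0 := g))) (T (a(0 := g')))" "c = c'" using splice_inj[OF eq c] by auto
    moreover have "T (a(0 := x)) i = x \<otimes> T (a(0 := \<one>)) i" if "x \<in> carrier G" for x i
    proof (induction i)
      case (Suc i)
      have t: "T (a(0 := \<one>)) i \<in> carrier G" using a cay_closed[of \<one> "a(0 := \<one>)"] by simp
      have "T (a(0 := x)) (Suc i) = x \<otimes> T (a(0 := \<one>)) i \<otimes> a (Suc i)"
        by (simp only: cay.simps(2) Suc.IH fun_upd_other[OF nat.distinct(2)])
      also have "\<dots> = x \<otimes> (T (a(0 := \<one>)) i \<otimes> a (Suc i))" using a by (intro m_assoc that t) simp
      finally show ?case by (simp only: cay.simps(2) fun_upd_other[OF nat.distinct(2)])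
    qed (use that in simp)
    moreover have "T (a(0 := \<one>)) w \<in> carrier G" using a cay_closed[of \<one> "a(0 := \<one>)"] by simp
    ultimately have "g \<otimes> T (a(0 := \<one>)) w = g' \<otimes> T (a(0 := \<one>)) w"
      using g unfolding agree_from_def by (metis order_refl)
    then show "g = g' \<and> c = c'" using g \<open>T (a(0 := \<one>)) w \<in> carrier G\<close> \<open>c = c'\<close> by simp
  qed
next
  fix g c assume g: "g \<in> carrier G" and c: "c \<in> pwords w"
  let ?b = "splice w c (T (a(0 := g)))"
  have b: "?b \<in> iwords" using g c a by simp
  have 1: "agree_from (Suc w) (V ?b) (V (T (a(0 := g))))" by (intro V_from agree_from_splice)
  have 2: "V (T (a(0 := g))) = a(0 := g)" using g a by simp
  have 3: "agree_from (Suc w) (a(0 := g)) a" by (simp add: agree_from_def)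
  from 1 3 have "agree_from (Suc w) (V ?b) a" unfolding 2 by (rule agree_from_trans)
  then have eq: "V ?b = splice (Suc w) (restrict (V ?b) {..<Suc w}) a"
    by (rule splice_restrict)
  have "?b = T (splice (Suc w) (restrict (V ?b) {..<Suc w}) a)"
    using cay_icay[OF one_closed b] unfolding eq[symmetric] by (rule sym)
  moreover have "restrict (V ?b) {..<Suc w} \<in> pwords (Suc w)" using b by (intro pwords_restrict) simp
  ultimately show "?b \<in> (\<lambda>c. T (splice (Suc w) c a)) ` pwords (Suc w)" by (rule image_eqI)
qed

text \<open>A change of the first letter becomes, after w steps of V, a change of letter w with
  nothing beyond it. So the average over the first letter supplies exactly the one letter that the
  average over the first w letters is missing.\<close>

lemma avg0_V_avg:
  assumes a: "a \<in> iwords"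
  shows "avg0 (\<lambda>x. avg w f ((V ^^ w) x)) a = avg (Suc w) f ((V ^^ w) a)"
  unfolding avg0_def avg_def
proof (rule avg0_avg[where f = f and \<phi> = "\<lambda>g c. splice w c ((V ^^ w) (a(0 := g)))" and \<psi> = "\<lambda>c. splice (Suc w) c ((V ^^ w) a)"])
  show "inj_on (\<lambda>(g, c). splice w c ((V ^^ w) (a(0 := g)))) (carrier G \<times> pwords w)"
  proof (rule inj_on_pairI)
    fix g c g' c' assume g: "g \<in> carrier G" "g' \<in> carrier G" and c: "c \<in> pwords w" "c' \<in> pwords w"
      and eq: "splice w c ((V ^^ w) (a(0 := g))) = splice w c' ((V ^^ w) (a(0 := g')))"
    have h: "agree_from (0 + w) ((V ^^ w) (a(0 := g))) ((V ^^ w) (a(0 := g')))" and "c = c'"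
      using splice_inj[OF eq c] by simp_all
    have s: "agree_from (Suc 0) (a(0 := g)) (a(0 := g'))" by (simp add: agree_from_def)
    have "agree_from 0 (a(0 := g)) (a(0 := g'))"
      by (rule agree_from_V_funpow[OF upd_closed[OF a g(1)] upd_closed[OF a g(2)] s h])
    then have "(a(0 := g)) 0 = (a(0 := g')) 0" unfolding agree_from_def by blast
    then show "g = g' \<and> c = c'" using \<open>c = c'\<close> by simp
  qed
next
  fix g c assume g: "g \<in> carrier G" and c: "c \<in> pwords w"
  let ?b = "splice w c ((V ^^ w) (a(0 := g)))"
  have b: "?b \<in> iwords" using g c a by simp
  have "agree_from (Suc 0 + w) ((V ^^ w) (a(0 := g))) ((V ^^ w) a)"
    by (rule V_funpow_from) (simp add: agree_from_def)
  then have 1: "agree_from (Suc w) ((V ^^ w) (a(0 := g))) ((V ^^ w) a)" by simp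
  have "agree_from (Suc w) ?b ((V ^^ w) a)"
    by (rule agree_from_trans[OF agree_from_mono[OF agree_from_splice] 1]) simp
  then have "?b = splice (Suc w) (restrict ?b {..<Suc w}) ((V ^^ w) a)"
    by (rule splice_restrict)
  moreover have "restrict ?b {..<Suc w} \<in> pwords (Suc w)" using b by (rule pwords_restrict)
  ultimately show "?b \<in> (\<lambda>c. splice (Suc w) c ((V ^^ w) a)) ` pwords (Suc w)" by (rule image_eqI)
qed

text \<open>Normal form of a product of averaged generators: V^m, then the average over w letters,
  then T^q. A new T in front cancels a V or, if the old m is 0, widens the average by one letter; a
  new V widens the average only if the old m equals w. In the other cases the new average over the
  first letter is absorbed, since its effect stays within the averaged letters.\<close>

lemma wop_shape:
  "walk_shape bs = (m, w, q) \<Longrightarrow> a \<in> iwords \<Longrightarrow> wop bs f a = avg w (\<lambda>b. f ((T ^^ q) b)) ((V ^^ m) a)"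
proof (induction bs arbitrary: m w q a rule: walk_shape.induct)
  case 1
  then show ?case by (auto simp: avg_def splice_def)
next
  case (2 bs)
  obtain m' w' q' where s: "walk_shape bs = (m', w', q')" by (metis prod_cases3)
  let ?N = "avg w' (\<lambda>b. f ((T ^^ q') b))"
  have "wop (True # bs) f a = avg0 (\<lambda>x. ?N ((V ^^ m') (T x))) a"
    using 2 s by (auto intro!: avg0_cong)
  also have "\<dots> = avg w (\<lambda>b. f ((T ^^ q) b)) ((V ^^ m) a)"
  proof (cases m')
    case 0
    then have "m = 0" "w = Suc w'" "q = Suc q'" using 2(2) s by auto
    then show ?thesis using avg0_T_avg[OF 2(3), of w' "\<lambda>b. f ((T ^^ q') b)"] 0
      by (simp add: funpow_swap1)
  next
    case (Suc k)
    then have mwq: "m = k" "w = w'" "q = q'" using 2(2) s by auto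
    have "avg0 (\<lambda>x. ?N ((V ^^ m') (T x))) a = avg0 (\<lambda>x. ?N ((V ^^ k) x)) a"
      using 2(3) Suc by (intro avg0_cong) (auto simp: funpow_swap1)
    also have "\<dots> = ?N ((V ^^ k) a)"
    proof (rule avg0_const, rule avg_cong_from)
      fix g
      have "agree_from (Suc 0 + k) ((V ^^ k) (a(0 := g))) ((V ^^ k) a)"
        by (rule V_funpow_from) (simp add: agree_from_def)
      then show "agree_from w' ((V ^^ k) (a(0 := g))) ((V ^^ k) a)"
        using walk_shape_le[OF s] Suc by (auto intro: agree_from_mono)
    qed
    finally show ?thesis using mwq by simp
  qed
  finally show ?case .
next
  case (3 bs)
  obtain m' w' q' where s: "walk_shape bs = (m', w', q')" by (metis prod_cases3)
  let ?N = "avg w' (\<lambda>b. f ((T ^^ q') b))"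
  have Va: "V a \<in> iwords" using 3 by simp
  have "wop (False # bs) f a = avg0 (\<lambda>x. ?N ((V ^^ m') x)) (V a)"
    using 3 s Va by (auto intro!: avg0_cong)
  also have "\<dots> = avg w (\<lambda>b. f ((T ^^ q) b)) ((V ^^ m) a)"
  proof (cases "m' < w'")
    case False
    then have "m' = w'" "m = Suc w'" "w = Suc w'" "q = q'" using 3(2) s walk_shape_le[OF s] by auto
    then show ?thesis using avg0_V_avg[OF Va, of w' "\<lambda>b. f ((T ^^ q') b)"]
      by (simp add: funpow_swap1)
  next
    case True
    then have mwq: "m = Suc m'" "w = w'" "q = q'" using 3(2) s by auto
    have "avg0 (\<lambda>x. ?N ((V ^^ m') x)) (V a) = ?N ((V ^^ m') (V a))"
    proof (rule avg0_const, rule avg_cong_from)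
      fix g
      have "agree_from (Suc 0 + m') ((V ^^ m') ((V a)(0 := g))) ((V ^^ m') (V a))"
        by (rule V_funpow_from) (simp add: agree_from_def)
      then show "agree_from w' ((V ^^ m') ((V a)(0 := g))) ((V ^^ m') (V a))"
        using True by (auto intro: agree_from_mono)
    qed
    then show ?thesis using mwq by (simp add: funpow_swap1)
  qed
  finally show ?case .
qed

section \<open>Normalized traces on the words of length k\<close>

definition pad :: "nat \<Rightarrow> (nat \<Rightarrow> 'a) \<Rightarrow> nat \<Rightarrow> 'a" where
  "pad k v = (\<lambda>i. if i < k then v i else \<one>)"

lemma pad_closed [simp]: "v \<in> pwords k \<Longrightarrow> pad k v \<in> iwords"
  by (rule iwordsI) (auto simp: pad_def dest: PiE_mem)

lemma agree_below_pad: "agree_below k (pad k v) v"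
  by (auto simp: agree_below_def pad_def)

definition wtrace :: "nat \<Rightarrow> bool list \<Rightarrow> real" where
  "wtrace k bs = (\<Sum>v\<in>pwords k. wop bs (\<lambda>b. of_bool (agree_below k b (pad k v))) (pad k v))"

text \<open>The diagonal entries of the normal form in \<open>wop_shape\<close>: each choice c of
  the averaged letters that brings v back contributes n^(-w) to the trace.\<close>

definition closed_pairs :: "nat \<Rightarrow> nat \<Rightarrow> nat \<Rightarrow> nat \<Rightarrow> ((nat \<Rightarrow> 'a) \<times> (nat \<Rightarrow> 'a)) set" where
  "closed_pairs k m w q = {(v, c) \<in> pwords k \<times> pwords w.
     agree_below k ((T ^^ q) (splice w c ((V ^^ m) (pad k v)))) (pad k v)}"

lemma wtrace_shape:
  assumes s: "walk_shape bs = (m, w, q)"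
  shows "wtrace k bs = real (card (closed_pairs k m w q)) / real n ^ w"
proof -
  have "wtrace k bs = (\<Sum>v\<in>pwords k. (\<Sum>c\<in>pwords w.
      of_bool (agree_below k ((T ^^ q) (splice w c ((V ^^ m) (pad k v)))) (pad k v))) / real n ^ w)"
    unfolding wtrace_def by (rule sum.cong[OF refl]) (simp add: wop_shape[OF s] avg_def)
  also have "\<dots> = (\<Sum>x\<in>pwords k \<times> pwords w. of_bool (x \<in> closed_pairs k m w q)) / real n ^ w"
    unfolding sum_divide_distrib[symmetric] sum.cartesian_product
    by (intro arg_cong2[where f = "(/)"] sum.cong) (auto simp: closed_pairs_def)
  also have "(\<Sum>x\<in>pwords k \<times> pwords w. of_bool (x \<in> closed_pairs k m w q)) =
      real (card ((pwords k \<times> pwords w) \<inter> closed_pairs k m w q))"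
    by (simp add: of_bool_def sum.If_cases Int_def)
  also have "(pwords k \<times> pwords w) \<inter> closed_pairs k m w q = closed_pairs k m w q"
    by (auto simp: closed_pairs_def)
  finally show ?thesis .
qed

text \<open>After T^m is cancelled, the pair closes up only if c repeats the letters that it
  replaces, so each v has exactly one c.\<close>

lemma card_closed_pairs_balanced:
  assumes "w \<le> k" shows "card (closed_pairs k m w m) = n ^ k"
proof -
  have iff: "(v, c) \<in> closed_pairs k m w m \<longleftrightarrow> v \<in> pwords k \<and> c = restrict ((V ^^ m) (pad k v)) {..<w}" for v c
  proof (cases "v \<in> pwords k")
    case True
    let ?b = "(V ^^ m) (pad k v)"
    have b: "?b \<in> iwords" using True by simp
    show ?thesis
    proof
      assume h: "(v, c) \<in> closed_pairs k m w m"
      then have c: "c \<in> pwords w" and ag: "agree_below k ((T ^^ m) (splice w c ?b)) (pad k v)"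
        by (auto simp: closed_pairs_def)
      have "agree_below k ((V ^^ m) ((T ^^ m) (splice w c ?b))) ?b" using V_funpow_below[OF ag] .
      then have ag': "agree_below k (splice w c ?b) ?b" using c b by simp
      have "agree_below w c (restrict ?b {..<w})"
        unfolding agree_below_def
      proof (intro allI impI)
        fix i assume "i < w"
        then show "c i = restrict ?b {..<w} i"
          using ag'[unfolded agree_below_def splice_def, rule_format, of i] assms by simp
      qed
      with c pwords_restrict[OF b] have "c = restrict ?b {..<w}" by (rule pwords_eqI)
      then show "v \<in> pwords k \<and> c = restrict ?b {..<w}" using True by simp
    next
      assume "v \<in> pwords k \<and> c = restrict ?b {..<w}"
      then have c: "c = restrict ?b {..<w}" by simp
      have "splice w c ?b = ?b" by (simp add: c splice_def fun_eq_iff)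
      then show "(v, c) \<in> closed_pairs k m w m"
        using True b pwords_restrict[OF b, of w] by (auto simp: closed_pairs_def c agree_below_def)
    qed
  qed (auto simp: closed_pairs_def)
  have "closed_pairs k m w m = (\<lambda>v. (v, restrict ((V ^^ m) (pad k v)) {..<w})) ` pwords k"
    using iff by auto
  moreover have "inj_on (\<lambda>v. (v, restrict ((V ^^ m) (pad k v)) {..<w})) (pwords k)" by (rule inj_onI) simp
  ultimately show ?thesis by (simp only: card_image card_pwords)
qed

text \<open>Words whose letters from position \<open>w\<close> on are periodic under \<open>T ^^ h\<close> are determined by few letters:
  the columns of their orbit can be reconstructed from right to left.\<close>

lemma periodic_agree:
  assumes x: "x \<in> iwords" "y \<in> iwords" and "h \<ge> 1"
    and px: "\<And>j. w \<le> j \<Longrightarrow> j < k \<Longrightarrow> (T ^^ h) x j = x j"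
    and py: "\<And>j. w \<le> j \<Longrightarrow> j < k \<Longrightarrow> (T ^^ h) y j = y j"
    and first: "agree_below w x y"
    and last: "\<And>i. i < h \<Longrightarrow> (T ^^ i) x (k - 1) = (T ^^ i) y (k - 1)"
  shows "agree_below k x y"
proof -
  have col: "\<forall>i\<le>h. (T ^^ i) x j = (T ^^ i) y j" if "w \<le> j" "j < k" for j
    using that
  proof (induction "k - 1 - j" arbitrary: j)
    case 0
    then have "j = k - 1" by simp
    then have "\<forall>i<h. (T ^^ i) x j = (T ^^ i) y j" using last by simp
    moreover have "(T ^^ h) x j = (T ^^ h) y j"
      using px[of j] py[of j] 0 calculation[rule_format, of 0] assms(3) by simp
    ultimately show ?case by (auto simp: le_less)
  next
    case (Suc l)
    have IH: "\<forall>i\<le>h. (T ^^ i) x (Suc j) = (T ^^ i) y (Suc j)"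
      using Suc.hyps(1)[of "Suc j"] Suc.hyps(2) Suc.prems by simp
    have step: "(T ^^ Suc i) x j = (T ^^ Suc i) y j" if "Suc i \<le> h" for i
    proof -
      have V: "V ((T ^^ Suc i) z) = (T ^^ i) z" if "z \<in> iwords" for z using that by simp
      show ?thesis
        using letter_from_next[of "(T ^^ Suc i) x" j] letter_from_next[of "(T ^^ Suc i) y" j]
          V[OF x(1)] V[OF x(2)] IH that x funpow_closed
        by (metis Suc_leD)
    qed
    \<comment> \<open>Entry i of column j is rebuilt from the entries i and i - 1 of column j + 1,
      so only i >= 1 is reached; the entry 0 is supplied by the entry h through periodicity.\<close>
    have "(T ^^ 0) x j = (T ^^ 0) y j"
      using step[of "h - 1"] assms(3) px[of j] py[of j] Suc.prems by simp
    then show ?case using step by (metis not0_implies_Suc)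
  qed
  show ?thesis
    unfolding agree_below_def
  proof (intro allI impI)
    fix j assume "j < k"
    then show "x j = y j"
      using col[of j] first by (cases "j < w") (auto simp: agree_below_def)
  qed
qed

text \<open>Cancelling the smaller power leaves T^h y = z on the first k letters, where y and z
  differ at most in the first w letters. So y is periodic under T^h from position w on and, by
  \<open>periodic_agree\<close>, determined by w letters and one column of h entries. The bound is
  independent of k, so the trace is negligible against n^k.\<close>

lemma card_closed_pairs_unbalanced:
  assumes "m \<noteq> q" and wk: "w \<le> k" "0 < k"
  shows "card (closed_pairs k m w q) \<le> n ^ (w + (if m < q then q - m else m - q))"
proof -
  define h where "h = (if m < q then q - m else m - q)"
  have h: "h \<ge> 1" using assms(1) by (auto simp: h_def)
  define b where "b v = (V ^^ m) (pad k v)" for v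
  \<comment> \<open>If m < q the surviving power T^h acts on the spliced word, otherwise on the
    unspliced one; y is the word it acts on, and z the image on the first k letters.\<close>
  define y where "y v c = (if m < q then splice w c (b v) else b v)" for v c
  define z where "z v c = (if m < q then b v else splice w c (b v))" for v c
  have closed: "b v \<in> iwords" "y v c \<in> iwords" "z v c \<in> iwords"
    if "(v, c) \<in> closed_pairs k m w q" for v c
    using that by (auto simp: b_def y_def z_def closed_pairs_def)
  have main: "agree_below k ((T ^^ h) (y v c)) (z v c)" if vc: "(v, c) \<in> closed_pairs k m w q" for v c
  proof -
    have ag: "agree_below k ((T ^^ q) (splice w c (b v))) ((T ^^ m) (b v))"
      and sp: "splice w c (b v) \<in> iwords"
      using vc by (auto simp: closed_pairs_def b_def)
    show ?thesis
    proof (cases "m < q")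
      case True
      then have "q = m + h" by (simp add: h_def)
      then have "agree_below k ((V ^^ m) ((T ^^ m) ((T ^^ h) (splice w c (b v))))) ((V ^^ m) ((T ^^ m) (b v)))"
        using V_funpow_below[OF ag] by (simp add: funpow_add)
      then show ?thesis using True sp closed[OF vc] by (simp add: y_def z_def)
    next
      case False
      then have "m = q + h" using assms(1) by (simp add: h_def)
      then have "agree_below k ((V ^^ q) ((T ^^ q) (splice w c (b v)))) ((V ^^ q) ((T ^^ q) ((T ^^ h) (b v))))"
        using V_funpow_below[OF ag] by (simp add: funpow_add)
      then show ?thesis using False sp closed[OF vc] by (simp add: y_def z_def agree_below_sym)
    qed
  qed
  have per: "(T ^^ h) (y v c) j = y v c j" if "(v, c) \<in> closed_pairs k m w q" "w \<le> j" "j < k" for v c j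
    using main[OF that(1)] that(2,3) by (auto simp: agree_below_def y_def z_def splice_def)
  let ?code = "\<lambda>(v, c). (restrict (y v c) {..<w}, restrict (\<lambda>i. (T ^^ i) (y v c) (k - 1)) {..<h})"
  have "inj_on ?code (closed_pairs k m w q)"
  proof (rule inj_onI, clarify)
    fix v c v' c' assume vc: "(v, c) \<in> closed_pairs k m w q" and vc': "(v', c') \<in> closed_pairs k m w q"
      and eq: "restrict (y v c) {..<w} = restrict (y v' c') {..<w}"
        "(\<lambda>i\<in>{..<h}. (T ^^ i) (y v c) (k - 1)) = (\<lambda>i\<in>{..<h}. (T ^^ i) (y v' c') (k - 1))"
    have ay: "agree_below k (y v c) (y v' c')"
    proof (rule periodic_agree[OF closed(2)[OF vc] closed(2)[OF vc'] h])
      show "agree_below w (y v c) (y v' c')"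
        using fun_cong[OF eq(1)] unfolding agree_below_def by (metis lessThan_iff restrict_apply')
      show "(T ^^ i) (y v c) (k - 1) = (T ^^ i) (y v' c') (k - 1)" if "i < h" for i
        using fun_cong[OF eq(2), of i] that by simp
    qed (use per[OF vc] per[OF vc'] in auto)
    have az: "agree_below k (z v c) (z v' c')"
      using agree_below_trans[OF agree_below_sym[OF main[OF vc]] agree_below_trans[OF T_funpow_below[OF ay] main[OF vc']]] .
    have ab: "agree_below k (b v) (b v')" and as: "agree_below k (splice w c (b v)) (splice w c' (b v'))"
      using ay az by (auto simp: y_def z_def split: if_splits)
    have "agree_below k ((T ^^ m) (b v)) ((T ^^ m) (b v'))" by (rule T_funpow_below[OF ab])
    then have "agree_below k (pad k v) (pad k v')" using vc vc' by (simp add: b_def closed_pairs_def)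
    then have "agree_below k v v'" by (auto simp: agree_below_def pad_def)
    moreover have "agree_below w c c'"
      unfolding agree_below_def
    proof (intro allI impI)
      fix i assume "i < w"
      then show "c i = c' i" using as[unfolded agree_below_def splice_def, rule_format, of i] wk by simp
    qed
    moreover have "v \<in> pwords k" "v' \<in> pwords k" "c \<in> pwords w" "c' \<in> pwords w"
      using vc vc' unfolding closed_pairs_def by blast+
    ultimately show "v = v' \<and> c = c'" using pwords_eqI by simp
  qed
  then have "card (closed_pairs k m w q) \<le> card (pwords w \<times> pwords h)"
  proof (rule card_inj_on_le)
    show "?code ` closed_pairs k m w q \<subseteq> pwords w \<times> pwords h"
    proof (rule image_subsetI)
      fix x assume "x \<in> closed_pairs k m w q"
      then obtain v c where x: "x = (v, c)" and vc: "(v, c) \<in> closed_pairs k m w q" by (cases x) simp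
      have "restrict (\<lambda>i. (T ^^ i) (y v c) (k - 1)) {..<h} \<in> pwords h"
        using closed(2)[OF vc] by (intro restrict_PiE_iff[THEN iffD2] ballI iwordsD funpow_closed)
      then show "?code x \<in> pwords w \<times> pwords h"
        unfolding x prod.case using pwords_restrict[OF closed(2)[OF vc]] by (rule SigmaI[rotated])
    qed
  qed simp
  then show ?thesis by (simp add: card_cartesian_product card_pwords power_add h_def)
qed

lemma wtrace_limit: "(\<lambda>k. wtrace k bs / real n ^ k) \<longlonglongrightarrow> closed_weight (real n) bs"
proof -
  obtain m w q where s: "walk_shape bs = (m, w, q)" by (metis prod_cases3)
  have n0: "real n \<noteq> 0" using n_ge2 by simp
  show ?thesis
  proof (cases "m = q")
    case True
    have "\<forall>\<^sub>F k in sequentially. closed_weight (real n) bs = wtrace k bs / real n ^ k"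
      using eventually_ge_at_top[of w]
    proof eventually_elim
      case (elim k)
      then show ?case using True n0
        by (simp add: closed_weight_def s wtrace_shape[OF s] card_closed_pairs_balanced power_inverse field_simps)
    qed
    then show ?thesis by (rule tendsto_eventually[OF eventually_mono]) simp
  next
    case False
    define h where "h = (if m < q then q - m else m - q)"
    have lim: "(\<lambda>k. real n ^ h * (1 / real n) ^ k) \<longlonglongrightarrow> 0"
      using n_ge2 by (intro tendsto_mult_right_zero LIMSEQ_power_zero) simp
    have "(\<lambda>k. wtrace k bs / real n ^ k) \<longlonglongrightarrow> 0"
    proof (rule tendsto_sandwich[OF _ _ tendsto_const lim])
      show "\<forall>\<^sub>F k in sequentially. 0 \<le> wtrace k bs / real n ^ k"
        by (simp add: wtrace_shape[OF s])
      show "\<forall>\<^sub>F k in sequentially. wtrace k bs / real n ^ k \<le> real n ^ h * (1 / real n) ^ k"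
        using eventually_ge_at_top[of "Suc w"]
      proof eventually_elim
        case (elim k)
        have "real (card (closed_pairs k m w q)) \<le> real (n ^ (w + h))"
          using card_closed_pairs_unbalanced[OF False, of w k] elim by (simp only: of_nat_le_iff h_def)
        then have "real (card (closed_pairs k m w q)) / real n ^ w \<le> real n ^ h"
          using n_ge2 by (simp add: power_add field_simps)
        from divide_right_mono[OF this, of "real n ^ k"]
        show ?case by (simp add: wtrace_shape[OF s] power_one_over)
      qed
    qed
    then show ?thesis using False by (simp add: closed_weight_def s)
  qed
qed

subsection \<open>Fixed points of words in the generators\<close>

abbreviation letters :: "(bool \<times> 'a) set" where
  "letters \<equiv> UNIV \<times> carrier G"

definition flip :: "bool \<times> 'a \<Rightarrow> bool \<times> 'a" where
  "flip s = (\<not> fst s, snd s)"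

sublocale L: free_letters letters flip "2 * n"
  by unfold_locales (auto simp: flip_def fin card_cartesian_product card_carrier)

definition act1 :: "bool \<times> 'a \<Rightarrow> (nat \<Rightarrow> 'a) \<Rightarrow> nat \<Rightarrow> 'a" where
  "act1 s a = (if fst s then cay (snd s) a else icay (snd s) a)"

text \<open>The head of the word acts first, so concatenation corresponds to the product of maps in
  reverse order, as in \<open>el_mult\<close>.\<close>

primrec act :: "(bool \<times> 'a) list \<Rightarrow> (nat \<Rightarrow> 'a) \<Rightarrow> nat \<Rightarrow> 'a" where
  "act [] a = a"
| "act (s # W) a = act W (act1 s a)"

lemma act1_closed [simp]: "s \<in> letters \<Longrightarrow> a \<in> iwords \<Longrightarrow> act1 s a \<in> iwords"
  by (auto simp: act1_def)

lemma act1_flip [simp]: "s \<in> letters \<Longrightarrow> a \<in> iwords \<Longrightarrow> act1 (flip s) (act1 s a) = a"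
  by (auto simp: act1_def flip_def)

lemma act_closed [simp]: "set W \<subseteq> letters \<Longrightarrow> a \<in> iwords \<Longrightarrow> act W a \<in> iwords"
  by (induction W arbitrary: a) simp_all

lemma act_append [simp]: "act (u @ v) a = act v (act u a)"
  by (induction u arbitrary: a) simp_all

lemma act_below: "agree_below k a b \<Longrightarrow> agree_below k (act W a) (act W b)"
  by (induction W arbitrary: a b) (simp_all add: act1_def cay_below icay_below)

text \<open>The padding is immaterial, since all maps preserve common prefixes; it lets the finite
  levels reuse the maps on infinite words.\<close>

definition lev :: "nat \<Rightarrow> (bool \<times> 'a) list \<Rightarrow> (nat \<Rightarrow> 'a) \<Rightarrow> nat \<Rightarrow> 'a" where
  "lev k W x = restrict (act W (pad k x)) {..<k}"

lemma lev_closed: "set W \<subseteq> letters \<Longrightarrow> x \<in> pwords k \<Longrightarrow> lev k W x \<in> pwords k"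
  unfolding lev_def by (intro pwords_restrict act_closed pad_closed)

lemma restrict_eq_iff: "restrict a {..<k} = restrict b {..<k} \<longleftrightarrow> agree_below k a b" for k :: nat
  unfolding agree_below_def by (auto simp: fun_eq_iff restrict_def)

lemma agree_below_pad_restrict: "agree_below k (pad k (restrict b {..<k})) b"
  by (auto simp: agree_below_def pad_def)

lemma lev_append: "lev k (u @ v) x = lev k v (lev k u x)"
  unfolding lev_def act_append restrict_eq_iff
  by (intro act_below agree_below_sym[OF agree_below_pad_restrict])

lemma lev_fixed_iff:
  assumes "x \<in> pwords k" shows "lev k W x = x \<longleftrightarrow> agree_below k (act W (pad k x)) (pad k x)"
proof -
  have "restrict (pad k x) {..<k} = x"
    by (rule pwords_eqI[OF pwords_restrict[OF pad_closed[OF assms]] assms]) (simp add: agree_below_def pad_def)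
  then show ?thesis unfolding lev_def restrict_eq_iff[symmetric] by simp
qed

definition fixed :: "nat \<Rightarrow> (bool \<times> 'a) list \<Rightarrow> (nat \<Rightarrow> 'a) set" where
  "fixed k W = {x \<in> pwords k. lev k W x = x}"

text \<open>The normalized character of the permutation representation on the words of length k,
  viewed as a function on words in the generators.\<close>

definition fix_ratio :: "nat \<Rightarrow> (bool \<times> 'a) list \<Rightarrow> complex" where
  "fix_ratio k W = of_nat (card (fixed k W)) / of_nat (n ^ k)"

lemma finite_fixed [simp]: "finite (fixed k W)"
  unfolding fixed_def by simp

text \<open>\<open>lev k u\<close> carries the fixed points of u v to those of v u, and
  \<open>lev k v\<close> undoes this. Used in both directions, it yields the conjugation invariance
  of the character.\<close>

lemma fixed_cyclic_le:
  assumes "set u \<subseteq> letters" "set v \<subseteq> letters"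
  shows "card (fixed k (u @ v)) \<le> card (fixed k (v @ u))"
proof (rule card_inj_on_le)
  show "inj_on (lev k u) (fixed k (u @ v))"
    by (rule inj_on_inverseI[where g = "lev k v"]) (simp add: fixed_def lev_append)
  show "lev k u ` fixed k (u @ v) \<subseteq> fixed k (v @ u)"
  proof (rule image_subsetI)
    fix x assume "x \<in> fixed k (u @ v)"
    then show "lev k u x \<in> fixed k (v @ u)"
      using lev_closed[OF assms(1), of x k] by (simp add: fixed_def lev_append del: PiE_iff)
  qed
qed simp

lemma class_fun_fix_ratio: "L.class_fun (fix_ratio k)"
  unfolding L.class_fun_def L.cancels_def
proof (intro conjI allI impI)
  fix u v :: "(bool \<times> 'a) list" assume "set u \<subseteq> letters" "set v \<subseteq> letters"
  then have "card (fixed k (u @ v)) = card (fixed k (v @ u))"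
    using fixed_cyclic_le by (intro antisym)
  then show "fix_ratio k (u @ v) = fix_ratio k (v @ u)" by (simp add: fix_ratio_def)
next
  fix u v :: "(bool \<times> 'a) list" and s
  assume "set u \<subseteq> letters" "set v \<subseteq> letters" "s \<in> letters"
  then have "lev k (u @ s # flip s # v) x = lev k (u @ v) x" if "x \<in> pwords k" for x
    using pad_closed[OF that] by (simp add: lev_def)
  then have "fixed k (u @ s # flip s # v) = fixed k (u @ v)" unfolding fixed_def by auto
  then show "fix_ratio k (u @ s # flip s # v) = fix_ratio k (u @ v)" by (simp add: fix_ratio_def)
qed

lemma fix_ratio_Nil [simp]: "fix_ratio k [] = 1"
proof -
  have "fixed k [] = pwords k"
    unfolding fixed_def using lev_fixed_iff[of _ k "[]"] by (auto simp: agree_below_def simp del: PiE_iff)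
  then show ?thesis using n_ge2 by (simp add: fix_ratio_def card_pwords)
qed

lemma norm_fix_ratio_le: "norm (fix_ratio k W) \<le> 1"
proof -
  have "card (fixed k W) \<le> n ^ k"
    using card_mono[of "pwords k" "fixed k W"] by (simp add: card_pwords fixed_def)
  then have "real (card (fixed k W)) \<le> real n ^ k" by (metis of_nat_le_iff of_nat_power)
  then show ?thesis using n_ge2 by (simp add: fix_ratio_def norm_divide norm_power)
qed

lemma sum_letters_act1:
  fixes h :: "(nat \<Rightarrow> 'a) \<Rightarrow> real"
  assumes a: "a \<in> iwords"
  shows "(\<Sum>s\<in>letters. h (act1 s a)) = real n * (avg0 (\<lambda>x. h (T x)) a + avg0 h (V a))"
proof -
  have n0: "real n \<noteq> 0" using n_ge2 by simp
  have a0: "a 0 \<in> carrier G" using a by simp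
  have "(\<Sum>s\<in>letters. h (act1 s a)) = (\<Sum>g\<in>carrier G. h (cay g a)) + (\<Sum>g\<in>carrier G. h (icay g a))"
  proof -
    have "(\<Sum>s\<in>letters. h (act1 s a)) = (\<Sum>b\<in>UNIV. \<Sum>g\<in>carrier G. h (act1 (b, g) a))"
      by (simp add: sum.cartesian_product)
    then show ?thesis by (simp add: UNIV_bool act1_def add.commute)
  qed
  also have "(\<Sum>g\<in>carrier G. h (cay g a)) = (\<Sum>g\<in>carrier G. h (T (a(0 := g \<otimes> a 0))))"
    by (intro sum.cong refl arg_cong[where f = h] cay_upd a)
  also have "\<dots> = (\<Sum>g\<in>carrier G. h (T (a(0 := g))))"
    by (rule sum.reindex_bij_witness[of _ "\<lambda>g. g \<otimes> inv (a 0)" "\<lambda>g. g \<otimes> a 0"]) (use a0 in \<open>simp_all add: m_assoc\<close>)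
  also have "(\<Sum>g\<in>carrier G. h (icay g a)) = (\<Sum>g\<in>carrier G. h ((V a)(0 := inv g \<otimes> a 0)))"
    by (intro sum.cong refl arg_cong[where f = h] icay_upd a)
  also have "\<dots> = (\<Sum>g\<in>carrier G. h ((V a)(0 := g)))"
  proof (rule sum.reindex_bij_witness[of _ "\<lambda>g. a 0 \<otimes> inv g" "\<lambda>g. inv g \<otimes> a 0"])
    fix g assume g: "g \<in> carrier G"
    show "a 0 \<otimes> inv (inv g \<otimes> a 0) = g" using g a0 by (simp add: inv_mult_group m_assoc[symmetric])
    show "inv (a 0 \<otimes> inv g) \<otimes> a 0 = g" using g a0 by (simp add: inv_mult_group m_assoc)
  qed (use a0 in simp_all)
  finally have *: "(\<Sum>s\<in>letters. h (act1 s a)) =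
      (\<Sum>g\<in>carrier G. h (T (a(0 := g)))) + (\<Sum>g\<in>carrier G. h ((V a)(0 := g)))" .
  have "real n * (x / real n) = x" for x using n0 by simp
  then show ?thesis unfolding avg0_def distrib_left * by (simp only:)
qed

lemma sum_words_act:
  fixes f :: "(nat \<Rightarrow> 'a) \<Rightarrow> real"
  shows "a \<in> iwords \<Longrightarrow> (\<Sum>W\<in>L.words j. f (act W a)) = real n ^ j * (\<Sum>bs\<in>sgn_words j. wop bs f a)"
proof (induction j arbitrary: a)
  case (Suc j)
  have "(\<Sum>W\<in>L.words (Suc j). f (act W a)) = (\<Sum>s\<in>letters. \<Sum>W\<in>L.words j. f (act W (act1 s a)))"
    unfolding L.words_Suc
    by (subst sum.reindex) (auto simp: inj_on_def sum.cartesian_product case_prod_unfold)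
  also have "\<dots> = (\<Sum>s\<in>letters. real n ^ j * (\<Sum>bs\<in>sgn_words j. wop bs f (act1 s a)))"
    using Suc by (intro sum.cong) simp_all
  also have "\<dots> = real n ^ j * (\<Sum>bs\<in>sgn_words j. \<Sum>s\<in>letters. wop bs f (act1 s a))"
    by (subst sum.swap) (simp add: sum_distrib_left)
  also have "\<dots> = real n ^ j * (\<Sum>bs\<in>sgn_words j. real n * (wop (True # bs) f a + wop (False # bs) f a))"
    by (simp add: sum_letters_act1[OF Suc.prems])
  also have "\<dots> = real n ^ Suc j * (\<Sum>bs\<in>sgn_words (Suc j). wop bs f a)"
    unfolding sum_sgn_words_Suc sum_distrib_left[symmetric] sum.distrib by simp
  finally show ?case .
qed simp

lemma sum_card_fixed:
  "(\<Sum>W\<in>L.words j. real (card (fixed k W))) = real n ^ j * (\<Sum>bs\<in>sgn_words j. wtrace k bs)"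
proof -
  have "real (card (fixed k W)) = (\<Sum>x\<in>pwords k. of_bool (agree_below k (act W (pad k x)) (pad k x)))" for W
  proof -
    have "fixed k W = pwords k \<inter> {x. agree_below k (act W (pad k x)) (pad k x)}"
      unfolding fixed_def using lev_fixed_iff by blast
    then show ?thesis by (simp add: of_bool_def sum.If_cases del: PiE_iff)
  qed
  then have "(\<Sum>W\<in>L.words j. real (card (fixed k W))) =
      (\<Sum>x\<in>pwords k. \<Sum>W\<in>L.words j. of_bool (agree_below k (act W (pad k x)) (pad k x)))"
    by (simp only:) (rule sum.swap)
  also have "\<dots> = (\<Sum>x\<in>pwords k. real n ^ j * (\<Sum>bs\<in>sgn_words j. wop bs (\<lambda>b. of_bool (agree_below k b (pad k x))) (pad k x)))"
    by (intro sum.cong refl sum_words_act pad_closed)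
  also have "\<dots> = real n ^ j * (\<Sum>bs\<in>sgn_words j. wtrace k bs)"
    unfolding wtrace_def sum_distrib_left by (rule sum.swap)
  finally show ?thesis .
qed

lemma wsum_fix_ratio_limit: "(\<lambda>k. L.wsum (fix_ratio k) j) \<longlonglongrightarrow> of_real (lim_moment j)"
proof -
  have "L.wsum (fix_ratio k) j = of_real (real n ^ j * (\<Sum>bs\<in>sgn_words j. wtrace k bs / real n ^ k))" for k
  proof -
    have "L.wsum (fix_ratio k) j = of_real ((\<Sum>W\<in>L.words j. real (card (fixed k W))) / real n ^ k)"
      by (simp add: L.wsum_def fix_ratio_def sum_divide_distrib)
    then show ?thesis unfolding sum_card_fixed by (simp add: sum_divide_distrib[symmetric])
  qed
  moreover have "(\<lambda>k. of_real (real n ^ j * (\<Sum>bs\<in>sgn_words j. wtrace k bs / real n ^ k)) :: complex)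
      \<longlonglongrightarrow> of_real (lim_moment j)"
    unfolding lim_moment_def by (intro tendsto_of_real tendsto_mult_left tendsto_sum wtrace_limit)
  ultimately show ?thesis by simp
qed

lemma walk_eval_fix_ratio_limit:
  "(\<lambda>k. L.walk_eval (fix_ratio k) (ihara_poly (2 * n) m)) \<longlonglongrightarrow> lim_coeff m"
  unfolding L.walk_eval_def lim_coeff_def by (intro tendsto_sum tendsto_mult_left wsum_fix_ratio_limit)

lemma csum_fix_ratio_limit:
  "(\<lambda>k. L.csum (fix_ratio k) (Suc m)) \<longlonglongrightarrow> lim_coeff (Suc m) + (if odd m then 2 * of_nat n - 2 else 0)"
proof -
  have "(\<lambda>k. L.walk_eval (fix_ratio k) (ihara_poly (2 * n) (Suc m)) + (if odd m then 2 * of_nat n - 2 else 0))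
      \<longlonglongrightarrow> lim_coeff (Suc m) + (if odd m then 2 * of_nat n - 2 else 0)"
    by (intro tendsto_add walk_eval_fix_ratio_limit tendsto_const)
  moreover have "L.csum (fix_ratio k) (Suc m) =
      L.walk_eval (fix_ratio k) (ihara_poly (2 * n) (Suc m)) + (if odd m then 2 * of_nat n - 2 else 0)" for k
    using L.csum_cpoly[OF class_fun_fix_ratio, of k m] by simp
  ultimately show ?thesis by (simp only:)
qed

lemma card_cwords_le: "card (L.cwords (Suc m)) \<le> 2 * n * (2 * n - 1) ^ m"
proof -
  have "card (L.cwords (Suc m)) \<le> card (L.rwords (Suc m))"
    by (rule card_mono) (auto simp: L.cwords_def L.rwords_def)
  then show ?thesis by (simp only: L.card_rwords)
qed

section \<open>Limit of the normalized logarithms\<close>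

lemma even_log_series:
  fixes t :: complex
  assumes "norm t < 1"
  shows "(\<lambda>m. (if even m then 2 * of_nat n - 2 else 0) * (t ^ m / of_nat m)) sums (- (of_nat n - 1) * Ln (1 - t\<^sup>2))"
proof -
  have "norm (t\<^sup>2) < 1" using assms by (simp add: norm_power power_less_one_iff)
  from sums_mult[OF sums_Ln_series[OF this], of "of_nat n - 1"]
  have "(\<lambda>r. (of_nat n - 1) * ((t\<^sup>2) ^ r / of_nat r)) sums ((of_nat n - 1) * - Ln (1 - t\<^sup>2))" .
  also have "(of_nat n - 1) * - Ln (1 - t\<^sup>2) = - (of_nat n - 1) * Ln (1 - t\<^sup>2)"
    by (simp only: mult_minus_left mult_minus_right)
  also have "(\<lambda>r. (of_nat n - 1) * ((t\<^sup>2) ^ r / of_nat r)) =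
      (\<lambda>r. (if even (2 * r) then 2 * of_nat n - 2 else 0) * (t ^ (2 * r) / of_nat (2 * r)))"
  proof
    fix r :: nat
    have "(of_nat n - 1) * (x / of_nat r) = (2 * of_nat n - 2) * (x / of_nat (2 * r))" for x :: complex
      by (cases "r = 0") (simp_all add: field_simps)
    then show "(of_nat n - 1) * ((t\<^sup>2) ^ r / of_nat r) =
        (if even (2 * r) then 2 * of_nat n - 2 else 0) * (t ^ (2 * r) / of_nat (2 * r))"
      unfolding power_mult by simp
  qed
  finally show ?thesis
    by (rule sums_mono_reindex[where f = "\<lambda>m. (if even m then 2 * of_nat n - 2 else 0) * (t ^ m / of_nat m)", THEN iffD1, rotated 2])
       (auto simp: strict_mono_def elim!: evenE)
qed

text \<open>The bound is uniform in k, since ratios are at most 1 and only reduced words are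
  counted; it is the dominating series for Tannery's theorem and determines the radius 1 / (2 n -
  1).\<close>

lemma norm_csum_fix_ratio_le:
  fixes t :: complex
  shows "norm (L.csum (fix_ratio k) m * (t ^ m / of_nat m)) \<le> 2 * real n * ((2 * real n - 1) * norm t) ^ m"
proof (cases m)
  case 0
  then show ?thesis by simp
next
  case (Suc j)
  have "norm (L.csum (fix_ratio k) m) \<le> (\<Sum>W\<in>L.cwords m. 1)"
    unfolding L.csum_def by (rule sum_norm_le) (rule norm_fix_ratio_le)
  also have "\<dots> = real (card (L.cwords m))" by simp
  also have "\<dots> \<le> real (2 * n * (2 * n - 1) ^ j)" unfolding Suc of_nat_le_iff by (rule card_cwords_le)
  also have "\<dots> = 2 * real n * (2 * real n - 1) ^ j" using n_ge2 by (simp add: of_nat_diff)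
  also have "\<dots> \<le> 2 * real n * (2 * real n - 1) ^ m"
    unfolding Suc using n_ge2 by (intro mult_left_mono power_increasing) auto
  finally have 1: "norm (L.csum (fix_ratio k) m) \<le> 2 * real n * (2 * real n - 1) ^ m" .
  have 2: "norm (t ^ m / of_nat m) \<le> norm t ^ m"
    using divide_left_mono[of 1 "real m" "norm t ^ m"] Suc
    by (simp only: norm_divide norm_power norm_of_nat) simp
  have "norm (L.csum (fix_ratio k) m * (t ^ m / of_nat m)) \<le> 2 * real n * (2 * real n - 1) ^ m * norm t ^ m"
    unfolding norm_mult using 1 2 n_ge2 by (intro mult_mono) auto
  then show ?thesis by (simp add: power_mult_distrib mult.assoc)
qed

theorem log_zeta_limit:
  fixes t :: complex
  assumes t: "norm t * (2 * real n - 1) < 1"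
  shows "(\<lambda>k. \<Sum>m. L.csum (fix_ratio k) m * (t ^ m / of_nat m)) \<longlonglongrightarrow>
      - (of_nat n - 1) * Ln (1 - t\<^sup>2) + (\<Sum>m. lim_coeff m * (t ^ m / of_nat m))"
    and "summable (\<lambda>m. lim_coeff m * (t ^ m / of_nat m))"
proof -
  define e where "e m = (if even m then 2 * of_nat n - 2 else 0 :: complex)" for m :: nat
  have lim: "(\<lambda>k. L.csum (fix_ratio k) m * (t ^ m / of_nat m)) \<longlonglongrightarrow> (lim_coeff m + e m) * (t ^ m / of_nat m)" for m
  proof (cases m)
    case (Suc j)
    then show ?thesis
      using tendsto_mult_right[OF csum_fix_ratio_limit[of j], of "t ^ m / of_nat m"] by (simp add: e_def)
  qed simp
  have r: "0 \<le> (2 * real n - 1) * norm t" "(2 * real n - 1) * norm t < 1"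
    using t n_ge2 by (simp_all add: mult.commute)
  have sm: "summable (\<lambda>m. 2 * real n * ((2 * real n - 1) * norm t) ^ m)"
    using r by (intro summable_mult summable_geometric) simp
  have "norm t * 1 \<le> norm t * (2 * real n - 1)" using n_ge2 by (intro mult_left_mono) auto
  then have t1: "norm t < 1" using t by simp
  have ev: "eventually (\<lambda>(m, k). norm (L.csum (fix_ratio k) m * (t ^ m / of_nat m)) \<le>
      2 * real n * ((2 * real n - 1) * norm t) ^ m) (at_top \<times>\<^sub>F sequentially)"
    by (rule always_eventually) (simp only: split_paired_All prod.case norm_csum_fix_ratio_le simp_thms)
  \<comment> \<open>Tannery's theorem exchanges the limit in k with the series in m. The limit
    coefficients split into \<open>lim_coeff\<close> and the correction e at even lengths, which
    sums to the logarithm of the power of 1 - t^2.\<close>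
  note tan = tannerys_theorem[OF lim ev sm trivial_limit_sequentially[unfolded trivial_limit_def, folded trivial_limit_def]]
  have s1: "summable (\<lambda>m. (lim_coeff m + e m) * (t ^ m / of_nat m))"
    using tan by (blast intro: summable_norm_cancel)
  have s2: "(\<lambda>m. e m * (t ^ m / of_nat m)) sums (- (of_nat n - 1) * Ln (1 - t\<^sup>2))"
    unfolding e_def by (rule even_log_series[OF t1])
  have "summable (\<lambda>m. (lim_coeff m + e m) * (t ^ m / of_nat m) - e m * (t ^ m / of_nat m))"
    by (rule summable_diff[OF s1 sums_summable[OF s2]])
  then show s3: "summable (\<lambda>m. lim_coeff m * (t ^ m / of_nat m))"
    by (simp only: distrib_right add_diff_cancel_right')
  have "(\<Sum>m. (lim_coeff m + e m) * (t ^ m / of_nat m)) =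
      (\<Sum>m. lim_coeff m * (t ^ m / of_nat m)) + - (of_nat n - 1) * Ln (1 - t\<^sup>2)"
    unfolding distrib_right suminf_add[OF s3 sums_summable[OF s2], symmetric] using sums_unique[OF s2] by simp
  then show "(\<lambda>k. \<Sum>m. L.csum (fix_ratio k) m * (t ^ m / of_nat m)) \<longlonglongrightarrow>
      - (of_nat n - 1) * Ln (1 - t\<^sup>2) + (\<Sum>m. lim_coeff m * (t ^ m / of_nat m))"
    using tan by (simp add: add.commute)
qed

end

section \<open>Ihara zeta functions and closed paths\<close>

text \<open>Closing up and the absence of backtracking are both conditions on cyclically adjacent
  edges; in this common form their stability under rotation, powers and roots is proved only
  once.\<close>

definition cyclic_chain :: "('e \<Rightarrow> 'e \<Rightarrow> bool) \<Rightarrow> 'e list \<Rightarrow> bool" where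
  "cyclic_chain R p \<longleftrightarrow> (\<forall>i<length p. R (p ! i) (p ! (Suc i mod length p)))"

lemma cyclic_chain_rotate:
  assumes "cyclic_chain R p" shows "cyclic_chain R (rotate j p)"
  unfolding cyclic_chain_def
proof (intro allI impI)
  fix i assume i: "i < length (rotate j p)"
  then have l: "0 < length p" by auto
  have "rotate j p ! i = p ! ((j + i) mod length p)" using i by (simp add: nth_rotate)
  moreover have "rotate j p ! (Suc i mod length p) = p ! ((j + Suc i mod length p) mod length p)"
    using l by (intro nth_rotate) simp
  moreover have "(j + Suc i mod length p) mod length p = Suc ((j + i) mod length p) mod length p"
    by (simp add: mod_simps)
  ultimately show "R (rotate j p ! i) (rotate j p ! (Suc i mod length (rotate j p)))"
    using assms l unfolding cyclic_chain_def by simp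
qed

lemma nth_concat_replicate:
  "i < m * length p \<Longrightarrow> concat (replicate m p) ! i = p ! (i mod length p)"
proof (induction m arbitrary: i)
  case (Suc m)
  show ?case
  proof (cases "i < length p")
    case True
    then show ?thesis by (simp add: nth_append)
  next
    case False
    then show ?thesis using Suc.prems Suc.IH[of "i - length p"] by (simp add: nth_append le_mod_geq)
  qed
qed simp

lemma cyclic_chain_power:
  assumes "m \<ge> 1" "p \<noteq> []"
  shows "cyclic_chain R (concat (replicate m p)) \<longleftrightarrow> cyclic_chain R p"
proof -
  let ?l = "length p" and ?q = "concat (replicate m p)"
  have l: "0 < ?l" and ml: "0 < m * ?l" using assms by auto
  have nx: "?q ! (Suc i mod (m * ?l)) = p ! (Suc i mod ?l)" for i
  proof -
    have "Suc i mod (m * ?l) < m * ?l" using ml by simp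
    then have "?q ! (Suc i mod (m * ?l)) = p ! (Suc i mod (m * ?l) mod ?l)" by (rule nth_concat_replicate)
    then show ?thesis by (simp add: mod_mod_cancel)
  qed
  have e: "cyclic_chain R ?q \<longleftrightarrow> (\<forall>i<m * ?l. R (p ! (i mod ?l)) (p ! (Suc i mod ?l)))"
    unfolding cyclic_chain_def length_concat_replicate using nx nth_concat_replicate by metis
  show ?thesis
  proof
    assume "cyclic_chain R ?q"
    then have h: "\<forall>i<m * ?l. R (p ! (i mod ?l)) (p ! (Suc i mod ?l))" using e by simp
    have "?l \<le> m * ?l" using assms by simp
    then show "cyclic_chain R p" unfolding cyclic_chain_def using h by (metis less_le_trans mod_less)
  next
    assume h: "cyclic_chain R p"
    have "R (p ! (i mod ?l)) (p ! (Suc i mod ?l))" for i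
      using h[unfolded cyclic_chain_def, rule_format, of "i mod ?l"] l by (simp add: mod_Suc_eq)
    then show "cyclic_chain R ?q" using e by simp
  qed
qed

lemma cyclic_chain_iff_successively:
  assumes "p \<noteq> []"
  shows "cyclic_chain R p \<longleftrightarrow> successively R p \<and> R (last p) (hd p)"
proof -
  obtain l where l: "length p = Suc l" using assms by (cases p) auto
  have "cyclic_chain R p \<longleftrightarrow> (\<forall>i<l. R (p ! i) (p ! Suc i)) \<and> R (p ! l) (p ! 0)"
  proof -
    have "Suc i mod Suc l = Suc i" if "i < l" for i using that by simp
    then have "R (p ! i) (p ! (Suc i mod Suc l)) \<longleftrightarrow> R (p ! i) (p ! Suc i)" if "i < l" for i using that by simp
    then show ?thesis unfolding cyclic_chain_def l less_Suc_eq by auto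
  qed
  then show ?thesis
    using assms l by (simp add: successively_conv_nth last_conv_nth hd_conv_nth)
qed

lemma cas_iff_successively:
  assumes "p \<noteq> []"
  shows "pre_digraph.cas Y u p v \<longleftrightarrow>
    tail Y (hd p) = u \<and> successively (\<lambda>e e'. head Y e = tail Y e') p \<and> head Y (last p) = v"
  using assms
proof (induction p arbitrary: u)
  case (Cons e p)
  show ?case
  proof (cases p)
    case Nil
    then show ?thesis by (simp add: pre_digraph.cas.simps)
  next
    case (Cons e' p')
    then have "p \<noteq> []" by simp
    have "pre_digraph.cas Y u (e # p) v \<longleftrightarrow> tail Y e = u \<and> pre_digraph.cas Y (head Y e) p v"
      by (simp add: pre_digraph.cas.simps)
    also have "\<dots> \<longleftrightarrow> tail Y e = u \<and> tail Y (hd p) = head Y e \<and>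
        successively (\<lambda>e e'. head Y e = tail Y e') p \<and> head Y (last p) = v"
      unfolding Cons.IH[OF \<open>p \<noteq> []\<close>] ..
    also have "\<dots> \<longleftrightarrow> tail Y e = u \<and> (tail Y (hd p) = head Y e \<and>
        successively (\<lambda>e e'. head Y e = tail Y e') p) \<and> head Y (last p) = v" by blast
    also have "tail Y (hd p) = head Y e \<and> successively (\<lambda>e e'. head Y e = tail Y e') p \<longleftrightarrow>
        successively (\<lambda>e e'. head Y e = tail Y e') (e # p)"
      unfolding Cons by (simp add: eq_commute[of "tail Y e'"])
    finally show ?thesis using \<open>p \<noteq> []\<close> by simp
  qed
qed simp

definition closed_reduced_paths :: "('v, 'e) pre_digraph \<Rightarrow> ('e \<Rightarrow> 'e) \<Rightarrow> 'e list set" where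
  "closed_reduced_paths Y \<iota> =
    {p. p \<noteq> [] \<and> set p \<subseteq> arcs Y \<and> cyclic_chain (\<lambda>e e'. head Y e = tail Y e' \<and> e' \<noteq> \<iota> e) p}"

lemma closed_reduced_paths_eq:
  assumes "\<And>e. e \<in> arcs Y \<Longrightarrow> tail Y e \<in> verts Y"
  shows "closed_reduced_paths Y \<iota> =
    {p. p \<noteq> [] \<and> (\<exists>u. pre_digraph.awalk Y u p u) \<and> cyclically_reduced \<iota> p}"
proof -
  have cc: "cyclic_chain (\<lambda>e e'. head Y e = tail Y e' \<and> e' \<noteq> \<iota> e) p \<longleftrightarrow>
      cyclic_chain (\<lambda>e e'. head Y e = tail Y e') p \<and> cyclically_reduced \<iota> p" for p
    unfolding cyclic_chain_def cyclically_reduced_def by blast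
  have aw: "(\<exists>u. pre_digraph.awalk Y u p u) \<longleftrightarrow> set p \<subseteq> arcs Y \<and> cyclic_chain (\<lambda>e e'. head Y e = tail Y e') p"
    if p: "p \<noteq> []" for p
  proof -
    have "(\<exists>u. pre_digraph.awalk Y u p u) \<longleftrightarrow>
      (\<exists>u. u \<in> verts Y \<and> set p \<subseteq> arcs Y \<and> tail Y (hd p) = u \<and>
        successively (\<lambda>e e'. head Y e = tail Y e') p \<and> head Y (last p) = u)"
      unfolding pre_digraph.awalk_def cas_iff_successively[OF p] ..
    also have "\<dots> \<longleftrightarrow> set p \<subseteq> arcs Y \<and> successively (\<lambda>e e'. head Y e = tail Y e') p \<and> head Y (last p) = tail Y (hd p)"
      using assms hd_in_set[OF p] by auto
    finally show ?thesis unfolding cyclic_chain_iff_successively[OF p] .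
  qed
  show ?thesis unfolding closed_reduced_paths_def cc using aw by blast
qed

theorem has_ln_ihara_zetaI:
  assumes tails: "\<And>e. e \<in> arcs Y \<Longrightarrow> tail Y e \<in> verts Y" and fin: "finite (arcs Y)"
    and sm: "summable (\<lambda>m. of_nat (card {p \<in> closed_reduced_paths Y \<iota>. length p = m}) * norm t ^ m)"
    and t: "norm t < 1"
  shows "has_ln_ihara_zeta Y \<iota> t
    (\<Sum>m. of_nat (card {p \<in> closed_reduced_paths Y \<iota>. length p = m}) * (t ^ m / of_nat m))"
proof -
  let ?P = "closed_reduced_paths Y \<iota>"
  have P: "?P = {p. p \<noteq> [] \<and> (\<exists>u. pre_digraph.awalk Y u p u) \<and> cyclically_reduced \<iota> p}"
    using tails by (rule closed_reduced_paths_eq)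
  have "{p. p \<noteq> [] \<and> (\<exists>u. pre_digraph.awalk Y u p u) \<and> cyclically_reduced \<iota> p \<and> primitive_path p} =
      {p \<in> ?P. primitive_path p}"
    unfolding P by blast
  then have e: "prime_cycles Y \<iota> = cyclic_class ` {p \<in> ?P. primitive_path p}"
    unfolding prime_cycles_def by simp
  show ?thesis
    unfolding has_ln_ihara_zeta_def e
  proof (rule euler_product_has_sum[OF _ _ _ _ sm t])
    show "rotate j p \<in> ?P" if "p \<in> ?P" for p j
      using that by (auto simp: closed_reduced_paths_def cyclic_chain_rotate)
    show "concat (replicate m p) \<in> ?P \<longleftrightarrow> p \<in> ?P" if "m \<ge> 1" "p \<noteq> []" for p m
    proof -
      have "set (concat (replicate m p)) = set p" "concat (replicate m p) \<noteq> []"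
        using that by (auto simp: concat_eq_Nil_conv)
      then show ?thesis using cyclic_chain_power[OF that] that by (simp add: closed_reduced_paths_def)
    qed
    show "[] \<notin> ?P" by (simp add: closed_reduced_paths_def)
    show "finite {p \<in> ?P. length p = m}" for m
      by (rule finite_subset[OF _ finite_lists_length_eq[OF fin, of m]]) (auto simp: closed_reduced_paths_def)
  qed
qed

section \<open>The automaton group\<close>

context cayley_group
begin

lemma cyclic_chain_cwords:
  assumes "W \<noteq> []"
  shows "W \<in> L.cwords (length W) \<longleftrightarrow> set W \<subseteq> letters \<and> cyclic_chain (\<lambda>s s'. s' \<noteq> flip s) W"
  using assms by (auto simp: L.cwords_def L.words_def L.reduced_def cyclic_chain_iff_successively)

abbreviation "BG \<equiv> BijGroup iwords"

abbreviation "\<Gamma> \<equiv> automaton_group (cayley_machine G)"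

definition el :: "(bool \<times> 'a) list \<Rightarrow> (nat \<Rightarrow> 'a) \<Rightarrow> nat \<Rightarrow> 'a" where
  "el W = restrict (act W) iwords"

definition rev_word :: "(bool \<times> 'a) list \<Rightarrow> (bool \<times> 'a) list" where
  "rev_word W = map flip (rev W)"

lemma rev_word_closed [simp]: "set W \<subseteq> letters \<Longrightarrow> set (rev_word W) \<subseteq> letters"
proof -
  assume W: "set W \<subseteq> letters"
  have "flip ` set W \<subseteq> letters" by (rule image_subsetI) (rule L.iv_in, rule subsetD[OF W])
  then show ?thesis unfolding rev_word_def set_map set_rev .
qed

lemma rev_word_Cons: "rev_word (s # W) = rev_word W @ [flip s]"
  by (simp add: rev_word_def)

lemma act_rev_word [simp]: "set W \<subseteq> letters \<Longrightarrow> a \<in> iwords \<Longrightarrow> act (rev_word W) (act W a) = a"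
proof (induction W arbitrary: a)
  case (Cons s W)
  then have "s \<in> letters" "set W \<subseteq> letters" by simp_all
  then show ?case using Cons.IH[of "act1 s a"] Cons.prems(2)
    unfolding rev_word_Cons act_append act.simps by (simp only: act1_closed act1_flip)
qed (simp add: rev_word_def)

lemma rev_word_rev_word [simp]: "rev_word (rev_word W) = W"
  by (simp add: rev_word_def flip_def rev_map comp_def)

lemma act_rev_word' [simp]: "set W \<subseteq> letters \<Longrightarrow> a \<in> iwords \<Longrightarrow> act W (act (rev_word W) a) = a"
  using act_rev_word[OF rev_word_closed, of W a] unfolding rev_word_rev_word .

lemma el_Bij: "set W \<subseteq> letters \<Longrightarrow> el W \<in> Bij iwords"
  unfolding Bij_def el_def
  by (auto intro!: bij_betwI[where g = "act (rev_word W)"])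

lemma el_mult:
  "set u \<subseteq> letters \<Longrightarrow> set v \<subseteq> letters \<Longrightarrow> el u \<otimes>\<^bsub>BG\<^esub> el v = el (v @ u)"
  using el_Bij[of u] el_Bij[of v]
  by (simp add: BijGroup_def compose_def el_def fun_eq_iff)

lemma el_Nil: "el [] = \<one>\<^bsub>BG\<^esub>"
  by (rule ext) (simp add: el_def BijGroup_def restrict_def)

lemma el_eqI: "(\<And>a. a \<in> iwords \<Longrightarrow> act u a = act v a) \<Longrightarrow> el u = el v"
  by (auto simp: el_def fun_eq_iff)

lemma el_inv:
  assumes "set W \<subseteq> letters" shows "inv\<^bsub>BG\<^esub> (el W) = el (rev_word W)"
proof (rule group.inv_equality[OF group_BijGroup])
  have "el (rev_word W) \<otimes>\<^bsub>BG\<^esub> el W = el (W @ rev_word W)" using assms by (intro el_mult) auto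
  also have "\<dots> = el []" using assms by (intro el_eqI) simp
  finally show "el (rev_word W) \<otimes>\<^bsub>BG\<^esub> el W = \<one>\<^bsub>BG\<^esub>" by (simp add: el_Nil)
qed (use assms el_Bij in \<open>auto simp: BijGroup_def\<close>)

lemma mealy_map_cayley: "mealy_map (cayley_machine G) g = el [(True, g)]"
proof -
  have "mealy_run (cayley_machine G) g a (Suc i) = cay g a i" for a i
    by (induction i) (simp_all add: cayley_machine_def)
  then show ?thesis
    by (simp add: mealy_map_def el_def act1_def cayley_machine_def fun_eq_iff restrict_def)
qed

lemma states_cayley [simp]: "states (cayley_machine G) = carrier G"
  and alphabet_cayley [simp]: "alphabet (cayley_machine G) = carrier G"
  by (simp_all add: cayley_machine_def)

lemma carrier_\<Gamma>: "carrier \<Gamma> = el ` {W. set W \<subseteq> letters}"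
proof -
  interpret BG: group BG by (rule group_BijGroup)
  let ?gens = "(\<lambda>g. el [(True, g)]) ` carrier G"
  have c: "carrier \<Gamma> = generate BG ?gens"
  proof -
    have "?gens \<subseteq> carrier BG" using el_Bij by (auto simp: BijGroup_def)
    then have "carrier BG \<inter> ?gens = ?gens" by blast
    moreover have "mealy_map (cayley_machine G) ` states (cayley_machine G) = ?gens"
      unfolding states_cayley by (rule image_cong) (simp_all only: mealy_map_cayley)
    ultimately show ?thesis
      by (simp only: automaton_group_def carrier_subgroup_generated alphabet_cayley)
  qed
  show ?thesis
  proof (intro equalityI subsetI)
    fix x assume "x \<in> carrier \<Gamma>"
    then have "x \<in> generate BG ?gens" by (simp add: c)
    then show "x \<in> el ` {W. set W \<subseteq> letters}"
    proof (induction rule: generate.induct)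
      case one
      then show ?case using el_Nil by (intro image_eqI[of _ _ "[]"]) auto
    next
      case (incl h)
      then obtain g where "g \<in> carrier G" "h = el [(True, g)]" by auto
      then show ?case by (intro image_eqI[of _ _ "[(True, g)]"]) auto
    next
      case (inv h)
      then obtain g where "g \<in> carrier G" "h = el [(True, g)]" by auto
      then show ?case using el_inv[of "[(True, g)]"]
        by (intro image_eqI[of _ _ "rev_word [(True, g)]"]) auto
    next
      case (eng h1 h2)
      then obtain u v where "set u \<subseteq> letters" "set v \<subseteq> letters" "h1 = el u" "h2 = el v" by auto
      then show ?case using el_mult[of u v] by (intro image_eqI[of _ _ "v @ u"]) auto
    qed
  next
    fix x assume "x \<in> el ` {W. set W \<subseteq> letters}"
    then obtain W where W: "set W \<subseteq> letters" "x = el W" by auto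
    from W(1) have "el W \<in> generate BG ?gens"
    proof (induction W)
      case Nil
      then show ?case using generate.one[of BG] by (simp add: el_Nil)
    next
      case (Cons s W)
      then have s: "s \<in> letters" and IH: "el W \<in> generate BG ?gens" by auto
      obtain b g where bg: "s = (b, g)" "g \<in> carrier G" using s by auto
      have "el [s] \<in> generate BG ?gens"
      proof (cases b)
        case True
        then show ?thesis using bg by (auto intro: generate.incl)
      next
        case False
        have "inv\<^bsub>BG\<^esub> (el [(True, g)]) = el [s]"
          using el_inv[of "[(True, g)]"] bg False by (simp add: rev_word_def flip_def)
        moreover have "inv\<^bsub>BG\<^esub> (el [(True, g)]) \<in> generate BG ?gens" using bg by (intro generate.inv) auto
        ultimately show ?thesis by simp
      qed
      then have "el W \<otimes>\<^bsub>BG\<^esub> el [s] \<in> generate BG ?gens" using IH by (intro generate.eng)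
      then show ?case using el_mult[of W "[s]"] Cons.prems by simp
    qed
    then show "x \<in> carrier \<Gamma>" using W c by simp
  qed
qed

lemma el_in_\<Gamma> [simp]: "set W \<subseteq> letters \<Longrightarrow> el W \<in> carrier \<Gamma>"
  by (auto simp: carrier_\<Gamma>)

lemma group_\<Gamma>: "group \<Gamma>"
  unfolding automaton_group_def by (intro group.group_subgroup_generated group_BijGroup)

lemma mult_\<Gamma> [simp]: "x \<otimes>\<^bsub>\<Gamma>\<^esub> y = x \<otimes>\<^bsub>BG\<^esub> y"
  by (simp add: automaton_group_def cayley_machine_def)

lemma one_\<Gamma>: "\<one>\<^bsub>\<Gamma>\<^esub> = el []"
  by (simp add: automaton_group_def cayley_machine_def el_Nil)

lemma inv_\<Gamma>: "set W \<subseteq> letters \<Longrightarrow> inv\<^bsub>\<Gamma>\<^esub> (el W) = el (rev_word W)"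
proof (rule group.inv_equality[OF group_\<Gamma>])
  assume W: "set W \<subseteq> letters"
  have "el (rev_word W) \<otimes>\<^bsub>BG\<^esub> el W = el (W @ rev_word W)" using W by (intro el_mult) auto
  also have "\<dots> = el []" using W by (intro el_eqI) simp
  finally show "el (rev_word W) \<otimes>\<^bsub>\<Gamma>\<^esub> el W = \<one>\<^bsub>\<Gamma>\<^esub>" by (simp add: one_\<Gamma>)
qed auto

lemma el_app [simp]: "a \<in> iwords \<Longrightarrow> el W a = act W a"
  by (simp add: el_def)

text \<open>Position 2 separates \<open>cay\<close> from \<open>icay\<close>: there the former
  depends on the first letter and the latter does not, and G has a nontrivial element to put there.
  This makes the degree of the Schreier graphs equal to 2 n and lets words be recovered from the
  labels of arcs.\<close>

lemma el_letter_inj: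
  assumes "s \<in> letters" "s' \<in> letters" "el [s] = el [s']" shows "s = s'"
proof -
  have eq: "act1 s a = act1 s' a" if "a \<in> iwords" for a
    using fun_cong[OF assms(3), of a] that by simp
  obtain b g b' g' where s: "s = (b, g)" "s' = (b', g')" "g \<in> carrier G" "g' \<in> carrier G"
    using assms by auto
  have one: "(\<lambda>_. \<one>) \<in> iwords" by (rule iwordsI) simp
  have mixed: False if h: "\<And>a. a \<in> iwords \<Longrightarrow> cay x a = icay y a" and xy: "x \<in> carrier G" "y \<in> carrier G" for x y
  proof -
    obtain z where z: "z \<in> carrier G" "z \<noteq> \<one>" using nontrivial one_closed by blast
    have "cay x (\<lambda>_. \<one>) 2 = icay y (\<lambda>_. \<one>) 2" using h[OF one] by simp
    then have "x = \<one>" using xy by (simp add: numeral_2_eq_2)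
    moreover have "cay x ((\<lambda>_. \<one>)(0 := z)) 2 = icay y ((\<lambda>_. \<one>)(0 := z)) 2"
      using h[OF upd_closed[OF one z(1)]] by simp
    then have "x \<otimes> z = \<one>" using xy z by (simp add: numeral_2_eq_2)
    ultimately show False using z by simp
  qed
  show ?thesis
  proof (cases "b = b'")
    case True
    have "act1 s (\<lambda>_. \<one>) 0 = act1 s' (\<lambda>_. \<one>) 0" using eq[OF one] by simp
    moreover have "inv g = inv g' \<Longrightarrow> g = g'" using s(3,4) by (metis inv_inv)
    ultimately have "g = g'" using s True by (cases b') (simp_all add: act1_def)
    then show ?thesis using s True by simp
  next
    case False
    then show ?thesis
    proof (cases b)
      case True
      then show ?thesis using mixed[of g g'] eq s False by (simp add: act1_def)
    next
      case b: False
      then have "cay g' a = icay g a" if "a \<in> iwords" for a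
        using eq[OF that] s False by (simp add: act1_def)
      then show ?thesis using mixed[of g' g] s by simp
    qed
  qed
qed

abbreviation "SS \<equiv> symmetric_generators (cayley_machine G)"

lemma SS_eq: "SS = (\<lambda>s. el [s]) ` letters"
proof -
  have "inv\<^bsub>\<Gamma>\<^esub> (el [(True, g)]) = el [(False, g)]" if "g \<in> carrier G" for g
    using inv_\<Gamma>[of "[(True, g)]"] that by (simp add: rev_word_def flip_def)
  then have "SS = (\<lambda>g. el [(True, g)]) ` carrier G \<union> (\<lambda>g. el [(False, g)]) ` carrier G"
    unfolding symmetric_generators_def mealy_map_cayley by (simp add: cayley_machine_def)
  moreover have "letters = (\<lambda>g. (True, g)) ` carrier G \<union> (\<lambda>g. (False, g)) ` carrier G"
    by (auto simp: image_iff)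
  ultimately show ?thesis by (simp add: image_Un image_image)
qed

lemma inj_on_el_letter: "inj_on (\<lambda>s. el [s]) letters"
  using el_letter_inj by (intro inj_onI)

subsection \<open>The Schreier graphs\<close>

text \<open>A change of the first letter is conjugated by T^i: \<open>V (cay h u)\<close> alters
  only the first letter of u = T^i a, and V^i carries the change to position i, possibly disturbing
  earlier letters but none after it. The value at i is injective in the new first letter, hence
  arbitrary, G being finite.\<close>

lemma change_letter:
  assumes a: "a \<in> iwords" and y: "y \<in> carrier G"
  obtains W where "set W \<subseteq> letters" "act W a i = y" "agree_from (Suc i) (act W a) a"
proof -
  have T: "act (replicate k (True, \<one>)) b = (T ^^ k) b" for k b
    by (induction k arbitrary: b) (simp_all add: act1_def funpow_swap1)
  have V: "act (replicate k (False, \<one>)) b = (V ^^ k) b" for k b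
    by (induction k arbitrary: b) (simp_all add: act1_def funpow_swap1)
  define u where "u = (T ^^ i) a"
  have u: "u \<in> iwords" using a by (simp add: u_def)
  define \<phi> where "\<phi> x = (V ^^ i) (u(0 := x))" for x
  have Vu: "(V ^^ i) u = a" using a by (simp add: u_def)
  have tail: "agree_from (Suc i) (\<phi> x) a" for x
  proof -
    have "agree_from (Suc 0 + i) ((V ^^ i) (u(0 := x))) ((V ^^ i) u)"
      by (rule V_funpow_from) (simp add: agree_from_def)
    then show ?thesis by (simp add: \<phi>_def Vu)
  qed
  have in_iw: "\<phi> x \<in> iwords" if "x \<in> carrier G" for x using u that by (simp add: \<phi>_def)
  have "inj_on (\<lambda>x. \<phi> x i) (carrier G)"
  proof (rule inj_onI)
    fix x x' assume x: "x \<in> carrier G" "x' \<in> carrier G" and eq: "\<phi> x i = \<phi> x' i"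
    have "agree_from i (\<phi> x) (\<phi> x')"
      using agree_from_trans[OF tail agree_from_sym[OF tail], of x x'] eq
      unfolding agree_from_def by (metis le_antisym not_less_eq_eq)
    then have h: "agree_from (0 + i) ((V ^^ i) (u(0 := x))) ((V ^^ i) (u(0 := x')))" by (simp add: \<phi>_def)
    have s: "agree_from (Suc 0) (u(0 := x)) (u(0 := x'))" by (simp add: agree_from_def)
    have "agree_from 0 (u(0 := x)) (u(0 := x'))"
      by (rule agree_from_V_funpow[OF upd_closed[OF u x(1)] upd_closed[OF u x(2)] s h])
    then have "(u(0 := x)) 0 = (u(0 := x')) 0" unfolding agree_from_def by blast
    then show "x = x'" by simp
  qed
  moreover have "(\<lambda>x. \<phi> x i) ` carrier G \<subseteq> carrier G" using in_iw by auto
  ultimately have "(\<lambda>x. \<phi> x i) ` carrier G = carrier G" using fin by (intro endo_inj_surj)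
  then obtain x where x: "x \<in> carrier G" "\<phi> x i = y" using y by (metis (no_types, lifting) image_iff)
  let ?h = "x \<otimes> inv (u 0)"
  let ?W = "replicate i (True, \<one>) @ [(True, ?h), (False, \<one>)] @ replicate i (False, \<one>)"
  have h: "?h \<in> carrier G" "?h \<otimes> u 0 = x" using x u by (simp_all add: m_assoc)
  have "act ?W a = (V ^^ i) (V (cay ?h u))" by (simp add: T V act1_def u_def)
  also have "V (cay ?h u) = u(0 := x)"
    unfolding cay_upd[OF h(1) u] h(2) using u x by (intro icay_cay) simp_all
  finally have "act ?W a = \<phi> x" by (simp only: \<phi>_def)
  moreover have "set ?W \<subseteq> letters" using h by auto
  ultimately show ?thesis using that[of ?W] x(2) tail[of x] by simp
qed

text \<open>Letters are corrected from position k - 1 down to 0, because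
  \<open>change_letter\<close> preserves only the letters to the right.\<close>

lemma level_transitive:
  assumes a: "a \<in> iwords" and v: "v \<in> pwords k"
  obtains W where "set W \<subseteq> letters" "agree_below k (act W a) v"
proof -
  have "\<exists>W. set W \<subseteq> letters \<and> (\<forall>i<k. k - j \<le> i \<longrightarrow> act W a i = v i)" if "j \<le> k" for j
    using that
  proof (induction j)
    case 0
    then show ?case by (intro exI[of _ "[]"]) simp
  next
    case (Suc j)
    then obtain W where W: "set W \<subseteq> letters" "\<forall>i<k. k - j \<le> i \<longrightarrow> act W a i = v i" by auto
    let ?i = "k - Suc j"
    have "?i < k" using Suc.prems by simp
    then have "v ?i \<in> carrier G" using v by (auto dest: PiE_mem)
    then obtain W' where W': "set W' \<subseteq> letters" "act W' (act W a) ?i = v ?i"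
      "agree_from (Suc ?i) (act W' (act W a)) (act W a)"
      using change_letter[OF act_closed[OF W(1) a]] by metis
    have "act (W @ W') a i = v i" if "i < k" "?i \<le> i" for i
    proof (cases "i = ?i")
      case False
      then have "Suc ?i \<le> i" "k - j \<le> i" using that by auto
      then show ?thesis using W'(3) W(2) that by (simp add: agree_from_def)
    qed (use W' in simp)
    then show ?case using W(1) W'(1) by (intro exI[of _ "W @ W'"]) auto
  qed
  from this[of k] show ?thesis using that by (auto simp: agree_below_def)
qed

text \<open>Left cosets of the prefix stabilizer, parametrized by words of length k instead of
  representatives.\<close>

definition coset_of :: "(nat \<Rightarrow> 'a) \<Rightarrow> nat \<Rightarrow> (nat \<Rightarrow> 'a) \<Rightarrow> ((nat \<Rightarrow> 'a) \<Rightarrow> nat \<Rightarrow> 'a) set" where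
  "coset_of w k v = {\<gamma> \<in> carrier \<Gamma>. agree_below k (\<gamma> w) v}"

lemma lev_agree: "set W \<subseteq> letters \<Longrightarrow> agree_below k b v \<Longrightarrow> agree_below k (act W b) (lev k W v)"
proof -
  assume b: "agree_below k b v"
  have "agree_below k b (pad k v)" using agree_below_trans[OF b agree_below_sym[OF agree_below_pad]] .
  then have "agree_below k (act W b) (act W (pad k v))" by (rule act_below)
  then show ?thesis unfolding lev_def by (simp add: agree_below_def)
qed

lemma lev_inverse:
  assumes "set W \<subseteq> letters" "v \<in> pwords k" shows "lev k (rev_word W) (lev k W v) = v"
proof -
  have "lev k (rev_word W) (lev k W v) = lev k (W @ rev_word W) v" by (simp add: lev_append)
  also have "\<dots> = lev k [] v" using assms pad_closed[OF assms(2)] by (simp add: lev_def)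
  also have "\<dots> = v" using lev_fixed_iff[OF assms(2), of "[]"] by (simp add: agree_below_def)
  finally show ?thesis .
qed

context
  fixes w :: "nat \<Rightarrow> 'a"
  assumes w: "w \<in> iwords"
begin

lemma coset_of_nonempty:
  assumes "v \<in> pwords k" obtains W where "set W \<subseteq> letters" "el W \<in> coset_of w k v"
proof -
  obtain W where "set W \<subseteq> letters" "agree_below k (act W w) v"
    using level_transitive[OF w assms] .
  then show ?thesis using that w by (auto simp: coset_of_def)
qed

lemma coset_of_inj:
  assumes "v \<in> pwords k" "v' \<in> pwords k" "coset_of w k v = coset_of w k v'" shows "v = v'"
proof -
  obtain W where "el W \<in> coset_of w k v" using coset_of_nonempty[OF assms(1)] .
  moreover from this have "el W \<in> coset_of w k v'" using assms(3) by simp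
  ultimately have 1: "agree_below k (el W w) v" and 2: "agree_below k (el W w) v'"
    unfolding coset_of_def by simp_all
  have "agree_below k v v'" by (rule agree_below_trans[OF agree_below_sym[OF 1] 2])
  then show ?thesis by (rule pwords_eqI[OF assms(1,2)])
qed

lemma l_coset_coset_of:
  assumes W: "set W \<subseteq> letters" and v: "v \<in> pwords k"
  shows "el W <#\<^bsub>\<Gamma>\<^esub> coset_of w k v = coset_of w k (lev k W v)"
proof (intro equalityI subsetI)
  fix \<delta> assume "\<delta> \<in> el W <#\<^bsub>\<Gamma>\<^esub> coset_of w k v"
  then obtain \<gamma> where \<gamma>: "\<gamma> \<in> carrier \<Gamma>" "agree_below k (\<gamma> w) v" "\<delta> = el W \<otimes>\<^bsub>BG\<^esub> \<gamma>"
    by (auto simp: l_coset_def coset_of_def)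
  then obtain u where u: "set u \<subseteq> letters" "\<gamma> = el u" by (auto simp: carrier_\<Gamma>)
  then have \<delta>: "\<delta> = el (u @ W)" using \<gamma> W by (simp add: el_mult)
  have "agree_below k (act u w) v" using \<gamma>(2) u w by simp
  then have "agree_below k (act W (act u w)) (lev k W v)" by (rule lev_agree[OF W])
  then show "\<delta> \<in> coset_of w k (lev k W v)" using \<delta> u W w by (simp add: coset_of_def)
next
  fix \<delta> assume \<delta>: "\<delta> \<in> coset_of w k (lev k W v)"
  then obtain u where u: "set u \<subseteq> letters" "\<delta> = el u" by (auto simp: carrier_\<Gamma> coset_of_def)
  have "agree_below k (act u w) (lev k W v)" using \<delta> u w by (simp add: coset_of_def)
  then have "agree_below k (act (rev_word W) (act u w)) v"
    using lev_agree[OF rev_word_closed[OF W], of k "act u w" "lev k W v"] lev_inverse[OF W v] by simp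
  then have "el (u @ rev_word W) \<in> coset_of w k v" using u W w by (simp add: coset_of_def)
  moreover have "el W \<otimes>\<^bsub>\<Gamma>\<^esub> el (u @ rev_word W) = \<delta>"
  proof -
    have "el W \<otimes>\<^bsub>\<Gamma>\<^esub> el (u @ rev_word W) = el ((u @ rev_word W) @ W)"
      using u W by (simp add: el_mult)
    also have "\<dots> = el u" using u W by (intro el_eqI) simp
    finally show ?thesis using u by simp
  qed
  ultimately show "\<delta> \<in> el W <#\<^bsub>\<Gamma>\<^esub> coset_of w k v" unfolding l_coset_def by blast
qed

abbreviation "Q k \<equiv> prefix_stabilizer \<Gamma> w k"

lemma prefix_stabilizer_eq: "Q k = coset_of w k (restrict w {..<k})"
  unfolding prefix_stabilizer_def coset_of_def by (auto simp: agree_below_def)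

lemma restrict_w: "restrict w {..<k} \<in> pwords k"
  by (rule pwords_restrict[OF w])

lemma lcosets_Q: "lcosets\<^bsub>\<Gamma>\<^esub> (Q k) = coset_of w k ` pwords k"
proof (intro equalityI subsetI)
  fix X assume "X \<in> lcosets\<^bsub>\<Gamma>\<^esub> (Q k)"
  then obtain W where W: "set W \<subseteq> letters" "X = el W <#\<^bsub>\<Gamma>\<^esub> Q k"
    by (auto simp: LCOSETS_def carrier_\<Gamma>)
  then have "X = coset_of w k (lev k W (restrict w {..<k}))"
    unfolding prefix_stabilizer_eq using l_coset_coset_of[OF W(1) restrict_w] by simp
  then show "X \<in> coset_of w k ` pwords k" using lev_closed[OF W(1) restrict_w] by (rule image_eqI)
next
  fix X assume "X \<in> coset_of w k ` pwords k"
  then obtain v where v: "v \<in> pwords k" "X = coset_of w k v" by (rule imageE)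
  obtain W where W: "set W \<subseteq> letters" "el W \<in> coset_of w k v" using coset_of_nonempty[OF v(1)] .
  have "agree_below k (act W w) v" using W w by (simp add: coset_of_def)
  moreover have "agree_below k (act W w) (lev k W (restrict w {..<k}))"
    by (rule lev_agree[OF W(1)]) (simp add: agree_below_def)
  ultimately have "lev k W (restrict w {..<k}) = v"
    by (intro pwords_eqI[OF lev_closed[OF W(1) restrict_w] v(1)]) (metis agree_below_trans agree_below_sym)
  then have "X = el W <#\<^bsub>\<Gamma>\<^esub> Q k"
    unfolding prefix_stabilizer_eq using l_coset_coset_of[OF W(1) restrict_w] v by simp
  then show "X \<in> lcosets\<^bsub>\<Gamma>\<^esub> (Q k)" unfolding LCOSETS_def using W(1) by (auto intro: el_in_\<Gamma>)
qed

abbreviation "X k \<equiv> schreier_graph \<Gamma> (Q k) SS"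

lemma verts_X: "verts (X k) = coset_of w k ` pwords k"
  by (simp add: schreier_graph_def lcosets_Q)

lemma arcs_X: "arcs (X k) = (\<lambda>(v, s). (coset_of w k v, el [s])) ` (pwords k \<times> letters)"
  by (auto simp: schreier_graph_def lcosets_Q SS_eq image_iff simp del: PiE_iff)

lemma finite_verts_X: "finite (verts (X k))"
  by (simp add: verts_X)

lemma card_verts_X: "card (verts (X k)) = n ^ k"
proof -
  have "inj_on (coset_of w k) (pwords k)" by (rule inj_onI) (rule coset_of_inj)
  then show ?thesis by (simp only: verts_X card_image card_pwords)
qed

section \<open>Closed reduced paths as fixed points of cyclically reduced words\<close>

primrec walk_arcs :: "nat \<Rightarrow> (nat \<Rightarrow> 'a) \<Rightarrow> (bool \<times> 'a) list \<Rightarrow> (((nat \<Rightarrow> 'a) \<Rightarrow> nat \<Rightarrow> 'a) set \<times> ((nat \<Rightarrow> 'a) \<Rightarrow> nat \<Rightarrow> 'a)) list" where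
  "walk_arcs k v [] = []"
| "walk_arcs k v (s # W) = (coset_of w k v, el [s]) # walk_arcs k (lev k [s] v) W"

lemma length_walk_arcs [simp]: "length (walk_arcs k v W) = length W"
  by (induction W arbitrary: v) simp_all

lemma lev_Cons: "lev k (s # W) v = lev k W (lev k [s] v)"
  using lev_append[of k "[s]" W v] by simp

lemma lev_Nil: "v \<in> pwords k \<Longrightarrow> lev k [] v = v"
  using lev_fixed_iff[of v k "[]"] by (simp add: agree_below_def)

lemma nth_walk_arcs:
  "v \<in> pwords k \<Longrightarrow> set W \<subseteq> letters \<Longrightarrow> i < length W \<Longrightarrow>
    walk_arcs k v W ! i = (coset_of w k (lev k (take i W) v), el [W ! i])"
proof (induction W arbitrary: v i)
  case (Cons s W)
  have s: "set [s] \<subseteq> letters" "set W \<subseteq> letters" using Cons.prems(2) by simp_all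
  show ?case
  proof (cases i)
    case 0
    then show ?thesis using lev_Nil[OF Cons.prems(1)] by simp
  next
    case (Suc j)
    then show ?thesis
      using Cons.IH[OF lev_closed[OF s(1) Cons.prems(1)] s(2), of j] Cons.prems(3)
      by (simp add: lev_Cons[of k s "take j W"])
  qed
qed simp

lemma walk_arcs_inj:
  "v \<in> pwords k \<Longrightarrow> v' \<in> pwords k \<Longrightarrow> set W \<subseteq> letters \<Longrightarrow> set W' \<subseteq> letters \<Longrightarrow> W \<noteq> [] \<Longrightarrow>
    walk_arcs k v W = walk_arcs k v' W' \<Longrightarrow> v = v' \<and> W = W'"
proof -
  assume v: "v \<in> pwords k" "v' \<in> pwords k" and W: "set W \<subseteq> letters" "set W' \<subseteq> letters" and ne: "W \<noteq> []"
    and eq: "walk_arcs k v W = walk_arcs k v' W'"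
  have len: "length W = length W'" using arg_cong[OF eq, of length] by simp
  have "W ! i = W' ! i" if "i < length W" for i
  proof (rule el_letter_inj)
    show "W ! i \<in> letters" "W' ! i \<in> letters" using that len W nth_mem by (metis subsetD)+
    show "el [W ! i] = el [W' ! i]"
      using nth_walk_arcs[OF v(1) W(1) that] nth_walk_arcs[OF v(2) W(2), of i] that len eq by simp
  qed
  then have "W = W'" using len by (intro nth_equalityI) auto
  moreover have "W' \<noteq> []" using len ne by auto
  then have "coset_of w k v = coset_of w k v'"
    using nth_walk_arcs[OF v(1) W(1), of 0] nth_walk_arcs[OF v(2) W(2), of 0] ne len eq lev_Nil v by simp
  then have "v = v'" by (rule coset_of_inj[OF v])
  ultimately show ?thesis by simp
qed

lemma head_X:
  assumes "v \<in> pwords k" "s \<in> letters"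
  shows "head (X k) (coset_of w k v, el [s]) = coset_of w k (lev k [s] v)"
    and "schreier_rev \<Gamma> (coset_of w k v, el [s]) = (coset_of w k (lev k [s] v), el [flip s])"
proof -
  have s: "set [s] \<subseteq> letters" using assms(2) by simp
  show "head (X k) (coset_of w k v, el [s]) = coset_of w k (lev k [s] v)"
    using l_coset_coset_of[OF s assms(1)] by (simp add: schreier_graph_def)
  show "schreier_rev \<Gamma> (coset_of w k v, el [s]) = (coset_of w k (lev k [s] v), el [flip s])"
    using l_coset_coset_of[OF s assms(1)] inv_\<Gamma>[OF s] by (simp add: schreier_rev_def rev_word_def)
qed

lemma tail_X [simp]: "tail (X k) (C, s) = C"
  by (simp add: schreier_graph_def)

text \<open>Consecutive arcs fit together along \<open>walk_arcs\<close>, so only the closing-up condition and the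
  backtracking conditions remain.\<close>

lemma walk_arcs_closed_reduced:
  assumes v: "v \<in> pwords k" and W: "set W \<subseteq> letters" and ne: "W \<noteq> []"
  shows "walk_arcs k v W \<in> closed_reduced_paths (X k) (schreier_rev \<Gamma>) \<longleftrightarrow>
    W \<in> L.cwords (length W) \<and> v \<in> fixed k W"
proof -
  let ?p = "walk_arcs k v W" and ?m = "length W"
  have m: "0 < ?m" using ne by simp
  have letter: "W ! i \<in> letters" if "i < ?m" for i using W that nth_mem by blast
  have tk: "lev k (take i W) v \<in> pwords k" for i
    using W set_take_subset[of i W] by (intro lev_closed v) blast
  have nth: "?p ! i = (coset_of w k (lev k (take i W) v), el [W ! i])" if "i < ?m" for i
    by (rule nth_walk_arcs[OF v W that])
  have Suc: "lev k [W ! i] (lev k (take i W) v) = lev k (take (Suc i) W) v" if "i < ?m" for i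
    using that by (simp add: take_Suc_conv_app_nth lev_append)
  have hd: "head (X k) (?p ! i) = coset_of w k (lev k (take (Suc i) W) v)"
    and rv: "schreier_rev \<Gamma> (?p ! i) = (coset_of w k (lev k (take (Suc i) W) v), el [flip (W ! i)])"
    if "i < ?m" for i
    unfolding nth[OF that] head_X[OF tk letter[OF that]] Suc[OF that] by simp_all
  have "set ?p \<subseteq> arcs (X k)"
  proof
    fix e assume "e \<in> set ?p"
    then obtain i where i: "i < ?m" "e = ?p ! i" by (auto simp: in_set_conv_nth)
    then have "e = (\<lambda>(v, s). (coset_of w k v, el [s])) (lev k (take i W) v, W ! i)" using nth by simp
    then show "e \<in> arcs (X k)" unfolding arcs_X using tk letter[OF i(1)] by (rule image_eqI[OF _ SigmaI])
  qed
  moreover have "?p \<noteq> []" using ne by (cases W) simp_all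
  moreover have "cyclic_chain (\<lambda>e e'. head (X k) e = tail (X k) e' \<and> e' \<noteq> schreier_rev \<Gamma> e) ?p \<longleftrightarrow>
      lev k W v = v \<and> cyclic_chain (\<lambda>s s'. s' \<noteq> flip s) W"
  proof -
    have step: "(head (X k) (?p ! i) = tail (X k) (?p ! (Suc i mod ?m)) \<and> ?p ! (Suc i mod ?m) \<noteq> schreier_rev \<Gamma> (?p ! i)) \<longleftrightarrow>
        lev k (take (Suc i) W) v = lev k (take (Suc i mod ?m) W) v \<and> W ! (Suc i mod ?m) \<noteq> flip (W ! i)"
      if i: "i < ?m" for i
    proof -
      have j: "Suc i mod ?m < ?m" using m by simp
      have "flip (W ! i) \<in> letters" using letter[OF i] by (rule L.iv_in)
      then have "el [W ! (Suc i mod ?m)] = el [flip (W ! i)] \<longleftrightarrow> W ! (Suc i mod ?m) = flip (W ! i)"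
        using el_letter_inj[OF letter[OF j] \<open>flip (W ! i) \<in> letters\<close>] by auto
      moreover have "coset_of w k (lev k (take (Suc i) W) v) = coset_of w k (lev k (take (Suc i mod ?m) W) v) \<longleftrightarrow>
          lev k (take (Suc i) W) v = lev k (take (Suc i mod ?m) W) v"
        using coset_of_inj[OF tk tk, of "Suc i" "Suc i mod ?m"] by auto
      ultimately show ?thesis unfolding hd[OF i] rv[OF i] nth[OF j] tail_X prod.inject by blast
    qed
    have closing: "(\<forall>i<?m. lev k (take (Suc i) W) v = lev k (take (Suc i mod ?m) W) v) \<longleftrightarrow> lev k W v = v"
    proof
      assume "\<forall>i<?m. lev k (take (Suc i) W) v = lev k (take (Suc i mod ?m) W) v"
      moreover have "?m - 1 < ?m" "Suc (?m - 1) = ?m" using m by auto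
      ultimately have "lev k (take ?m W) v = lev k (take (?m mod ?m) W) v" by metis
      then show "lev k W v = v" by (simp add: lev_Nil[OF v])
    next
      assume h: "lev k W v = v"
      show "\<forall>i<?m. lev k (take (Suc i) W) v = lev k (take (Suc i mod ?m) W) v"
      proof (intro allI impI)
        fix i assume "i < ?m"
        then consider "Suc i < ?m" | "Suc i = ?m" by linarith
        then show "lev k (take (Suc i) W) v = lev k (take (Suc i mod ?m) W) v"
          by cases (simp_all add: h lev_Nil[OF v])
      qed
    qed
    have "cyclic_chain (\<lambda>e e'. head (X k) e = tail (X k) e' \<and> e' \<noteq> schreier_rev \<Gamma> e) ?p \<longleftrightarrow>
        (\<forall>i<?m. lev k (take (Suc i) W) v = lev k (take (Suc i mod ?m) W) v \<and> W ! (Suc i mod ?m) \<noteq> flip (W ! i))"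
      unfolding cyclic_chain_def length_walk_arcs by (intro all_cong step)
    also have "\<dots> \<longleftrightarrow> lev k W v = v \<and> cyclic_chain (\<lambda>s s'. s' \<noteq> flip s) W"
      unfolding cyclic_chain_def closing[symmetric] by blast
    finally show ?thesis .
  qed
  ultimately show ?thesis
    unfolding closed_reduced_paths_def cyclic_chain_cwords[OF ne] fixed_def using W v by blast
qed

lemma chain_walk_arcs:
  "set p \<subseteq> arcs (X k) \<Longrightarrow> successively (\<lambda>e e'. head (X k) e = tail (X k) e') p \<Longrightarrow> p \<noteq> [] \<Longrightarrow>
    \<exists>v W. v \<in> pwords k \<and> set W \<subseteq> letters \<and> p = walk_arcs k v W"
proof (induction p)
  case (Cons e p)
  have "e \<in> arcs (X k)" using Cons.prems(1) by simp
  then obtain v s where vs: "v \<in> pwords k" "s \<in> letters" "e = (coset_of w k v, el [s])"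
    unfolding arcs_X by (elim imageE) (simp add: case_prod_unfold, metis prod.collapse mem_Sigma_iff)
  show ?case
  proof (cases "p = []")
    case True
    then show ?thesis using vs by (intro exI[of _ v] exI[of _ "[s]"]) simp
  next
    case False
    have "set p \<subseteq> arcs (X k)" "successively (\<lambda>e e'. head (X k) e = tail (X k) e') p"
      using Cons.prems False by (auto simp: successively_Cons)
    then obtain v' W where v': "v' \<in> pwords k" "set W \<subseteq> letters" "p = walk_arcs k v' W"
      using Cons.IH False by blast
    then obtain s' W' where W: "W = s' # W'" using False by (cases W) simp_all
    have "head (X k) e = tail (X k) (hd p)" using Cons.prems(2) False by (auto simp: successively_Cons)
    then have "coset_of w k (lev k [s] v) = coset_of w k v'"
      using head_X(1)[OF vs(1,2)] vs(3) v'(3) W by simp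
    then have "lev k [s] v = v'"
      using coset_of_inj[OF _ v'(1)] lev_closed[of "[s]" v k] vs by simp
    then show ?thesis using vs v' by (intro exI[of _ v] exI[of _ "s # W"]) simp
  qed
qed simp

lemma card_closed_reduced_paths:
  assumes "m \<noteq> 0"
  shows "card {p \<in> closed_reduced_paths (X k) (schreier_rev \<Gamma>). length p = m} = (\<Sum>W\<in>L.cwords m. card (fixed k W))"
proof -
  let ?A = "Sigma (L.cwords m) (fixed k)" and ?f = "\<lambda>(W, v). walk_arcs k v W"
  have mem: "set W \<subseteq> letters" "length W = m" "W \<noteq> []" if "W \<in> L.cwords m" for W
    using that assms by (auto simp: L.cwords_def L.words_def)
  have fx: "v \<in> pwords k" if "v \<in> fixed k W" for v W using that unfolding fixed_def by blast
  have inj: "inj_on ?f ?A"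
  proof (rule inj_onI)
    fix x y assume x: "x \<in> ?A" "y \<in> ?A" and eq: "?f x = ?f y"
    obtain W v W' v' where xy: "x = (W, v)" "y = (W', v')" by (metis surj_pair)
    then have h: "W \<in> L.cwords m" "v \<in> fixed k W" "W' \<in> L.cwords m" "v' \<in> fixed k W'"
      and eq': "walk_arcs k v W = walk_arcs k v' W'"
      using x eq by simp_all
    have "v = v' \<and> W = W'"
      by (rule walk_arcs_inj[OF fx[OF h(2)] fx[OF h(4)] mem(1)[OF h(1)] mem(1)[OF h(3)] mem(3)[OF h(1)] eq'])
    then show "x = y" using xy by simp
  qed
  have im: "?f ` ?A = {p \<in> closed_reduced_paths (X k) (schreier_rev \<Gamma>). length p = m}"
  proof (intro equalityI subsetI)
    fix p assume "p \<in> ?f ` ?A"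
    then obtain W v where h: "W \<in> L.cwords m" "v \<in> fixed k W" "p = walk_arcs k v W" by auto
    have "p \<in> closed_reduced_paths (X k) (schreier_rev \<Gamma>)"
      unfolding h(3) walk_arcs_closed_reduced[OF fx[OF h(2)] mem(1)[OF h(1)] mem(3)[OF h(1)]]
      using h mem(2)[OF h(1)] by simp
    then show "p \<in> {p \<in> closed_reduced_paths (X k) (schreier_rev \<Gamma>). length p = m}"
      using h(3) mem(2)[OF h(1)] by simp
  next
    fix p assume "p \<in> {p \<in> closed_reduced_paths (X k) (schreier_rev \<Gamma>). length p = m}"
    then have p: "p \<in> closed_reduced_paths (X k) (schreier_rev \<Gamma>)" "length p = m" by auto
    have ne: "p \<noteq> []" using p assms by auto
    have "cyclic_chain (\<lambda>e e'. head (X k) e = tail (X k) e') p" "set p \<subseteq> arcs (X k)"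
      using p(1) unfolding closed_reduced_paths_def cyclic_chain_def by blast+
    then obtain v W where vW: "v \<in> pwords k" "set W \<subseteq> letters" "p = walk_arcs k v W"
      using chain_walk_arcs[of p k] cyclic_chain_iff_successively[OF ne] ne by blast
    then have "length W = m" "W \<noteq> []" using p(2) assms by auto
    then have "W \<in> L.cwords m" "v \<in> fixed k W"
      using walk_arcs_closed_reduced[OF vW(1,2)] p(1) unfolding vW(3) by simp_all
    then show "p \<in> ?f ` ?A" using vW(3) by (intro image_eqI[of _ _ "(W, v)"]) auto
  qed
  have "card {p \<in> closed_reduced_paths (X k) (schreier_rev \<Gamma>). length p = m} = card ?A"
    unfolding im[symmetric] by (rule card_image[OF inj])
  also have "\<dots> = (\<Sum>W\<in>L.cwords m. card (fixed k W))" by (rule card_SigmaI) simp_all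
  finally show ?thesis .
qed

lemma closed_reduced_count:
  "of_nat (card {p \<in> closed_reduced_paths (X k) (schreier_rev \<Gamma>). length p = m}) * (t ^ m / of_nat m) =
    of_nat (n ^ k) * (L.csum (fix_ratio k) m * (t ^ m / of_nat m))" for t :: complex
proof (cases "m = 0")
  case False
  have "of_nat (n ^ k) * L.csum (fix_ratio k) m = (\<Sum>W\<in>L.cwords m. of_nat (card (fixed k W)))"
    using n_ge2 by (simp add: L.csum_def fix_ratio_def sum_divide_distrib[symmetric])
  then show ?thesis by (simp only: card_closed_reduced_paths[OF False] of_nat_sum mult.assoc[symmetric])
qed simp

lemma has_ln_ihara_zeta_X:
  assumes t: "norm t * (2 * real n - 1) < 1"
  shows "has_ln_ihara_zeta (X k) (schreier_rev \<Gamma>) t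
    (of_nat (n ^ k) * (\<Sum>m. L.csum (fix_ratio k) m * (t ^ m / of_nat m)))"
proof -
  let ?N = "\<lambda>m. card {p \<in> closed_reduced_paths (X k) (schreier_rev \<Gamma>). length p = m}"
  have r: "0 \<le> (2 * real n - 1) * norm t" "(2 * real n - 1) * norm t < 1"
    using t n_ge2 by (simp_all add: mult.commute)
  have "norm t * 1 \<le> norm t * (2 * real n - 1)" using n_ge2 by (intro mult_left_mono) auto
  then have t1: "norm t < 1" using t by simp
  have bound: "real (?N m) * norm t ^ m \<le> real n ^ k * (2 * real n) * ((2 * real n - 1) * norm t) ^ m" for m
  proof (cases m)
    case 0
    have "{p \<in> closed_reduced_paths (X k) (schreier_rev \<Gamma>). length p = m} = {}"
      using 0 by (auto simp: closed_reduced_paths_def)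
    then have "?N m = 0" by (simp only: card.empty)
    then show ?thesis using 0 by (simp only:) simp
  next
    case (Suc j)
    then have "m \<noteq> 0" by simp
    have "?N m \<le> (\<Sum>W\<in>L.cwords m. n ^ k)"
      unfolding card_closed_reduced_paths[OF \<open>m \<noteq> 0\<close>]
    proof (rule sum_mono)
      fix W
      show "card (fixed k W) \<le> n ^ k"
        using card_mono[of "pwords k" "fixed k W"] by (simp add: card_pwords fixed_def)
    qed
    also have "\<dots> = card (L.cwords m) * n ^ k" by simp
    also have "\<dots> \<le> (2 * n * (2 * n - 1) ^ j) * n ^ k" unfolding Suc using card_cwords_le by (rule mult_right_mono) simp
    finally have "real (?N m) \<le> real ((2 * n * (2 * n - 1) ^ j) * n ^ k)" by (simp only: of_nat_le_iff)
    also have "\<dots> = 2 * real n * (2 * real n - 1) ^ j * real n ^ k" using n_ge2 by (simp add: of_nat_diff)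
    also have "\<dots> \<le> 2 * real n * (2 * real n - 1) ^ m * real n ^ k"
      unfolding Suc using n_ge2 by (intro mult_right_mono mult_left_mono power_increasing) auto
    finally have "real (?N m) * norm t ^ m \<le> (2 * real n * (2 * real n - 1) ^ m * real n ^ k) * norm t ^ m"
      by (rule mult_right_mono) simp
    then show ?thesis by (simp add: power_mult_distrib mult_ac)
  qed
  have "summable (\<lambda>m. real n ^ k * (2 * real n) * ((2 * real n - 1) * norm t) ^ m)"
    using r by (intro summable_mult summable_geometric) simp
  then have sm: "summable (\<lambda>m. of_nat (?N m) * norm t ^ m)"
    by (rule summable_comparison_test') (use bound in simp)
  have "has_ln_ihara_zeta (X k) (schreier_rev \<Gamma>) t (\<Sum>m. of_nat (?N m) * (t ^ m / of_nat m))"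
  proof (rule has_ln_ihara_zetaI[OF _ _ sm t1])
    show "tail (X k) e \<in> verts (X k)" if "e \<in> arcs (X k)" for e
      using that by (auto simp: schreier_graph_def)
    show "finite (arcs (X k))" unfolding arcs_X using L.finS by simp
  qed
  also have "(\<Sum>m. of_nat (?N m) * (t ^ m / of_nat m)) = of_nat (n ^ k) * (\<Sum>m. L.csum (fix_ratio k) m * (t ^ m / of_nat m))"
  proof -
    have "summable (\<lambda>m. L.csum (fix_ratio k) m * (t ^ m / of_nat m))"
    proof (rule summable_comparison_test')
      show "summable (\<lambda>m. 2 * real n * ((2 * real n - 1) * norm t) ^ m)"
        using r by (intro summable_mult summable_geometric) simp
    qed (rule norm_csum_fix_ratio_le)
    then show ?thesis unfolding closed_reduced_count by (rule suminf_mult)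
  qed
  finally show ?thesis .
qed

theorem has_schreier_zeta_parabolic:
  assumes t: "norm t * (2 * real n - 1) < 1"
  shows "has_schreier_zeta \<Gamma> SS (parabolic_subgroup \<Gamma> w) (prefix_stabilizer \<Gamma> w) t
    (exp (- (of_nat n - 1) * Ln (1 - t\<^sup>2) + (\<Sum>m. lim_coeff m * (t ^ m / of_nat m))))"
  unfolding has_schreier_zeta_def
proof (intro conjI ballI allI)
  fix \<gamma> assume \<gamma>: "\<gamma> \<in> carrier \<Gamma>"
  show "\<forall>\<^sub>F k in sequentially. \<gamma> \<in> Q k \<longleftrightarrow> \<gamma> \<in> parabolic_subgroup \<Gamma> w"
  proof (cases "\<gamma> w = w")
    case True
    then show ?thesis using \<gamma> by (simp add: prefix_stabilizer_def parabolic_subgroup_def stabilizer_def)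
  next
    case False
    then obtain i where i: "\<gamma> w i \<noteq> w i" by auto
    show ?thesis
      using eventually_ge_at_top[of "Suc i"]
    proof eventually_elim
      case (elim k)
      then show ?case using i by (auto simp: prefix_stabilizer_def parabolic_subgroup_def stabilizer_def)
    qed
  qed
next
  show "finite (verts (X k))" for k by (rule finite_verts_X)
next
  let ?s = "\<lambda>k. \<Sum>m. L.csum (fix_ratio k) m * (t ^ m / of_nat m)"
  let ?l = "\<lambda>k. of_nat (n ^ k) * ?s k"
  let ?L = "- (of_nat n - 1) * Ln (1 - t\<^sup>2) + (\<Sum>m. lim_coeff m * (t ^ m / of_nat m))"
  have "(\<lambda>k. ?l k / of_nat (card (verts (X k)))) \<longlonglongrightarrow> ?L"
    using log_zeta_limit(1)[OF t] n_ge2 by (simp add: card_verts_X)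
  then show "\<exists>l L. (\<forall>k. has_ln_ihara_zeta (X k) (schreier_rev \<Gamma>) t (l k)) \<and>
      (\<lambda>k. l k / of_nat (card (verts (X k)))) \<longlonglongrightarrow> L \<and> exp ?L = exp L"
    using has_ln_ihara_zeta_X[OF t] by (intro exI[of _ ?l] exI[of _ ?L]) blast
qed

end

end

section \<open>The zeta function of a marked group\<close>

lemma coeff_pcompose_scale:
  fixes p :: "'a::comm_ring_1 poly"
  shows "coeff (pcompose p [:0, c:]) i = c ^ i * coeff p i"
proof (induction p arbitrary: i)
  case (pCons a p)
  have "pcompose (pCons a p) [:0, c:] = [:a:] + pCons 0 (smult c (pcompose p [:0, c:]))"
    by (simp add: pcompose_pCons)
  then show ?case using pCons.IH by (cases i) (simp_all add: mult.assoc)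
qed simp

lemma infsum_Cauchy_Schwarz:
  fixes a b :: "'i \<Rightarrow> real"
  assumes a: "a summable_on I" "\<And>i. i \<in> I \<Longrightarrow> 0 \<le> a i"
    and ab: "(\<lambda>i. a i * b i) summable_on I" and ab2: "(\<lambda>i. a i * (b i)\<^sup>2) summable_on I"
  shows "(\<Sum>\<^sub>\<infinity>i\<in>I. a i * b i) \<le> sqrt (infsum a I * (\<Sum>\<^sub>\<infinity>i\<in>I. a i * (b i)\<^sup>2))"
proof (rule infsum_le_finite_sums[OF ab])
  fix F assume F: "finite F" "F \<subseteq> I"
  have nn: "0 \<le> a i" if "i \<in> F" for i using a(2) F that by blast
  have "(\<Sum>i\<in>F. a i * b i)\<^sup>2 = (\<Sum>i\<in>F. sqrt (a i) * (sqrt (a i) * b i))\<^sup>2"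
    by (intro arg_cong[where f = "\<lambda>x. x\<^sup>2"] sum.cong) (simp_all add: nn mult.assoc[symmetric])
  also have "\<dots> \<le> (\<Sum>i\<in>F. (sqrt (a i))\<^sup>2) * (\<Sum>i\<in>F. (sqrt (a i) * b i)\<^sup>2)"
    by (rule Cauchy_Schwarz_ineq_sum)
  also have "\<dots> = (\<Sum>i\<in>F. a i) * (\<Sum>i\<in>F. a i * (b i)\<^sup>2)"
    by (simp add: nn power_mult_distrib)
  also have "\<dots> \<le> infsum a I * (\<Sum>\<^sub>\<infinity>i\<in>I. a i * (b i)\<^sup>2)"
  proof (rule mult_mono)
    show "(\<Sum>i\<in>F. a i) \<le> infsum a I" using a F by (intro finite_sum_le_infsum) auto
    show "(\<Sum>i\<in>F. a i * (b i)\<^sup>2) \<le> (\<Sum>\<^sub>\<infinity>i\<in>I. a i * (b i)\<^sup>2)"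
      using a F by (intro finite_sum_le_infsum[OF ab2]) auto
  qed (use a nn in \<open>auto intro!: infsum_nonneg sum_nonneg\<close>)
  finally show "(\<Sum>i\<in>F. a i * b i) \<le> sqrt (infsum a I * (\<Sum>\<^sub>\<infinity>i\<in>I. a i * (b i)\<^sup>2))"
    by (rule real_le_rsqrt)
qed

lemma ell2_norm_nonneg: "ell2_norm H x \<ge> 0"
  by (simp add: ell2_norm_def infsum_nonneg)

lemma norm_le_ell2_norm:
  assumes "x \<in> ell2 H" "g \<in> carrier H" shows "norm (x g) \<le> ell2_norm H x"
proof -
  have "(\<Sum>g\<in>{g}. (norm (x g))\<^sup>2) \<le> (\<Sum>\<^sub>\<infinity>g\<in>carrier H. (norm (x g))\<^sup>2)"
    using assms by (intro finite_sum_le_infsum) (auto simp: ell2_def)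
  then show ?thesis by (simp add: ell2_norm_def real_le_rsqrt)
qed

text \<open>A sum of permutation operators with absolutely summable coefficients has norm at most
  the sum B of their moduli. Cauchy-Schwarz with weights |\<alpha> i| bounds |y g|^2 by B times a
  weighted sum of squares; summing over g, where each permutation preserves the norm, gives the
  second factor B.\<close>

lemma ell2_weighted_sum:
  fixes \<alpha> :: "'i \<Rightarrow> complex" and \<pi> :: "'i \<Rightarrow> 'h \<Rightarrow> 'h"
  assumes x: "x \<in> ell2 H" and bij: "\<And>i. i \<in> I \<Longrightarrow> bij_betw (\<pi> i) (carrier H) (carrier H)"
    and \<alpha>: "(\<lambda>i. norm (\<alpha> i)) summable_on I"
    and y: "\<And>g. g \<in> carrier H \<Longrightarrow> y g = (\<Sum>\<^sub>\<infinity>i\<in>I. \<alpha> i * x (\<pi> i g))"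
  shows "y \<in> ell2 H" and "ell2_norm H y \<le> (\<Sum>\<^sub>\<infinity>i\<in>I. norm (\<alpha> i)) * ell2_norm H x"
    and "g \<in> carrier H \<Longrightarrow> (\<lambda>i. \<alpha> i * x (\<pi> i g)) summable_on I"
proof -
  let ?C = "carrier H"
  define B where "B = (\<Sum>\<^sub>\<infinity>i\<in>I. norm (\<alpha> i))"
  define N where "N = (\<Sum>\<^sub>\<infinity>g\<in>?C. (norm (x g))\<^sup>2)"
  have B0: "0 \<le> B" "0 \<le> N" by (simp_all add: B_def N_def infsum_nonneg)
  have xs: "(\<lambda>g. (norm (x g))\<^sup>2) summable_on ?C" using x by (simp add: ell2_def)
  have xi: "(\<lambda>g. (norm (x (\<pi> i g)))\<^sup>2) summable_on ?C" "(\<Sum>\<^sub>\<infinity>g\<in>?C. (norm (x (\<pi> i g)))\<^sup>2) = N"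
    if "i \<in> I" for i
    using summable_on_reindex_bij_betw[OF bij[OF that], of "\<lambda>g. (norm (x g))\<^sup>2"] xs
      infsum_reindex_bij_betw[OF bij[OF that], of "\<lambda>g. (norm (x g))\<^sup>2"] by (simp_all add: N_def)
  have nx: "norm (x (\<pi> i g)) \<le> ell2_norm H x" if "i \<in> I" "g \<in> ?C" for i g
    using norm_le_ell2_norm[OF x] bij_betwE[OF bij[OF that(1)]] that(2) by blast
  let ?F = "\<lambda>(i, g). norm (\<alpha> i) * (norm (x (\<pi> i g)))\<^sup>2"
  have Fabs: "(\<lambda>z. norm (?F z)) summable_on (Sigma I (\<lambda>_. ?C))"
    unfolding Infinite_Sum.abs_summable_on_Sigma_iff
  proof (intro conjI ballI)
    fix i assume i: "i \<in> I"
    show "(\<lambda>g. norm (?F (i, g))) summable_on ?C"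
      using summable_on_cmult_right[OF xi(1)[OF i], of "norm (\<alpha> i)"] by (simp add: abs_mult)
  next
    have "(\<Sum>\<^sub>\<infinity>g\<in>?C. norm (?F (i, g))) = norm (\<alpha> i) * N" if "i \<in> I" for i
      using infsum_cmult_right[of "norm (\<alpha> i)" "\<lambda>g. (norm (x (\<pi> i g)))\<^sup>2" ?C] xi[OF that] by (simp add: abs_mult)
    then show "(\<lambda>i. norm (\<Sum>\<^sub>\<infinity>g\<in>?C. norm (?F (i, g)))) summable_on I"
      using summable_on_cmult_left[OF \<alpha>, of N] B0 by (simp add: abs_mult cong: summable_on_cong)
  qed
  then have F: "?F summable_on (I \<times> ?C)" by (rule abs_summable_summable)
  then have F': "(\<lambda>(g, i). ?F (i, g)) summable_on (?C \<times> I)" using summable_on_swap[of ?F I ?C] by blast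
  define Gs where "Gs g = (\<Sum>\<^sub>\<infinity>i\<in>I. norm (\<alpha> i) * (norm (x (\<pi> i g)))\<^sup>2)" for g
  have Gi: "(\<lambda>i. norm (\<alpha> i) * (norm (x (\<pi> i g)))\<^sup>2) summable_on I" if "g \<in> ?C" for g
    using summable_on_SigmaD1[of "\<lambda>g i. norm (\<alpha> i) * (norm (x (\<pi> i g)))\<^sup>2" ?C "\<lambda>_. I", OF _ that] F'
    by (simp add: case_prod_unfold)
  have Gsum: "Gs summable_on ?C"
  proof (rule has_sum_imp_summable[OF has_sum_SigmaD[OF has_sum_infsum[OF F']]])
    fix g assume "g \<in> ?C"
    then show "((\<lambda>i. case (g, i) of (g, i) \<Rightarrow> ?F (i, g)) has_sum Gs g) I"
      unfolding Gs_def by (simp add: has_sum_infsum[OF Gi])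
  qed
  have Gtot: "infsum Gs ?C = B * N"
  proof -
    have "infsum Gs ?C = (\<Sum>\<^sub>\<infinity>i\<in>I. \<Sum>\<^sub>\<infinity>g\<in>?C. norm (\<alpha> i) * (norm (x (\<pi> i g)))\<^sup>2)"
      unfolding Gs_def using infsum_swap_banach[of "\<lambda>i g. norm (\<alpha> i) * (norm (x (\<pi> i g)))\<^sup>2" I ?C] F by simp
    also have "\<dots> = (\<Sum>\<^sub>\<infinity>i\<in>I. norm (\<alpha> i) * N)"
      by (rule infsum_cong) (simp add: infsum_cmult_right xi)
    also have "\<dots> = B * N" unfolding B_def by (rule infsum_cmult_left) (rule \<alpha>)
    finally show ?thesis .
  qed
  have abs1: "(\<lambda>i. norm (\<alpha> i) * norm (x (\<pi> i g))) summable_on I" if g: "g \<in> ?C" for g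
  proof (rule summable_on_comparison_test)
    show "(\<lambda>i. norm (\<alpha> i) * ell2_norm H x) summable_on I" by (rule summable_on_cmult_left[OF \<alpha>])
  qed (use nx[OF _ g] in \<open>auto intro: mult_left_mono\<close>)
  have sm: "(\<lambda>i. \<alpha> i * x (\<pi> i g)) summable_on I" if g: "g \<in> ?C" for g
    by (rule abs_summable_summable) (use abs1[OF g] in \<open>simp add: norm_mult\<close>)
  then show "g \<in> carrier H \<Longrightarrow> (\<lambda>i. \<alpha> i * x (\<pi> i g)) summable_on I" .
  have y2: "(norm (y g))\<^sup>2 \<le> B * Gs g" if g: "g \<in> ?C" for g
  proof -
    have "norm (y g) \<le> (\<Sum>\<^sub>\<infinity>i\<in>I. norm (\<alpha> i * x (\<pi> i g)))"
      unfolding y[OF g] by (rule norm_infsum_bound) (use abs1[OF g] in \<open>simp add: norm_mult\<close>)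
    also have "\<dots> = (\<Sum>\<^sub>\<infinity>i\<in>I. norm (\<alpha> i) * norm (x (\<pi> i g)))" by (simp add: norm_mult)
    also have "\<dots> \<le> sqrt (B * Gs g)"
      unfolding B_def Gs_def by (rule infsum_Cauchy_Schwarz[OF \<alpha> _ abs1[OF g] Gi[OF g]]) simp
    finally have le: "norm (y g) \<le> sqrt (B * Gs g)" .
    have "0 \<le> B * Gs g" using B0 by (simp add: Gs_def infsum_nonneg)
    then show ?thesis using power_mono[OF le, of 2] by simp
  qed
  have BG: "(\<lambda>g. B * Gs g) summable_on ?C" by (rule summable_on_cmult_right[OF Gsum])
  have ys: "(\<lambda>g. (norm (y g))\<^sup>2) summable_on ?C"
    by (rule summable_on_comparison_test[OF BG]) (use y2 in auto)
  then show "y \<in> ell2 H" by (simp add: ell2_def)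
  have "(\<Sum>\<^sub>\<infinity>g\<in>?C. (norm (y g))\<^sup>2) \<le> (\<Sum>\<^sub>\<infinity>g\<in>?C. B * Gs g)"
    by (rule infsum_mono[OF ys BG]) (rule y2)
  also have "\<dots> = B * (B * N)" using infsum_cmult_right[OF Gsum, of B] Gtot by simp
  finally have "sqrt (\<Sum>\<^sub>\<infinity>g\<in>?C. (norm (y g))\<^sup>2) \<le> sqrt (B * (B * N))" by (rule real_sqrt_le_mono)
  also have "\<dots> = B * sqrt N" using B0 by (simp add: real_sqrt_mult mult.assoc[symmetric])
  finally show "ell2_norm H y \<le> (\<Sum>\<^sub>\<infinity>i\<in>I. norm (\<alpha> i)) * ell2_norm H x"
    by (simp add: ell2_norm_def B_def N_def)
qed

text \<open>Injectivity of \<open>gen\<close> makes the normalization of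
  \<open>markov_operator\<close>, by the cardinality of a set of group elements, agree with the
  number d of letters.\<close>

locale marked_group = free_letters S iv d + H: group H
  for S :: "'s set" and iv :: "'s \<Rightarrow> 's" and d :: nat and H :: "('h, 'k) monoid_scheme" +
  fixes gen :: "'s \<Rightarrow> 'h"
  assumes gen_closed: "s \<in> S \<Longrightarrow> gen s \<in> carrier H"
    and gen_iv: "s \<in> S \<Longrightarrow> gen (iv s) = inv\<^bsub>H\<^esub> gen s"
    and gen_inj: "inj_on gen S"
    and d2: "d \<ge> 2"
begin

primrec wact :: "'s list \<Rightarrow> 'h \<Rightarrow> 'h" where
  "wact [] g = g"
| "wact (s # W) g = wact W (gen s \<otimes>\<^bsub>H\<^esub> g)"

lemma wact_append: "wact (u @ v) g = wact v (wact u g)"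
  by (induction u arbitrary: g) simp_all

lemma wact_closed: "set W \<subseteq> S \<Longrightarrow> g \<in> carrier H \<Longrightarrow> wact W g \<in> carrier H"
  by (induction W arbitrary: g) (simp_all add: gen_closed)

lemma wact_iv: "s \<in> S \<Longrightarrow> g \<in> carrier H \<Longrightarrow> gen (iv s) \<otimes>\<^bsub>H\<^esub> (gen s \<otimes>\<^bsub>H\<^esub> g) = g"
  using gen_closed[of s] by (simp add: gen_iv H.m_assoc[symmetric])

lemma bij_wact: "set W \<subseteq> S \<Longrightarrow> bij_betw (wact W) (carrier H) (carrier H)"
proof (induction W)
  case Nil
  then show ?case by (simp add: bij_betw_def inj_on_def)
next
  case (Cons s W)
  have s: "s \<in> S" using Cons.prems by simp
  have "bij_betw (\<lambda>g. gen s \<otimes>\<^bsub>H\<^esub> g) (carrier H) (carrier H)"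
  proof (rule bij_betwI[where g = "\<lambda>g. gen (iv s) \<otimes>\<^bsub>H\<^esub> g"])
    show "gen s \<otimes>\<^bsub>H\<^esub> (gen (iv s) \<otimes>\<^bsub>H\<^esub> g) = g" if "g \<in> carrier H" for g
      using wact_iv[OF iv_in[OF s] that] iv_iv[OF s] by simp
  qed (use s gen_closed iv_in wact_iv in auto)
  then have "bij_betw (wact W \<circ> (\<lambda>g. gen s \<otimes>\<^bsub>H\<^esub> g)) (carrier H) (carrier H)"
    by (rule bij_betw_trans) (use Cons in simp)
  then show ?case by (simp add: comp_def)
qed

lemma cancels_wact: "g \<in> carrier H \<Longrightarrow> cancels (\<lambda>W. x (wact W g))"
  unfolding cancels_def by (simp add: wact_append wact_iv wact_closed)

abbreviation "MM \<equiv> markov_operator H (gen ` S)"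

lemma card_gen: "card (gen ` S) = d"
  using card_image[OF gen_inj] cardS by simp

lemma markov_power: "(MM ^^ i) x g = wsum (\<lambda>W. x (wact W g)) i / of_nat d ^ i"
proof (induction i arbitrary: g)
  case (Suc i)
  have "(MM ^^ Suc i) x g = (\<Sum>s\<in>S. (MM ^^ i) x (gen s \<otimes>\<^bsub>H\<^esub> g)) / of_nat d"
    by (simp add: markov_operator_def card_gen sum.reindex[OF gen_inj])
  then show ?case by (simp add: Suc wsum_Suc sum_divide_distrib[symmetric])
qed simp

text \<open>Substituting d x for x passes from the Markov operator to the adjacency operator, whose
  powers are plain sums over words.\<close>

lemma poly_op_scale:
  "poly_op (pcompose p [:0, of_nat d:]) MM x g = walk_eval (\<lambda>W. x (wact W g)) p"
proof -
  let ?q = "pcompose p [:0, of_nat d:]"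
  have d0: "(of_nat d :: complex) \<noteq> 0" using d2 by simp
  have "degree ?q = degree p" using d0 by (simp add: degree_pcompose)
  then show ?thesis
    using d0 by (simp add: poly_op_def walk_eval_def markov_power coeff_pcompose_scale)
qed

text \<open>\<open>kap m W\<close> is the coefficient of the reduced word \<open>W\<close> in the \<open>m\<close>-th Ihara polynomial of the adjacency operator.\<close>

definition kap :: "nat \<Rightarrow> 's list \<Rightarrow> complex" where
  "kap m W = (if length W = m then 1 else if even (m - length W) then - (of_nat d - 2) else 0)"

definition short :: "nat \<Rightarrow> 's list set" where
  "short m = (\<Union>l\<le>m. rwords l)"

lemma finite_short [simp]: "finite (short m)"
  by (simp add: short_def)

lemma short_closed: "W \<in> short m \<Longrightarrow> set W \<subseteq> S"
  by (auto simp: short_def rwords_def words_def)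

lemma sum_short:
  "(\<Sum>W\<in>short m. f W) = (\<Sum>l\<le>m. \<Sum>W\<in>rwords l. f W)" for f :: "'s list \<Rightarrow> 'z::comm_monoid_add"
  unfolding short_def
proof (rule sum.UNION_disjoint)
  show "\<forall>l\<in>{..m}. finite (rwords l)" by simp
  show "\<forall>i\<in>{..m}. \<forall>j\<in>{..m}. i \<noteq> j \<longrightarrow> rwords i \<inter> rwords j = {}" by (auto simp: rwords_def words_def)
qed simp

lemma card_short: "card (short m) \<le> Suc m * (d * (d - 1) ^ m)"
proof -
  have "card (rwords l) \<le> d * (d - 1) ^ m" if "l \<le> m" for l
  proof (cases l)
    case 0
    have "1 \<le> (d - 1) ^ m" using d2 by (intro one_le_power) simp
    then have "1 * 1 \<le> d * (d - 1) ^ m" using d2 by (intro mult_mono) simp_all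
    then show ?thesis using 0 by simp
  next
    case (Suc j)
    have "(d - 1) ^ j \<le> (d - 1) ^ m" using Suc that d2 by (intro power_increasing) auto
    then show ?thesis unfolding Suc card_rwords by simp
  qed
  then have "(\<Sum>l\<le>m. card (rwords l)) \<le> (\<Sum>l\<le>m. d * (d - 1) ^ m)" by (intro sum_mono) simp
  moreover have "card (short m) = (\<Sum>l\<le>m. card (rwords l))" using sum_short[of "\<lambda>_. 1 :: nat" m] by simp
  ultimately show ?thesis by simp
qed

lemma norm_kap: "norm (kap m W) \<le> real d"
proof -
  have "norm (of_nat d - 2 :: complex) = real d - 2"
    using d2 by (metis norm_of_nat of_nat_diff of_nat_numeral)
  then show ?thesis using d2 by (auto simp: kap_def norm_minus_commute)
qed

lemma walk_eval_short:
  assumes "cancels \<Phi>" shows "walk_eval \<Phi> (ihara_poly d (Suc m)) = (\<Sum>W\<in>short (Suc m). kap (Suc m) W * \<Phi> W)"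
proof -
  have len: "length W = l" if "W \<in> rwords l" for W l using that by (auto simp: rwords_def words_def)
  have "(\<Sum>W\<in>short (Suc m). kap (Suc m) W * \<Phi> W) =
      (\<Sum>l\<le>Suc m. (if l = Suc m then 1 else if even (Suc m - l) then - (of_nat d - 2) else 0) * rsum \<Phi> l)"
    unfolding sum_short rsum_def sum_distrib_left by (intro sum.cong refl) (simp add: kap_def len)
  also have "\<dots> = rsum \<Phi> (Suc m) + (\<Sum>l\<le>m. (if even (Suc m - l) then - (of_nat d - 2) else 0) * rsum \<Phi> l)"
    by (simp add: add.commute)
  also have "(\<Sum>l\<le>m. (if even (Suc m - l) then - (of_nat d - 2) else 0) * rsum \<Phi> l) =
      (\<Sum>l | l \<le> m \<and> even (m + 1 - l). - (of_nat d - 2) * rsum \<Phi> l)"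
    by (rule sum.mono_neutral_cong_right) auto
  finally show ?thesis unfolding walk_eval_cpoly[OF assms] sum_distrib_left[symmetric]
    by (simp only: mult_minus_left diff_conv_add_uminus)
qed

context
  fixes t :: complex
  assumes t: "norm t * (real d - 1) < 1"
begin

section \<open>The logarithm as a norm-convergent series of reduced words\<close>

definition coef :: "nat \<times> 's list \<Rightarrow> complex" where
  "coef = (\<lambda>(m, W). t ^ m / of_nat m * kap m W)"

definition tail_set :: "nat \<Rightarrow> (nat \<times> 's list) set" where
  "tail_set j = Sigma {j..} short"

definition bnd :: "nat \<Rightarrow> real" where
  "bnd m = (\<Sum>W\<in>short m. norm (coef (m, W)))"

lemma bnd_nonneg: "0 \<le> bnd m"
  by (simp add: bnd_def sum_nonneg)

lemma bnd_le: "bnd m \<le> 2 * (real d)\<^sup>2 * ((real d - 1) * norm t) ^ m"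
proof (cases "m = 0")
  case True
  then show ?thesis by (simp add: bnd_def coef_def)
next
  case False
  have "bnd m \<le> (\<Sum>W\<in>short m. norm t ^ m / real m * real d)"
    unfolding bnd_def
  proof (rule sum_mono)
    fix W
    have "norm (coef (m, W)) = norm t ^ m / real m * norm (kap m W)"
      by (simp add: coef_def norm_mult norm_divide norm_power)
    also have "\<dots> \<le> norm t ^ m / real m * real d" by (rule mult_left_mono[OF norm_kap]) simp
    finally show "norm (coef (m, W)) \<le> norm t ^ m / real m * real d" .
  qed
  also have "\<dots> = real (card (short m)) * (norm t ^ m / real m * real d)" by simp
  also have "\<dots> \<le> real (Suc m * (d * (d - 1) ^ m)) * (norm t ^ m / real m * real d)"
    using card_short[of m] by (intro mult_right_mono) (auto simp del: of_nat_mult of_nat_Suc)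
  also have "\<dots> = real (Suc m) / real m * ((real d)\<^sup>2 * ((real d - 1) * norm t) ^ m)"
  proof -
    have "real (d - 1) = real d - 1" using d2 by simp
    then have "real (Suc m * (d * (d - 1) ^ m)) = real (Suc m) * (real d * (real d - 1) ^ m)"
      by (simp only: of_nat_mult of_nat_power)
    then show ?thesis
      by (simp only: power_mult_distrib power2_eq_square times_divide_eq_right times_divide_eq_left mult_ac)
  qed
  \<comment> \<open>The number m + 1 of possible word lengths is absorbed by the factor 1 / m of the
    logarithm series, at the cost of a factor 2.\<close>
  also have "\<dots> \<le> 2 * ((real d)\<^sup>2 * ((real d - 1) * norm t) ^ m)"
  proof (rule mult_right_mono)
    show "real (Suc m) / real m \<le> 2" using False by (simp add: divide_le_eq)
    show "0 \<le> (real d)\<^sup>2 * ((real d - 1) * norm t) ^ m"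
      using d2 by (intro mult_nonneg_nonneg zero_le_power) simp_all
  qed
  finally show ?thesis by simp
qed

lemma summable_bnd: "summable bnd"
proof (rule summable_comparison_test')
  have "0 \<le> (real d - 1) * norm t" "(real d - 1) * norm t < 1" using t d2 by (simp_all add: mult.commute)
  then show "summable (\<lambda>m. 2 * (real d)\<^sup>2 * ((real d - 1) * norm t) ^ m)"
    by (intro summable_mult summable_geometric) simp
  show "norm (bnd m) \<le> 2 * (real d)\<^sup>2 * ((real d - 1) * norm t) ^ m" for m
    using bnd_le bnd_nonneg by simp
qed

lemma summable_coef: "(\<lambda>i. norm (coef i)) summable_on tail_set j"
proof -
  have "(\<lambda>i. norm (coef i)) summable_on Sigma UNIV short"
    unfolding Infinite_Sum.abs_summable_on_Sigma_iff
  proof (intro conjI ballI)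
    show "(\<lambda>W. norm (coef (m, W))) summable_on short m" for m by (rule summable_on_finite) simp
    have "(\<lambda>m. bnd m) summable_on UNIV"
      by (rule norm_summable_imp_summable_on) (use summable_bnd bnd_nonneg in simp)
    then show "(\<lambda>m. norm (\<Sum>\<^sub>\<infinity>W\<in>short m. norm (coef (m, W)))) summable_on UNIV"
      using bnd_nonneg by (simp add: bnd_def)
  qed
  then show ?thesis by (rule summable_on_subset_banach) (auto simp: tail_set_def)
qed

lemma infsum_coef: "(\<Sum>\<^sub>\<infinity>i\<in>tail_set j. norm (coef i)) = (\<Sum>m. bnd (m + j))"
proof -
  have "((\<lambda>i. norm (coef i)) has_sum (\<Sum>\<^sub>\<infinity>i\<in>tail_set j. norm (coef i))) (Sigma {j..} short)"
    using summable_coef[of j] unfolding tail_set_def by (rule has_sum_infsum)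
  then have "(bnd has_sum (\<Sum>\<^sub>\<infinity>i\<in>tail_set j. norm (coef i))) {j..}"
    by (rule has_sum_SigmaD) (rule has_sum_finiteI, simp_all add: bnd_def)
  moreover have "(bnd has_sum (\<Sum>\<^sub>\<infinity>i\<in>tail_set j. norm (coef i))) {j..} \<longleftrightarrow>
      ((\<lambda>m. bnd (m + j)) has_sum (\<Sum>\<^sub>\<infinity>i\<in>tail_set j. norm (coef i))) UNIV"
    by (rule has_sum_reindex_bij_witness[of _ "\<lambda>m. m + j" "\<lambda>m. m - j"]) auto
  ultimately show ?thesis by (intro sums_unique has_sum_imp_sums) simp
qed

text \<open>For j = 0 this is minus the logarithm of the operator; in general it is the remainder of
  the series from m = j on, controlled in norm by the tail of \<open>bnd\<close>. The sum runs over
  pairs (m, W) so that \<open>ell2_weighted_sum\<close> applies directly.\<close>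

definition tail_op :: "nat \<Rightarrow> ('h \<Rightarrow> complex) \<Rightarrow> 'h \<Rightarrow> complex" where
  "tail_op j x g = (\<Sum>\<^sub>\<infinity>i\<in>tail_set j. coef i * x (wact (snd i) g))"

lemma tail_op:
  assumes x: "x \<in> ell2 H"
  shows "tail_op j x \<in> ell2 H" "ell2_norm H (tail_op j x) \<le> (\<Sum>m. bnd (m + j)) * ell2_norm H x"
    and "g \<in> carrier H \<Longrightarrow> (\<lambda>i. coef i * x (wact (snd i) g)) summable_on tail_set j"
proof -
  have bij: "bij_betw (wact (snd i)) (carrier H) (carrier H)" if "i \<in> tail_set j" for i
  proof -
    obtain m W where i: "i = (m, W)" by (cases i)
    then have "W \<in> short m" using that by (simp add: tail_set_def)
    then show ?thesis unfolding i snd_conv by (intro bij_wact short_closed)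
  qed
  note e = ell2_weighted_sum[of x H "tail_set j" "\<lambda>i. wact (snd i)" coef "tail_op j x", OF x bij summable_coef tail_op_def]
  show "tail_op j x \<in> ell2 H" by (rule e(1))
  show "ell2_norm H (tail_op j x) \<le> (\<Sum>m. bnd (m + j)) * ell2_norm H x" using e(2) unfolding infsum_coef .
  show "g \<in> carrier H \<Longrightarrow> (\<lambda>i. coef i * x (wact (snd i) g)) summable_on tail_set j" by (rule e(3))
qed

lemma sum_short_coef:
  assumes "g \<in> carrier H"
  shows "(\<Sum>W\<in>short m. coef (m, W) * x (wact W g)) = t ^ m / of_nat m * walk_eval (\<lambda>W. x (wact W g)) (ihara_poly d m)"
proof (cases m)
  case 0
  then show ?thesis by (simp add: coef_def)
next
  case (Suc k)
  show ?thesis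
    unfolding Suc walk_eval_short[OF cancels_wact[OF assms]] sum_distrib_left by (simp add: coef_def mult.assoc)
qed

lemma tail_op_split:
  assumes x: "x \<in> ell2 H" and g: "g \<in> carrier H"
  shows "tail_op 0 x g = (\<Sum>m<j. t ^ m / of_nat m * walk_eval (\<lambda>W. x (wact W g)) (ihara_poly d m)) + tail_op j x g"
proof -
  have u: "tail_set 0 = Sigma {..<j} short \<union> tail_set j" by (auto simp: tail_set_def)
  have "tail_op 0 x g = (\<Sum>\<^sub>\<infinity>i\<in>Sigma {..<j} short. coef i * x (wact (snd i) g)) + tail_op j x g"
    unfolding tail_op_def u
  proof (rule infsum_Un_disjoint)
    show "(\<lambda>i. coef i * x (wact (snd i) g)) summable_on Sigma {..<j} short" by (rule summable_on_finite) simp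
    show "(\<lambda>i. coef i * x (wact (snd i) g)) summable_on tail_set j" by (rule tail_op(3)[OF x g])
  qed (auto simp: tail_set_def)
  also have "(\<Sum>\<^sub>\<infinity>i\<in>Sigma {..<j} short. coef i * x (wact (snd i) g)) =
      (\<Sum>m<j. \<Sum>W\<in>short m. coef (m, W) * x (wact W g))"
    by (subst sum.Sigma) (simp_all add: case_prod_unfold)
  finally show ?thesis by (simp only: sum_short_coef[OF g])
qed

lemma tail_op_sums:
  assumes x: "x \<in> ell2 H" and g: "g \<in> carrier H"
  shows "(\<lambda>m. t ^ m / of_nat m * walk_eval (\<lambda>W. x (wact W g)) (ihara_poly d m)) sums tail_op 0 x g"
proof -
  have "((\<lambda>i. coef i * x (wact (snd i) g)) has_sum tail_op 0 x g) (Sigma {0..} short)"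
    using tail_op(3)[OF x g, of 0] unfolding tail_op_def tail_set_def by (rule has_sum_infsum)
  then have "((\<lambda>m. t ^ m / of_nat m * walk_eval (\<lambda>W. x (wact W g)) (ihara_poly d m)) has_sum tail_op 0 x g) {0..}"
    by (rule has_sum_SigmaD) (rule has_sum_finiteI, simp_all add: sum_short_coef[OF g])
  then show ?thesis by (intro has_sum_imp_sums) (simp add: atLeast_0)
qed

definition log_poly :: "nat \<Rightarrow> complex poly" where
  "log_poly j = - (\<Sum>m<j. smult (t ^ m / of_nat m) (ihara_poly d m))"

lemma walk_eval_log_poly:
  "walk_eval \<Phi> (log_poly j) = - (\<Sum>m<j. t ^ m / of_nat m * walk_eval \<Phi> (ihara_poly d m))"
proof -
  have "walk_eval \<Phi> (\<Sum>m<j. smult (t ^ m / of_nat m) (ihara_poly d m)) =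
      (\<Sum>m<j. t ^ m / of_nat m * walk_eval \<Phi> (ihara_poly d m))"
    by (induction j) (simp_all add: walk_eval_add walk_eval_smult)
  then show ?thesis using walk_eval_minus[of \<Phi> 0 "\<Sum>m<j. smult (t ^ m / of_nat m) (ihara_poly d m)"]
    by (simp add: log_poly_def)
qed

text \<open>One sequence of polynomials serves both requirements: the partial sums of the series
  converge uniformly on [-1, 1] by the Weierstrass test, and in operator norm because their distance
  to the limit is \<open>tail_op j\<close>.\<close>

theorem functional_calculus_log:
  "is_functional_calculus H MM
    (\<lambda>x. Ln (1 - t * of_nat d * of_real x + (of_nat d - 1) * t\<^sup>2)) (\<lambda>x g. - tail_op 0 x g)"
  unfolding is_functional_calculus_def
proof (intro conjI ballI exI[of _ "\<lambda>j. pcompose (log_poly j) [:0, of_nat d:]"] allI impI)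
  fix x assume "x \<in> ell2 H"
  then show "(\<lambda>g. - tail_op 0 x g) \<in> ell2 H" using tail_op(1)[of x 0] by (simp add: ell2_def)
next
  let ?h = "\<lambda>m x. - (poly (ihara_poly d m) (of_real (of_nat d * x)) * (t ^ m / of_nat m))"
  have r: "0 \<le> (real d - 1) * norm t" "(real d - 1) * norm t < 1" using t d2 by (simp_all add: mult.commute)
  have sm: "summable (\<lambda>m. 2 * ((real d - 1) * norm t) ^ m)"
    using r by (intro summable_mult summable_geometric) simp
  have bound: "norm (?h m x) \<le> 2 * ((real d - 1) * norm t) ^ m" if "x \<in> {-1..1}" for m x
  proof -
    have "norm (t ^ m / of_nat m) \<le> norm t ^ m"
      using divide_left_mono[of 1 "real m" "norm t ^ m"]
      by (cases "m = 0") (simp_all add: norm_divide norm_power)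
    then have "norm (?h m x) \<le> (2 * (real d - 1) ^ m) * norm t ^ m"
      unfolding norm_minus_cancel norm_mult using norm_ihara_poly_le[OF d2, of x m] that d2
      by (intro mult_mono) auto
    then show ?thesis by (simp add: power_mult_distrib mult_ac)
  qed
  have ul: "uniform_limit {-1..1} (\<lambda>j x. \<Sum>m<j. ?h m x) (\<lambda>x. \<Sum>m. ?h m x) sequentially"
    by (rule Weierstrass_m_test[OF bound sm])
  have e1: "(\<Sum>m<j. ?h m x) = poly (pcompose (log_poly j) [:0, of_nat d:]) (of_real x)" for j x
    by (simp add: poly_pcompose log_poly_def poly_sum sum_negf mult_ac)
  have e2: "(\<Sum>m. ?h m x) = Ln (1 - t * of_nat d * of_real x + (of_nat d - 1) * t\<^sup>2)"
    if "x \<in> {-1..1}" for x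
    using sums_minus[OF ihara_log_series(2)[OF d2 _ t, of x]] that by (intro sums_unique[symmetric]) auto
  show "uniform_limit {-1..1} (\<lambda>j x. poly (pcompose (log_poly j) [:0, of_nat d:]) (complex_of_real x))
     (\<lambda>x. Ln (1 - t * of_nat d * of_real x + (of_nat d - 1) * t\<^sup>2)) sequentially"
    by (rule uniform_limit_cong'[THEN iffD1, OF e1 e2 ul])
next
  fix \<epsilon> :: real assume \<epsilon>: "\<epsilon> > 0"
  have "\<forall>\<^sub>F j in sequentially. (\<Sum>m. bnd (m + j)) < \<epsilon>"
    using order_tendstoD(2)[OF suminf_exist_split2[OF summable_bnd] \<epsilon>] by simp
  then show "\<forall>\<^sub>F j in sequentially. \<forall>x\<in>ell2 H.
      ell2_norm H (\<lambda>g. poly_op (pcompose (log_poly j) [:0, of_nat d:]) MM x g - - tail_op 0 x g) \<le> \<epsilon> * ell2_norm H x"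
  proof eventually_elim
    case (elim j)
    show ?case
    proof
      fix x assume x: "x \<in> ell2 H"
      have "poly_op (pcompose (log_poly j) [:0, of_nat d:]) MM x g - - tail_op 0 x g = tail_op j x g"
        if "g \<in> carrier H" for g
        unfolding poly_op_scale walk_eval_log_poly using tail_op_split[OF x that, of j] by simp
      then have "ell2_norm H (\<lambda>g. poly_op (pcompose (log_poly j) [:0, of_nat d:]) MM x g - - tail_op 0 x g) = ell2_norm H (tail_op j x)"
        unfolding ell2_norm_def by (simp cong: infsum_cong)
      also have "\<dots> \<le> (\<Sum>m. bnd (m + j)) * ell2_norm H x" by (rule tail_op(2)[OF x])
      also have "\<dots> \<le> \<epsilon> * ell2_norm H x" using elim ell2_norm_nonneg by (intro mult_right_mono) auto
      finally show "ell2_norm H (\<lambda>g. poly_op (pcompose (log_poly j) [:0, of_nat d:]) MM x g - - tail_op 0 x g) \<le> \<epsilon> * ell2_norm H x" .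
    qed
  qed
qed

lemma delta_ell2: "(indicator {\<one>\<^bsub>H\<^esub>} :: 'h \<Rightarrow> complex) \<in> ell2 H"
  unfolding ell2_def mem_Collect_eq
  by (rule finite_nonzero_values_imp_summable_on) (rule finite_subset[of _ "{\<one>\<^bsub>H\<^esub>}"], auto simp: indicator_def split: if_splits)

lemma vn_trace_eq: "vn_trace H L = L (indicator {\<one>\<^bsub>H\<^esub>}) \<one>\<^bsub>H\<^esub>"
proof -
  have "(\<Sum>\<^sub>\<infinity>g\<in>carrier H. L (indicator {\<one>\<^bsub>H\<^esub>}) g * cnj (indicator {\<one>\<^bsub>H\<^esub>} g)) =
      (\<Sum>\<^sub>\<infinity>g\<in>{\<one>\<^bsub>H\<^esub>}. L (indicator {\<one>\<^bsub>H\<^esub>}) g * cnj (indicator {\<one>\<^bsub>H\<^esub>} g))"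
    by (rule infsum_cong_neutral) auto
  then show ?thesis by (simp add: vn_trace_def ell2_inner_def)
qed

theorem has_group_zeta_walks:
  "has_group_zeta H (gen ` S) t (exp (- ((of_nat d - 2) / 2) * Ln (1 - t\<^sup>2) +
     (\<Sum>m. walk_eval (\<lambda>W. of_bool (wact W \<one>\<^bsub>H\<^esub> = \<one>\<^bsub>H\<^esub>)) (ihara_poly d m) * (t ^ m / of_nat m))))"
proof -
  let ?L = "\<lambda>x g. - tail_op 0 x g"
  have ind: "(\<lambda>W. indicator {\<one>\<^bsub>H\<^esub>} (wact W \<one>\<^bsub>H\<^esub>)) = (\<lambda>W. of_bool (wact W \<one>\<^bsub>H\<^esub> = \<one>\<^bsub>H\<^esub>) :: complex)"
    by (auto simp: indicator_def)
  have "vn_trace H ?L = - (\<Sum>m. walk_eval (\<lambda>W. of_bool (wact W \<one>\<^bsub>H\<^esub> = \<one>\<^bsub>H\<^esub>)) (ihara_poly d m) * (t ^ m / of_nat m))"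
    unfolding vn_trace_eq using sums_unique[OF tail_op_sums[OF delta_ell2 H.one_closed]]
    by (simp add: ind mult.commute)
  then show ?thesis
    unfolding has_group_zeta_def card_gen using functional_calculus_log by (intro exI[of _ ?L]) simp
qed

end

end

section \<open>Abelian groups\<close>

text \<open>The axioms are pulled back along \<psi>; in this way the wreath product is a group
  through its faithful realization as \<open>\<Gamma>\<close>.\<close>

lemma group_transport:
  assumes K: "group K" and inj: "inj_on \<psi> (carrier H)" and im: "\<psi> ` carrier H = carrier K"
    and closed: "\<And>x y. x \<in> carrier H \<Longrightarrow> y \<in> carrier H \<Longrightarrow> x \<otimes>\<^bsub>H\<^esub> y \<in> carrier H"
    and mult: "\<And>x y. x \<in> carrier H \<Longrightarrow> y \<in> carrier H \<Longrightarrow> \<psi> (x \<otimes>\<^bsub>H\<^esub> y) = \<psi> x \<otimes>\<^bsub>K\<^esub> \<psi> y"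
    and one: "\<one>\<^bsub>H\<^esub> \<in> carrier H" "\<psi> \<one>\<^bsub>H\<^esub> = \<one>\<^bsub>K\<^esub>"
  shows "group H"
proof -
  interpret K: group K by (rule K)
  have in_K: "\<psi> x \<in> carrier K" if "x \<in> carrier H" for x using im that by blast
  show ?thesis
  proof (rule groupI)
    fix x y z assume x: "x \<in> carrier H" and y: "y \<in> carrier H" and z: "z \<in> carrier H"
    have "\<psi> (x \<otimes>\<^bsub>H\<^esub> y \<otimes>\<^bsub>H\<^esub> z) = \<psi> (x \<otimes>\<^bsub>H\<^esub> (y \<otimes>\<^bsub>H\<^esub> z))"
      using x y z closed in_K by (simp add: mult K.m_assoc)
    then show "x \<otimes>\<^bsub>H\<^esub> y \<otimes>\<^bsub>H\<^esub> z = x \<otimes>\<^bsub>H\<^esub> (y \<otimes>\<^bsub>H\<^esub> z)"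
      using inj_onD[OF inj] x y z closed by blast
  next
    fix x assume x: "x \<in> carrier H"
    have "\<psi> (\<one>\<^bsub>H\<^esub> \<otimes>\<^bsub>H\<^esub> x) = \<psi> x" using x one in_K by (simp add: mult)
    then show "\<one>\<^bsub>H\<^esub> \<otimes>\<^bsub>H\<^esub> x = x" using inj_onD[OF inj] x one closed by blast
    have "inv\<^bsub>K\<^esub> (\<psi> x) \<in> \<psi> ` carrier H" using x in_K im by simp
    then obtain y where y: "y \<in> carrier H" "\<psi> y = inv\<^bsub>K\<^esub> (\<psi> x)" by (metis imageE)
    have "\<psi> (y \<otimes>\<^bsub>H\<^esub> x) = \<psi> \<one>\<^bsub>H\<^esub>" using x y in_K by (simp add: mult one)
    then have "y \<otimes>\<^bsub>H\<^esub> x = \<one>\<^bsub>H\<^esub>" using inj_onD[OF inj] x y one closed by blast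
    then show "\<exists>y\<in>carrier H. y \<otimes>\<^bsub>H\<^esub> x = \<one>\<^bsub>H\<^esub>" using y by blast
  qed (use closed one in auto)
qed

lemma agree_from_pred: "agree_from (Suc k) a b \<Longrightarrow> a k = b k \<Longrightarrow> agree_from k a b"
  unfolding agree_from_def
proof (intro allI impI)
  fix i assume "\<forall>i\<ge>Suc k. a i = b i" "a k = b k" "k \<le> i"
  then show "a i = b i" by (cases "i = k") simp_all
qed

locale comm_cayley_group = cayley_group G n + comm_group G for G :: "('a, 'm) monoid_scheme" (structure) and n
begin

section \<open>Pointwise multiplication of words and the powers of T\<close>

definition wmul :: "(nat \<Rightarrow> 'a) \<Rightarrow> (nat \<Rightarrow> 'a) \<Rightarrow> nat \<Rightarrow> 'a" where
  "wmul a b = (\<lambda>i. a i \<otimes> b i)"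

definition winv :: "(nat \<Rightarrow> 'a) \<Rightarrow> nat \<Rightarrow> 'a" where
  "winv a = (\<lambda>i. inv (a i))"

definition wone :: "nat \<Rightarrow> 'a" where
  "wone = (\<lambda>_. \<one>)"

definition single0 :: "'a \<Rightarrow> nat \<Rightarrow> 'a" where
  "single0 g = wone(0 := g)"

lemma wmul_closed [simp]: "a \<in> iwords \<Longrightarrow> b \<in> iwords \<Longrightarrow> wmul a b \<in> iwords"
  by (rule iwordsI) (simp add: wmul_def)

lemma winv_closed [simp]: "a \<in> iwords \<Longrightarrow> winv a \<in> iwords"
  by (rule iwordsI) (simp add: winv_def)

lemma wone_closed [simp]: "wone \<in> iwords"
  by (rule iwordsI) (simp add: wone_def)

lemma single0_closed [simp]: "g \<in> carrier G \<Longrightarrow> single0 g \<in> iwords"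
  unfolding single0_def by (rule upd_closed) simp_all

lemma wmul_assoc: "a \<in> iwords \<Longrightarrow> b \<in> iwords \<Longrightarrow> c \<in> iwords \<Longrightarrow> wmul (wmul a b) c = wmul a (wmul b c)"
  by (simp add: wmul_def m_assoc)

lemma wmul_comm: "a \<in> iwords \<Longrightarrow> b \<in> iwords \<Longrightarrow> wmul a b = wmul b a"
  by (simp add: wmul_def m_comm)

lemma wmul_wone [simp]: "a \<in> iwords \<Longrightarrow> wmul a wone = a" "a \<in> iwords \<Longrightarrow> wmul wone a = a"
  by (simp_all add: wmul_def wone_def)

text \<open>The letters of T a are the products of the prefixes of a, and these are multiplicative
  in a because G is commutative.\<close>

lemma T_wmul: "a \<in> iwords \<Longrightarrow> b \<in> iwords \<Longrightarrow> T (wmul a b) = wmul (T a) (T b)"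
proof
  fix i assume ab: "a \<in> iwords" "b \<in> iwords"
  then have c: "T a i \<in> carrier G" "T b i \<in> carrier G" for i using cay_closed[OF one_closed] by simp_all
  show "T (wmul a b) i = wmul (T a) (T b) i"
  proof (induction i)
    case 0
    then show ?case using ab by (simp add: wmul_def)
  next
    case (Suc i)
    have "T (wmul a b) (Suc i) = (T a i \<otimes> T b i) \<otimes> (a (Suc i) \<otimes> b (Suc i))"
      using Suc by (simp add: wmul_def)
    also have "\<dots> = (T a i \<otimes> a (Suc i)) \<otimes> (T b i \<otimes> b (Suc i))" using ab c by (simp add: m_ac)
    finally show ?case by (simp add: wmul_def)
  qed
qed

lemma V_wmul: "a \<in> iwords \<Longrightarrow> b \<in> iwords \<Longrightarrow> V (wmul a b) = wmul (V a) (V b)"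
proof -
  assume ab: "a \<in> iwords" "b \<in> iwords"
  have "T (wmul (V a) (V b)) = wmul a b" using ab by (simp add: T_wmul)
  then have "V (T (wmul (V a) (V b))) = V (wmul a b)" by simp
  then show ?thesis using ab by simp
qed

lemma T_wone [simp]: "T wone = wone"
proof
  fix i show "T wone i = wone i" by (induction i) (simp_all add: wone_def)
qed

lemma V_wone [simp]: "V wone = wone"
  using icay_cay[OF one_closed wone_closed] by simp

text \<open>The generator is affine, with linear part T and the constant word g as translation,
  which is T (single0 g) by \<open>T_single0\<close>. Its inverse has linear part V and a
  translation concentrated in the first letter.\<close>

lemma cay_wmul: "g \<in> carrier G \<Longrightarrow> a \<in> iwords \<Longrightarrow> cay g a = wmul (T a) (\<lambda>_. g)"
proof
  fix i assume g: "g \<in> carrier G" "a \<in> iwords"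
  then have c: "T a i \<in> carrier G" for i using cay_closed[OF one_closed] by simp
  show "cay g a i = wmul (T a) (\<lambda>_. g) i"
  proof (induction i)
    case 0
    then show ?case using g by (simp add: wmul_def m_comm)
  next
    case (Suc i)
    then show ?case using g c[of i] by (simp add: wmul_def m_ac)
  qed
qed

lemma T_single0: "g \<in> carrier G \<Longrightarrow> T (single0 g) = (\<lambda>_. g)"
proof
  fix i assume "g \<in> carrier G"
  then show "T (single0 g) i = g" by (induction i) (simp_all add: single0_def wone_def)
qed

lemma icay_wmul: "g \<in> carrier G \<Longrightarrow> a \<in> iwords \<Longrightarrow> icay g a = wmul (V a) (single0 (inv g))"
proof
  fix i assume "g \<in> carrier G" "a \<in> iwords"
  then show "icay g a i = wmul (V a) (single0 (inv g)) i"
    by (cases i) (simp_all add: wmul_def single0_def wone_def m_comm)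
qed

definition Tz :: "int \<Rightarrow> (nat \<Rightarrow> 'a) \<Rightarrow> nat \<Rightarrow> 'a" where
  "Tz h = (if 0 \<le> h then T ^^ nat h else V ^^ nat (- h))"

lemma Tz_closed [simp]: "a \<in> iwords \<Longrightarrow> Tz h a \<in> iwords"
  by (simp add: Tz_def)

lemma Tz_0 [simp]: "Tz 0 a = a"
  by (simp add: Tz_def)

lemma T_Tz: "a \<in> iwords \<Longrightarrow> T (Tz h a) = Tz (h + 1) a"
proof (cases "0 \<le> h")
  case True
  then have "nat (h + 1) = Suc (nat h)" by simp
  then show ?thesis using True by (simp add: Tz_def)
next
  case False
  assume a: "a \<in> iwords"
  from False have "nat (- h) = Suc (nat (- (h + 1)))" by simp
  then have "T (Tz h a) = (V ^^ nat (- (h + 1))) a" using False a by (simp add: Tz_def)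
  also have "\<dots> = Tz (h + 1) a" using False by (cases "h + 1 = 0") (simp_all add: Tz_def)
  finally show ?thesis .
qed

lemma V_Tz: "a \<in> iwords \<Longrightarrow> V (Tz h a) = Tz (h - 1) a"
  using T_Tz[of a "h - 1"] icay_cay[OF one_closed Tz_closed[of a "h - 1"]] by simp

lemma Tz_add: "a \<in> iwords \<Longrightarrow> Tz h (Tz k a) = Tz (h + k) a"
proof (induction h rule: int_induct[of _ 0])
  case base
  then show ?case by simp
next
  case (step1 i)
  then have "Tz (i + 1) (Tz k a) = T (Tz (i + k) a)" using T_Tz[OF Tz_closed[of a k], of i] by simp
  then show ?case using T_Tz[of a "i + k"] step1 by (simp add: algebra_simps)
next
  case (step2 i)
  then have "Tz (i - 1) (Tz k a) = V (Tz (i + k) a)" using V_Tz[OF Tz_closed[of a k], of i] by simp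
  then show ?case using V_Tz[of a "i + k"] step2 by (simp add: algebra_simps)
qed

lemma Tz_wmul: "a \<in> iwords \<Longrightarrow> b \<in> iwords \<Longrightarrow> Tz h (wmul a b) = wmul (Tz h a) (Tz h b)"
proof (induction h rule: int_induct[of _ 0])
  case base
  then show ?case by simp
next
  case (step1 i)
  have "Tz (i + 1) (wmul a b) = T (Tz i (wmul a b))" using step1.prems T_Tz[OF wmul_closed] by simp
  also have "\<dots> = wmul (T (Tz i a)) (T (Tz i b))" using step1 by (simp only: T_wmul Tz_closed)
  finally show ?case using step1.prems by (simp only: T_Tz)
next
  case (step2 i)
  have "Tz (i - 1) (wmul a b) = V (Tz i (wmul a b))" using step2.prems V_Tz[OF wmul_closed] by simp
  also have "\<dots> = wmul (V (Tz i a)) (V (Tz i b))" using step2 by (simp only: V_wmul Tz_closed)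
  finally show ?case using step2.prems by (simp only: V_Tz)
qed

lemma Tz_wone [simp]: "Tz h wone = wone"
proof (induction h rule: int_induct[of _ 0])
  case (step1 i)
  then show ?case using T_Tz[OF wone_closed, of i] by simp
next
  case (step2 i)
  then show ?case using V_Tz[OF wone_closed, of i] by simp
qed simp

lemma wmul_winv: "a \<in> iwords \<Longrightarrow> wmul a (winv a) = wone"
  by (simp add: wmul_def winv_def wone_def)

lemma Tz_winv: "a \<in> iwords \<Longrightarrow> Tz h (winv a) = winv (Tz h a)"
proof -
  assume a: "a \<in> iwords"
  have e: "wmul (Tz h a) (Tz h (winv a)) = wone"
    using a Tz_wmul[of a "winv a" h] by (simp add: wmul_winv)
  show ?thesis
  proof
    fix i
    have "Tz h a i \<otimes> Tz h (winv a) i = \<one>" using fun_cong[OF e, of i] by (simp add: wmul_def wone_def)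
    moreover have "Tz h a i \<in> carrier G" "Tz h (winv a) i \<in> carrier G"
      using iwordsD[OF Tz_closed[OF a]] iwordsD[OF Tz_closed[OF winv_closed[OF a]]] by auto
    ultimately have "inv (Tz h a i) = Tz h (winv a) i"
      by (intro inv_equality) (simp_all add: m_comm)
    then show "Tz h (winv a) i = winv (Tz h a) i" by (simp add: winv_def)
  qed
qed

text \<open>An element of the restricted product acts as the translation by \<open>transl f\<close>; its coordinate \<open>i\<close>
  contributes \<open>Tz i\<close> applied to the translation of the first letter.\<close>

definition fsupp :: "(int \<Rightarrow> 'a) \<Rightarrow> int set" where
  "fsupp f = {i. f i \<noteq> \<one>}"

definition fin_funs :: "(int \<Rightarrow> 'a) set" where
  "fin_funs = {f. (\<forall>i. f i \<in> carrier G) \<and> finite (fsupp f)}"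

definition transl :: "(int \<Rightarrow> 'a) \<Rightarrow> nat \<Rightarrow> 'a" where
  "transl f = (\<lambda>j. finprod G (\<lambda>i. Tz i (single0 (f i)) j) (fsupp f))"

lemma fin_funsD [simp]:
  "f \<in> fin_funs \<Longrightarrow> f i \<in> carrier G" and fin_funs_finite [simp]: "f \<in> fin_funs \<Longrightarrow> finite (fsupp f)"
  unfolding fin_funs_def by simp_all

lemma fin_funsI: "(\<And>i. f i \<in> carrier G) \<Longrightarrow> finite (fsupp f) \<Longrightarrow> f \<in> fin_funs"
  unfolding fin_funs_def by simp

lemma coord_closed: "f \<in> fin_funs \<Longrightarrow> Tz i (single0 (f i)) j \<in> carrier G"
  by (rule iwordsD) simp

lemma transl_closed [simp]: "f \<in> fin_funs \<Longrightarrow> transl f \<in> iwords"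
  unfolding transl_def by (intro iwordsI finprod_closed Pi_I coord_closed)

lemma single0_one [simp]: "single0 \<one> = wone"
  by (simp add: single0_def wone_def fun_eq_iff)

lemma transl_superset:
  assumes "f \<in> fin_funs" "finite A" "fsupp f \<subseteq> A"
  shows "transl f = (\<lambda>j. finprod G (\<lambda>i. Tz i (single0 (f i)) j) A)"
proof
  fix j show "transl f j = finprod G (\<lambda>i. Tz i (single0 (f i)) j) A"
    unfolding transl_def
  proof (rule finprod_mono_neutral_cong_left[OF assms(2,3)])
    fix i assume "i \<in> A - fsupp f"
    then have "f i = \<one>" by (simp add: fsupp_def)
    then show "Tz i (single0 (f i)) j = \<one>"
      by (simp only: single0_one Tz_wone) (simp add: wone_def)
  qed (use coord_closed[OF assms(1)] in auto)
qed

definition fmul :: "(int \<Rightarrow> 'a) \<Rightarrow> (int \<Rightarrow> 'a) \<Rightarrow> int \<Rightarrow> 'a" where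
  "fmul f g = (\<lambda>i. f i \<otimes> g i)"

definition shift :: "int \<Rightarrow> (int \<Rightarrow> 'a) \<Rightarrow> int \<Rightarrow> 'a" where
  "shift a f = (\<lambda>i. f (i - a))"

lemma fsupp_fmul: "fsupp (fmul f g) \<subseteq> fsupp f \<union> fsupp g"
  by (auto simp: fsupp_def fmul_def)

lemma fsupp_shift: "fsupp (shift a f) = (\<lambda>i. i + a) ` fsupp f"
proof (intro equalityI subsetI)
  fix i assume "i \<in> fsupp (shift a f)"
  then have "i - a \<in> fsupp f" by (simp add: fsupp_def shift_def)
  then show "i \<in> (\<lambda>i. i + a) ` fsupp f" by (intro image_eqI[of _ _ "i - a"]) simp_all
qed (auto simp: fsupp_def shift_def)

lemma fmul_closed [simp]: "f \<in> fin_funs \<Longrightarrow> g \<in> fin_funs \<Longrightarrow> fmul f g \<in> fin_funs"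
  by (rule fin_funsI) (simp_all add: fmul_def finite_subset[OF fsupp_fmul, unfolded fmul_def])

lemma shift_closed [simp]: "f \<in> fin_funs \<Longrightarrow> shift a f \<in> fin_funs"
  by (rule fin_funsI) (simp add: shift_def, simp add: fsupp_shift)

lemma single0_mult: "x \<in> carrier G \<Longrightarrow> y \<in> carrier G \<Longrightarrow> single0 (x \<otimes> y) = wmul (single0 x) (single0 y)"
  by (simp add: single0_def wmul_def wone_def fun_eq_iff)

lemma transl_fmul:
  assumes f: "f \<in> fin_funs" and g: "g \<in> fin_funs"
  shows "transl (fmul f g) = wmul (transl f) (transl g)"
proof
  fix j
  let ?A = "fsupp f \<union> fsupp g"
  have A: "finite ?A" using f g by simp
  have "transl (fmul f g) j = finprod G (\<lambda>i. Tz i (single0 (fmul f g i)) j) ?A"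
    by (simp add: transl_superset[OF fmul_closed[OF f g] A fsupp_fmul])
  also have "\<dots> = finprod G (\<lambda>i. Tz i (single0 (f i)) j \<otimes> Tz i (single0 (g i)) j) ?A"
  proof (rule finprod_cong')
    show "Tz i (single0 (fmul f g i)) j = Tz i (single0 (f i)) j \<otimes> Tz i (single0 (g i)) j" for i
    proof -
      have "Tz i (single0 (fmul f g i)) = wmul (Tz i (single0 (f i))) (Tz i (single0 (g i)))"
        using f g by (simp add: fmul_def single0_mult Tz_wmul)
      then show ?thesis by (simp add: wmul_def)
    qed
  qed (use coord_closed[OF f] coord_closed[OF g] in auto)
  also have "\<dots> = finprod G (\<lambda>i. Tz i (single0 (f i)) j) ?A \<otimes> finprod G (\<lambda>i. Tz i (single0 (g i)) j) ?A"
    using coord_closed[OF f] coord_closed[OF g] by (intro finprod_multf) auto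
  also have "\<dots> = transl f j \<otimes> transl g j"
    by (simp add: transl_superset[OF f A] transl_superset[OF g A])
  finally show "transl (fmul f g) j = wmul (transl f) (transl g) j" by (simp add: wmul_def)
qed

lemma Tz_finprod:
  assumes "finite A" "\<And>i. i \<in> A \<Longrightarrow> u i \<in> iwords"
  shows "(\<lambda>j. finprod G (\<lambda>i. u i j) A) \<in> iwords \<and>
    Tz a (\<lambda>j. finprod G (\<lambda>i. u i j) A) = (\<lambda>j. finprod G (\<lambda>i. Tz a (u i) j) A)"
  using assms
proof (induction A rule: finite_induct)
  case empty
  then show ?case using Tz_wone[of a] wone_closed by (simp add: wone_def)
next
  case (insert x A)
  have c: "u i j \<in> carrier G" "Tz a (u i) j \<in> carrier G" if "i \<in> insert x A" for i j
    using insert.prems[OF that] iwordsD[OF Tz_closed] by auto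
  have 1: "(\<lambda>j. finprod G (\<lambda>i. u i j) (insert x A)) = wmul (u x) (\<lambda>j. finprod G (\<lambda>i. u i j) A)"
    unfolding wmul_def using insert.hyps c(1) by (intro ext finprod_insert) auto
  have 2: "(\<lambda>j. finprod G (\<lambda>i. Tz a (u i) j) (insert x A)) = wmul (Tz a (u x)) (\<lambda>j. finprod G (\<lambda>i. Tz a (u i) j) A)"
    unfolding wmul_def using insert.hyps c(2) by (intro ext finprod_insert) auto
  have IH: "(\<lambda>j. finprod G (\<lambda>i. u i j) A) \<in> iwords"
    "Tz a (\<lambda>j. finprod G (\<lambda>i. u i j) A) = (\<lambda>j. finprod G (\<lambda>i. Tz a (u i) j) A)"
    using insert.IH insert.prems by auto
  show ?case unfolding 1 2 using IH(1) insert.prems[of x] by (simp add: Tz_wmul IH(2))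
qed

text \<open>Each coordinate i enters through T^i, so applying T^a shifts the coordinates by a; this
  is the action of the integers in the wreath product.\<close>

lemma Tz_transl:
  assumes f: "f \<in> fin_funs" shows "Tz a (transl f) = transl (shift a f)"
proof
  fix j
  have "Tz a (transl f) j = finprod G (\<lambda>i. Tz a (Tz i (single0 (f i))) j) (fsupp f)"
    unfolding transl_def using Tz_finprod[of "fsupp f" "\<lambda>i. Tz i (single0 (f i))" a] f by simp
  also have "\<dots> = finprod G (\<lambda>i. Tz (i + a) (single0 (shift a f (i + a))) j) (fsupp f)"
    using f by (simp add: Tz_add shift_def add.commute)
  also have "\<dots> = finprod G (\<lambda>i. Tz i (single0 (shift a f i)) j) ((\<lambda>i. i + a) ` fsupp f)"
    by (rule finprod_reindex[symmetric]) (use coord_closed[OF shift_closed[OF f]] in auto)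
  finally show "Tz a (transl f) j = transl (shift a f) j" unfolding transl_def fsupp_shift .
qed

text \<open>V moves the last nontrivial letter one place to the right without losing it: agreement
  with the trivial word from k on would propagate back to position 0 by
  \<open>agree_from_V_funpow\<close>.\<close>

lemma V_funpow_single0:
  assumes g: "g \<in> carrier G" "g \<noteq> \<one>" shows "(V ^^ k) (single0 g) k \<noteq> \<one>"
proof
  assume h: "(V ^^ k) (single0 g) k = \<one>"
  have Vo: "(V ^^ k) wone = wone" by (induction k) simp_all
  have s: "agree_from (Suc 0) (single0 g) wone" by (simp add: agree_from_def single0_def)
  from V_funpow_from[OF s, of k] have "agree_from (Suc k) ((V ^^ k) (single0 g)) wone" by (simp add: Vo)
  moreover have "(V ^^ k) (single0 g) k = wone k" using h by (simp add: wone_def)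
  ultimately have "agree_from k ((V ^^ k) (single0 g)) wone" by (rule agree_from_pred)
  then have c: "agree_from (0 + k) ((V ^^ k) (single0 g)) ((V ^^ k) wone)" by (simp add: Vo)
  have "agree_from 0 (single0 g) wone"
    by (rule agree_from_V_funpow[OF single0_closed[OF g(1)] wone_closed s c])
  then have "single0 g 0 = wone 0" by (simp only: agree_from_0)
  then show False using g by (simp add: single0_def wone_def)
qed

lemma V_funpow_single0_beyond:
  assumes "g \<in> carrier G" "l < k" shows "(V ^^ l) (single0 g) k = \<one>"
proof -
  have Vo: "(V ^^ l) wone = wone" by (induction l) simp_all
  have "agree_from (Suc 0) (single0 g) wone" by (simp add: agree_from_def single0_def)
  from V_funpow_from[OF this, of l] have "agree_from (Suc l) ((V ^^ l) (single0 g)) wone" by (simp add: Vo)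
  then show ?thesis using assms(2) by (simp add: agree_from_def wone_def)
qed

text \<open>After a shift, the coordinates of \<open>f\<close> are at nonpositive positions, and the lowest of them
  alone determines the last nontrivial letter of \<open>transl f\<close>.\<close>

lemma transl_eq_wone:
  assumes f: "f \<in> fin_funs" and v: "transl f = wone" shows "f = (\<lambda>_. \<one>)"
proof (rule ccontr)
  assume "f \<noteq> (\<lambda>_. \<one>)"
  then have ne: "fsupp f \<noteq> {}" by (auto simp: fsupp_def)
  define M where "M = Max (fsupp f)"
  define f' where "f' = shift (- M) f"
  have f': "f' \<in> fin_funs" using f by (simp add: f'_def)
  have v': "transl f' = wone" using Tz_transl[OF f, of "- M"] v by (simp add: f'_def)
  have S': "fsupp f' = (\<lambda>i. i - M) ` fsupp f" by (simp add: f'_def fsupp_shift)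
  have neg: "i \<le> 0" if "i \<in> fsupp f'" for i
    using that f Max_ge[of "fsupp f"] by (auto simp: S' M_def)
  have ne': "fsupp f' \<noteq> {}" using ne by (simp add: S')
  define m where "m = Min (fsupp f')"
  have m: "m \<in> fsupp f'" and m_le: "\<And>i. i \<in> fsupp f' \<Longrightarrow> m \<le> i"
    using ne' f' by (simp_all add: m_def)
  define k where "k = nat (- m)"
  have m0: "m \<le> 0" using neg m by blast
  have Tzneg: "Tz i a = (V ^^ nat (- i)) a" if "i \<le> 0" for i a
    using that by (cases "i = 0") (simp_all add: Tz_def)
  have "transl f' k = finprod G (\<lambda>i. Tz i (single0 (f' i)) k) {m}"
    unfolding transl_def
  proof (rule finprod_mono_neutral_cong_right)
    fix i assume i: "i \<in> fsupp f' - {m}"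
    then have "m < i" "i \<le> 0" using m_le neg by force+
    then have "nat (- i) < k" by (simp add: k_def)
    then show "Tz i (single0 (f' i)) k = \<one>"
      unfolding Tzneg[OF \<open>i \<le> 0\<close>] using f' by (intro V_funpow_single0_beyond) simp_all
  qed (use f' m coord_closed[OF f'] in auto)
  also have "\<dots> = Tz m (single0 (f' m)) k" using coord_closed[OF f'] by simp
  also have "\<dots> = (V ^^ k) (single0 (f' m)) k" using Tzneg[OF m0] by (simp add: k_def)
  finally have "(V ^^ k) (single0 (f' m)) k = \<one>" using v' by (simp add: wone_def)
  moreover have "f' m \<noteq> \<one>" using m by (simp add: fsupp_def)
  ultimately show False using V_funpow_single0[of "f' m" k] f' by simp
qed

text \<open>T has infinite order: a word whose only nontrivial letter is the first, if fixed by T^a,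
  is also fixed by V^|a|, which however puts a nontrivial letter at position |a|.\<close>

lemma Tz_eq_id:
  assumes "\<And>x. x \<in> iwords \<Longrightarrow> Tz a x = x" shows "a = 0"
proof (rule ccontr)
  assume a: "a \<noteq> 0"
  obtain z where z: "z \<in> carrier G" "z \<noteq> \<one>" using nontrivial one_closed by blast
  have p: "Tz a (single0 z) = single0 z" using assms z by simp
  then have "Tz (- a) (single0 z) = single0 z" using Tz_add[of "single0 z" "- a" a] z by simp
  with p have "(V ^^ nat \<bar>a\<bar>) (single0 z) = single0 z"
    using a by (cases "0 \<le> a") (auto simp: Tz_def split: if_splits)
  then have "(V ^^ nat \<bar>a\<bar>) (single0 z) (nat \<bar>a\<bar>) = \<one>" using a by (simp add: single0_def wone_def)
  then show False using V_funpow_single0[OF z] by blast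
qed

section \<open>Words in the generators as elements of the wreath product\<close>

definition acts_as :: "(bool \<times> 'a) list \<Rightarrow> (int \<Rightarrow> 'a) \<Rightarrow> int \<Rightarrow> bool" where
  "acts_as W f a \<longleftrightarrow> (\<forall>x\<in>iwords. act W x = wmul (Tz a x) (transl f))"

text \<open>Composing two affine maps pushes the inner translation through the outer linear part,
  which shifts its coordinates; the result is the multiplication of the wreath product.\<close>

lemma acts_as_append:
  assumes "acts_as W f a" "acts_as W' f' b" "f \<in> fin_funs" "f' \<in> fin_funs"
  shows "acts_as (W' @ W) (fmul f (shift a f')) (a + b)"
  unfolding acts_as_def
proof
  fix x assume x: "x \<in> iwords"
  have "act (W' @ W) x = act W (wmul (Tz b x) (transl f'))"
    using assms(2) x by (simp add: acts_as_def)
  also have "\<dots> = wmul (Tz a (wmul (Tz b x) (transl f'))) (transl f)"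
    using assms x by (simp add: acts_as_def)
  also have "\<dots> = wmul (wmul (Tz (a + b) x) (transl (shift a f'))) (transl f)"
    using assms x by (simp add: Tz_wmul Tz_add Tz_transl)
  also have "\<dots> = wmul (Tz (a + b) x) (wmul (transl f) (transl (shift a f')))"
    using assms x wmul_comm[of "transl f" "transl (shift a f')"] by (simp add: wmul_assoc)
  finally show "act (W' @ W) x = wmul (Tz (a + b) x) (transl (fmul f (shift a f')))"
    using assms by (simp add: transl_fmul)
qed

definition fone :: "int \<Rightarrow> 'a" where
  "fone = (\<lambda>_. \<one>)"

definition fsingle :: "int \<Rightarrow> 'a \<Rightarrow> int \<Rightarrow> 'a" where
  "fsingle i g = fone(i := g)"

lemma fone_closed [simp]: "fone \<in> fin_funs"
  by (rule fin_funsI) (simp_all add: fone_def fsupp_def)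

lemma fsingle_closed [simp]: "g \<in> carrier G \<Longrightarrow> fsingle i g \<in> fin_funs"
proof (rule fin_funsI)
  have "fsupp (fsingle i g) \<subseteq> {i}" by (auto simp: fsupp_def fsingle_def fone_def)
  then show "finite (fsupp (fsingle i g))" by (rule finite_subset) simp
qed (simp add: fsingle_def fone_def)

lemma transl_fone [simp]: "transl fone = wone"
  by (simp add: transl_def fsupp_def fone_def wone_def)

lemma transl_fsingle: "g \<in> carrier G \<Longrightarrow> transl (fsingle i g) = Tz i (single0 g)"
proof
  fix j assume g: "g \<in> carrier G"
  have "fsupp (fsingle i g) \<subseteq> {i}" by (auto simp: fsupp_def fsingle_def fone_def)
  then have "transl (fsingle i g) j = finprod G (\<lambda>k. Tz k (single0 (fsingle i g k)) j) {i}"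
    using transl_superset[OF fsingle_closed[OF g], of "{i}" i] by simp
  also have "\<dots> = Tz i (single0 (fsingle i g i)) j"
    using coord_closed[OF fsingle_closed[OF g], of i i] by simp
  finally show "transl (fsingle i g) j = Tz i (single0 g) j" by (simp add: fsingle_def)
qed

lemma fmul_fone [simp]: "f \<in> fin_funs \<Longrightarrow> fmul f fone = f" "f \<in> fin_funs \<Longrightarrow> fmul fone f = f"
  by (simp_all add: fmul_def fone_def)

lemma shift_fone [simp]: "shift a fone = fone"
  by (simp add: shift_def fone_def)

lemma acts_as_Nil: "acts_as [] fone 0"
  by (simp add: acts_as_def)

text \<open>The generator translates by T (single0 g), hence sits at coordinate 1; its inverse
  translates by single0 (inv g), at coordinate 0.\<close>

lemma acts_as_letter:
  assumes g: "g \<in> carrier G"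
  shows "acts_as [(True, g)] (fsingle 1 g) 1" and "acts_as [(False, g)] (fsingle 0 (inv g)) (- 1)"
proof -
  have T1: "Tz 1 x = T x" if "x \<in> iwords" for x using T_Tz[OF that, of 0] by simp
  have V1: "Tz (- 1) x = V x" if "x \<in> iwords" for x using V_Tz[OF that, of 0] by simp
  have tr1: "transl (fsingle 1 g) = T (single0 g)" "transl (fsingle 0 (inv g)) = single0 (inv g)"
    using g transl_fsingle[of g 1] transl_fsingle[of "inv g" 0] T1[of "single0 g"] by simp_all
  show "acts_as [(True, g)] (fsingle 1 g) 1"
    unfolding acts_as_def
  proof
    fix x assume x: "x \<in> iwords"
    have "act [(True, g)] x = cay g x" by (simp add: act1_def)
    also have "\<dots> = wmul (T x) (\<lambda>_. g)" by (rule cay_wmul[OF g x])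
    also have "\<dots> = wmul (Tz 1 x) (transl (fsingle 1 g))"
      by (simp only: tr1 T1[OF x] T_single0[OF g])
    finally show "act [(True, g)] x = wmul (Tz 1 x) (transl (fsingle 1 g))" .
  qed
  show "acts_as [(False, g)] (fsingle 0 (inv g)) (- 1)"
    unfolding acts_as_def
  proof
    fix x assume x: "x \<in> iwords"
    have "act [(False, g)] x = icay g x" by (simp add: act1_def)
    also have "\<dots> = wmul (V x) (single0 (inv g))" by (rule icay_wmul[OF g x])
    also have "\<dots> = wmul (Tz (- 1) x) (transl (fsingle 0 (inv g)))"
      by (simp only: tr1 V1[OF x])
    finally show "act [(False, g)] x = wmul (Tz (- 1) x) (transl (fsingle 0 (inv g)))" .
  qed
qed

lemma word_acts_as:
  "set W \<subseteq> letters \<Longrightarrow> \<exists>f a. f \<in> fin_funs \<and> acts_as W f a"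
proof (induction W)
  case Nil
  show ?case using acts_as_Nil fone_closed by (intro exI conjI)
next
  case (Cons s W)
  then obtain f a where fa: "f \<in> fin_funs" "acts_as W f a" by auto
  obtain b g where s: "s = (b, g)" "g \<in> carrier G" using Cons.prems by auto
  obtain f' a' where fa': "f' \<in> fin_funs" "acts_as [s] f' a'"
  proof (cases b)
    case True
    show ?thesis by (rule that[of "fsingle 1 g" 1]) (simp_all only: s True fsingle_closed acts_as_letter)
  next
    case False
    show ?thesis by (rule that[of "fsingle 0 (inv g)" "- 1"])
      (simp_all only: s False fsingle_closed acts_as_letter inv_closed)
  qed
  have "acts_as ([s] @ W) (fmul f (shift a f')) (a + a')" by (rule acts_as_append[OF fa(2) fa'(2) fa(1) fa'(1)])
  moreover have "fmul f (shift a f') \<in> fin_funs" by (intro fmul_closed shift_closed fa(1) fa'(1))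
  ultimately show ?case by (intro exI[of _ "fmul f (shift a f')"] exI[of _ "a + a'"]) simp
qed

lemma acts_as_power: "\<exists>W. set W \<subseteq> letters \<and> acts_as W fone a"
proof (induction a rule: int_induct[of _ 0])
  case base
  then show ?case using acts_as_Nil by (intro exI[of _ "[]"]) simp
next
  case (step1 i)
  then obtain W where W: "set W \<subseteq> letters" "acts_as W fone i" by auto
  have "acts_as (W @ [(True, \<one>)]) (fmul (fsingle 1 \<one>) (shift 1 fone)) (1 + i)"
    by (rule acts_as_append[OF acts_as_letter(1)[OF one_closed] W(2)]) simp_all
  moreover have "fsingle 1 \<one> = fone" by (simp add: fsingle_def fone_def fun_eq_iff)
  ultimately show ?case using W(1) by (intro exI[of _ "W @ [(True, \<one>)]"]) (simp add: add.commute)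
next
  case (step2 i)
  then obtain W where W: "set W \<subseteq> letters" "acts_as W fone i" by auto
  have "acts_as (W @ [(False, \<one>)]) (fmul (fsingle 0 (inv \<one>)) (shift (- 1) fone)) (- 1 + i)"
    by (rule acts_as_append[OF acts_as_letter(2)[OF one_closed] W(2)]) simp_all
  moreover have "fsingle 0 (inv \<one>) = fone" by (simp add: fsingle_def fone_def fun_eq_iff)
  ultimately show ?case using W(1) by (intro exI[of _ "W @ [(False, \<one>)]"]) simp
qed

text \<open>The map is T^(i - 1) C T^(-i) with C the generator of g: the linear parts cancel, and
  the coordinate 1 of the generator is shifted to i.\<close>

lemma acts_as_single:
  assumes g: "g \<in> carrier G" shows "\<exists>W. set W \<subseteq> letters \<and> acts_as W (fsingle i g) 0"
proof -
  obtain u where u: "set u \<subseteq> letters" "acts_as u fone (i - 1)" using acts_as_power by blast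
  obtain v where v: "set v \<subseteq> letters" "acts_as v fone (- i)" using acts_as_power by blast
  have "acts_as (v @ [(True, g)]) (fmul (fsingle 1 g) (shift 1 fone)) (1 + - i)"
    by (rule acts_as_append[OF acts_as_letter(1)[OF g] v(2)]) (simp_all add: g)
  then have 1: "acts_as (v @ [(True, g)]) (fsingle 1 g) (1 - i)" using g by simp
  have "acts_as ((v @ [(True, g)]) @ u) (fmul fone (shift (i - 1) (fsingle 1 g))) (i - 1 + (1 - i))"
    by (rule acts_as_append[OF u(2) 1]) (simp_all add: g)
  moreover have "shift (i - 1) (fsingle 1 g) = fsingle i g"
    by (auto simp: shift_def fsingle_def fone_def fun_eq_iff)
  ultimately have "acts_as ((v @ [(True, g)]) @ u) (fsingle i g) 0" using g by simp
  then show ?thesis using u v g by (intro exI[of _ "(v @ [(True, g)]) @ u"]) simp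
qed

lemma fin_fun_acts_as:
  "finite A \<Longrightarrow> f \<in> fin_funs \<Longrightarrow> fsupp f \<subseteq> A \<Longrightarrow> \<exists>W. set W \<subseteq> letters \<and> acts_as W f 0"
proof (induction A arbitrary: f rule: finite_induct)
  case empty
  then have "f = fone" by (auto simp: fsupp_def fone_def)
  then show ?case using acts_as_Nil by (intro exI[of _ "[]"]) simp
next
  case (insert i A)
  let ?f = "f(i := \<one>)"
  have fi: "f i \<in> carrier G" using insert.prems by simp
  have sub: "fsupp ?f \<subseteq> A" using insert.prems(2) by (auto simp: fsupp_def)
  have f: "?f \<in> fin_funs"
  proof (rule fin_funsI)
    show "finite (fsupp ?f)" using sub insert.hyps(1) by (rule finite_subset)
  qed (use insert.prems in simp)
  obtain u where u: "set u \<subseteq> letters" "acts_as u ?f 0" using insert.IH[OF f sub] by blast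
  obtain v where v: "set v \<subseteq> letters" "acts_as v (fsingle i (f i)) 0" using acts_as_single[OF fi] by blast
  have "acts_as (v @ u) (fmul ?f (shift 0 (fsingle i (f i)))) (0 + 0)"
    by (rule acts_as_append[OF u(2) v(2) f fsingle_closed[OF fi]])
  moreover have "fmul ?f (shift 0 (fsingle i (f i))) = f"
    using insert.prems by (auto simp: fmul_def shift_def fsingle_def fone_def fun_eq_iff)
  ultimately show ?case using u v by (intro exI[of _ "v @ u"]) simp
qed

lemma element_acts_as:
  assumes "f \<in> fin_funs" obtains W where "set W \<subseteq> letters" "acts_as W f a"
proof -
  obtain u where u: "set u \<subseteq> letters" "acts_as u f 0"
    using fin_fun_acts_as[OF fin_funs_finite[OF assms] assms order_refl] by blast
  obtain v where v: "set v \<subseteq> letters" "acts_as v fone a" using acts_as_power by blast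
  have "acts_as (v @ u) (fmul f (shift 0 fone)) (0 + a)"
    by (rule acts_as_append[OF u(2) v(2) assms fone_closed])
  then show ?thesis using that[of "v @ u"] u v assms by simp
qed

definition realize :: "(int \<Rightarrow> 'a) \<times> int \<Rightarrow> (nat \<Rightarrow> 'a) \<Rightarrow> nat \<Rightarrow> 'a" where
  "realize = (\<lambda>(f, a). restrict (\<lambda>x. wmul (Tz a x) (transl f)) iwords)"

lemma acts_as_realize: "acts_as W f a \<Longrightarrow> el W = realize (f, a)"
  unfolding acts_as_def el_def realize_def by (auto simp: fun_eq_iff restrict_def)

abbreviation "WG \<equiv> wreath_int G"

lemma carrier_WG: "carrier WG = fin_funs \<times> UNIV"
proof -
  have "carrier (sum_group (UNIV :: int set) (\<lambda>_. G)) = fin_funs"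
    using carrier_sum_group[of "UNIV :: int set" "\<lambda>_. G"] is_group
    unfolding fin_funs_def fsupp_def by (auto simp: PiE_iff)
  then show ?thesis by (simp add: wreath_int_def)
qed

lemma mult_WG: "(f, a) \<otimes>\<^bsub>WG\<^esub> (h, b) = (fmul f (shift a h), a + b)"
  by (simp add: wreath_int_def fmul_def shift_def restrict_def)

lemma one_WG: "\<one>\<^bsub>WG\<^esub> = (fone, 0)"
  by (simp add: wreath_int_def fone_def restrict_def)

lemma realize_mult:
  assumes "p \<in> carrier WG" "q \<in> carrier WG"
  shows "realize (p \<otimes>\<^bsub>WG\<^esub> q) = realize p \<otimes>\<^bsub>\<Gamma>\<^esub> realize q"
proof -
  obtain f a h b where pq: "p = (f, a)" "q = (h, b)" "f \<in> fin_funs" "h \<in> fin_funs"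
    using assms unfolding carrier_WG by auto
  obtain u where u: "set u \<subseteq> letters" "acts_as u f a" using element_acts_as[OF pq(3)] .
  obtain v where v: "set v \<subseteq> letters" "acts_as v h b" using element_acts_as[OF pq(4)] .
  have "realize p \<otimes>\<^bsub>\<Gamma>\<^esub> realize q = el (v @ u)"
    using u v acts_as_realize[OF u(2)] acts_as_realize[OF v(2)] el_mult[OF u(1) v(1)] pq by simp
  also have "\<dots> = realize (fmul f (shift a h), a + b)"
    by (rule acts_as_realize[OF acts_as_append[OF u(2) v(2) pq(3,4)]])
  finally show ?thesis by (simp add: pq mult_WG)
qed

lemma realize_image: "realize ` carrier WG = carrier \<Gamma>"
proof (intro equalityI subsetI)
  fix x assume "x \<in> realize ` carrier WG"
  then obtain f a where x: "f \<in> fin_funs" "x = realize (f, a)" unfolding carrier_WG by auto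
  obtain W where "set W \<subseteq> letters" "acts_as W f a" using element_acts_as[OF x(1)] .
  then show "x \<in> carrier \<Gamma>" using x acts_as_realize by (metis el_in_\<Gamma>)
next
  fix x assume "x \<in> carrier \<Gamma>"
  then obtain W where W: "set W \<subseteq> letters" "x = el W" by (auto simp: carrier_\<Gamma>)
  obtain f a where "f \<in> fin_funs" "acts_as W f a" using word_acts_as[OF W(1)] by blast
  then show "x \<in> realize ` carrier WG"
    using W acts_as_realize by (intro image_eqI[of _ _ "(f, a)"]) (simp_all add: carrier_WG)
qed

text \<open>The trivial word detects the translation part; cancelling it leaves equal powers of T,
  which has infinite order. Equality of the coordinates then follows from
  \<open>transl_eq_wone\<close> for their quotient.\<close>

lemma realize_inj: "inj_on realize (carrier WG)"
proof (rule inj_onI)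
  fix p q assume p: "p \<in> carrier WG" and q: "q \<in> carrier WG" and eq: "realize p = realize q"
  obtain f a h b where pq: "p = (f, a)" "q = (h, b)" "f \<in> fin_funs" "h \<in> fin_funs"
    using p q unfolding carrier_WG by auto
  have e: "wmul (Tz a x) (transl f) = wmul (Tz b x) (transl h)" if "x \<in> iwords" for x
    using fun_cong[OF eq, of x] that by (simp add: realize_def pq)
  have fh: "transl f = transl h" using e[OF wone_closed] pq by simp
  have Tab: "Tz a x = Tz b x" if x: "x \<in> iwords" for x
  proof
    fix i
    have "Tz a x i \<otimes> transl f i = Tz b x i \<otimes> transl f i"
      using fun_cong[OF e[OF x], of i] by (simp add: fh wmul_def)
    then show "Tz a x i = Tz b x i"
      using iwordsD[OF Tz_closed[OF x]] iwordsD[OF transl_closed[OF pq(3)]] by simp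
  qed
  have "Tz (a - b) x = x" if x: "x \<in> iwords" for x
    using Tab[OF Tz_closed[OF x, of "- b"]] x by (simp add: Tz_add)
  then have "a - b = 0" by (rule Tz_eq_id)
  moreover have "f = h"
  proof -
    define k where "k = (\<lambda>i. inv (h i))"
    have k: "k \<in> fin_funs"
    proof (rule fin_funsI)
      have "fsupp k \<subseteq> fsupp h" unfolding fsupp_def k_def by auto
      then show "finite (fsupp k)" by (rule finite_subset) (use pq in simp)
    qed (use pq in \<open>simp add: k_def\<close>)
    have hk: "fmul h k = fone" using pq by (simp add: fmul_def k_def fone_def)
    have "transl (fmul f k) = transl (fmul h k)" using pq k fh by (simp add: transl_fmul)
    then have "transl (fmul f k) = wone" by (simp add: hk)
    then have "fmul f k = (\<lambda>_. \<one>)" by (rule transl_eq_wone[OF fmul_closed[OF pq(3) k]])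
    then have "f i \<otimes> inv (h i) = \<one>" for i unfolding fmul_def k_def by (rule fun_cong)
    then show ?thesis using pq by (metis ext fin_funsD inv_inv inv_equality inv_closed)
  qed
  ultimately show "p = q" using pq by simp
qed

lemma group_WG: "group WG"
proof (rule group_transport[OF group_\<Gamma> realize_inj realize_image _ realize_mult])
  show "x \<otimes>\<^bsub>WG\<^esub> y \<in> carrier WG" if "x \<in> carrier WG" "y \<in> carrier WG" for x y
    using that by (auto simp: carrier_WG mult_WG)
  show "\<one>\<^bsub>WG\<^esub> \<in> carrier WG" by (simp add: carrier_WG one_WG)
  show "realize \<one>\<^bsub>WG\<^esub> = \<one>\<^bsub>\<Gamma>\<^esub>" using acts_as_realize[OF acts_as_Nil] by (simp add: one_WG one_\<Gamma>)
qed

theorem \<Gamma>_iso_wreath: "\<Gamma> \<cong> WG"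
proof -
  have "realize \<in> iso WG \<Gamma>"
    unfolding iso_iff using realize_inj realize_image realize_mult by (auto simp: hom_def)
  then show ?thesis using group.iso_sym[OF group_WG] is_isoI by blast
qed

text \<open>The quotient of two fixed words is fixed by the linear part \<open>Tz a\<close>, so \<open>periodic_agree\<close> applies with \<open>w = 0\<close>.\<close>

lemma fixed_small:
  assumes W: "f \<in> fin_funs" "acts_as W f a" "set W \<subseteq> letters" and a: "a \<noteq> 0" and k: "0 < k"
  shows "card (fixed k W) \<le> n ^ nat \<bar>a\<bar>"
proof (cases "fixed k W = {}")
  case False
  then obtain y where y: "y \<in> fixed k W" by blast
  define H where "H = nat \<bar>a\<bar>"
  have H: "H \<ge> 1" using a by (simp add: H_def)
  define c where "c x = wmul (pad k x) (winv (pad k y))" for x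
  have pw: "x \<in> pwords k" if "x \<in> fixed k W" for x using that unfolding fixed_def by blast
  have c: "c x \<in> iwords" if "x \<in> fixed k W" for x
    unfolding c_def by (intro wmul_closed winv_closed pad_closed pw that y)
  have fx: "wmul (Tz a (pad k x)) (transl f) i = pad k x i" if "x \<in> fixed k W" "i < k" for x i
  proof -
    have "agree_below k (act W (pad k x)) (pad k x)"
      using that(1) lev_fixed_iff[OF pw[OF that(1)]] unfolding fixed_def by blast
    then show ?thesis using W(2) pad_closed[OF pw[OF that(1)]] that(2)
      unfolding acts_as_def agree_below_def by auto
  qed
  have ca: "agree_below k (Tz a (c x)) (c x)" if x: "x \<in> fixed k W" for x
    unfolding agree_below_def
  proof (intro allI impI)
    fix i assume i: "i < k"
    have px: "pad k x \<in> iwords" "pad k y \<in> iwords" using pad_closed pw x y by auto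
    have in_G: "Tz a (pad k x) i \<in> carrier G" "Tz a (pad k y) i \<in> carrier G" "transl f i \<in> carrier G"
      using iwordsD[OF Tz_closed[OF px(1)]] iwordsD[OF Tz_closed[OF px(2)]] iwordsD[OF transl_closed[OF W(1)]] by auto
    have "Tz a (c x) i = Tz a (pad k x) i \<otimes> inv (Tz a (pad k y) i)"
      unfolding c_def using px by (simp add: Tz_wmul Tz_winv) (simp add: wmul_def winv_def)
    also have "\<dots> = (Tz a (pad k x) i \<otimes> transl f i) \<otimes> inv (Tz a (pad k y) i \<otimes> transl f i)"
      using in_G by (simp add: inv_mult_group m_assoc[symmetric]) (simp add: m_assoc)
    also have "\<dots> = pad k x i \<otimes> inv (pad k y i)"
      using fx[OF x i] fx[OF y i] by (simp add: wmul_def)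
    finally show "Tz a (c x) i = c x i" by (simp add: c_def wmul_def winv_def)
  qed
  have per: "agree_below k ((T ^^ H) (c x)) (c x)" if x: "x \<in> fixed k W" for x
  proof (cases "0 \<le> a")
    case True
    then show ?thesis using ca[OF x] by (simp add: Tz_def H_def)
  next
    case False
    then have "agree_below k ((V ^^ H) (c x)) (c x)" using ca[OF x] by (simp add: Tz_def H_def)
    then have "agree_below k ((T ^^ H) ((V ^^ H) (c x))) ((T ^^ H) (c x))" by (rule T_funpow_below)
    then show ?thesis using c[OF x] by (simp add: agree_below_sym)
  qed
  let ?code = "\<lambda>x. restrict (\<lambda>i. (T ^^ i) (c x) (k - 1)) {..<H}"
  have "inj_on ?code (fixed k W)"
  proof (rule inj_onI)
    fix x x' assume x: "x \<in> fixed k W" "x' \<in> fixed k W" and eq: "?code x = ?code x'"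
    have cc: "agree_below k (c x) (c x')"
    proof (rule periodic_agree[where w = 0, OF c[OF x(1)] c[OF x(2)] H])
      show "(T ^^ H) (c x) j = c x j" if "j < k" for j
        using per[OF x(1)] that by (simp add: agree_below_def)
      show "(T ^^ H) (c x') j = c x' j" if "j < k" for j
        using per[OF x(2)] that by (simp add: agree_below_def)
      show "agree_below 0 (c x) (c x')" by (simp add: agree_below_def)
      show "(T ^^ i) (c x) (k - 1) = (T ^^ i) (c x') (k - 1)" if "i < H" for i
        using fun_cong[OF eq, of i] that by simp
    qed
    have "agree_below k x x'"
      unfolding agree_below_def
    proof (intro allI impI)
      fix i assume i: "i < k"
      have in_G: "pad k x i \<in> carrier G" "pad k x' i \<in> carrier G" "pad k y i \<in> carrier G"
        using iwordsD[OF pad_closed[OF pw[OF x(1)]]] iwordsD[OF pad_closed[OF pw[OF x(2)]]] iwordsD[OF pad_closed[OF pw[OF y]]]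
        by auto
      have "pad k x i \<otimes> inv (pad k y i) = pad k x' i \<otimes> inv (pad k y i)"
        using cc i by (simp add: agree_below_def c_def wmul_def winv_def)
      then have "pad k x i = pad k x' i" using in_G by simp
      then show "x i = x' i" using i by (simp add: pad_def)
    qed
    then show "x = x'" by (rule pwords_eqI[OF pw[OF x(1)] pw[OF x(2)]])
  qed
  then have "card (fixed k W) \<le> card (pwords H)"
  proof (rule card_inj_on_le)
    show "?code ` fixed k W \<subseteq> pwords H"
      by (intro image_subsetI restrict_PiE_iff[THEN iffD2] ballI iwordsD funpow_closed c)
  qed simp
  then show ?thesis by (simp only: card_pwords H_def)
qed simp

text \<open>The normalized characters of the levels converge to the canonical trace of the group. An
  element with linear part T^a, where a is not 0, fixes a number of words bounded independently of k
  > 0, and a translation with a nontrivial letter at i fixes none once k > i.\<close>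

lemma fix_ratio_limit:
  assumes W: "set W \<subseteq> letters"
  shows "(\<lambda>k. fix_ratio k W) \<longlonglongrightarrow> of_bool (el W = el [])"
proof (cases "el W = el []")
  case True
  have "fix_ratio k W = 1" for k
  proof -
    have "act W (pad k x) = pad k x" if "x \<in> pwords k" for x
      using fun_cong[OF True, of "pad k x"] pad_closed[OF that] by simp
    then have "lev k W x = lev k [] x" if "x \<in> pwords k" for x using that by (simp add: lev_def)
    then have "fixed k W = fixed k []" unfolding fixed_def by auto
    then show ?thesis using fix_ratio_Nil[of k] by (simp add: fix_ratio_def)
  qed
  then show ?thesis using True by simp
next
  case False
  obtain f a where fa: "f \<in> fin_funs" "acts_as W f a" using word_acts_as[OF W] by blast
  have "(\<lambda>k. fix_ratio k W) \<longlonglongrightarrow> 0"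
  proof (cases "a = 0")
    case True
    have "transl f \<noteq> wone"
    proof
      assume "transl f = wone"
      then have "act W x = act [] x" if "x \<in> iwords" for x
        using fa(2) that True by (simp add: acts_as_def)
      then show False using False el_eqI by blast
    qed
    then obtain i where i: "transl f i \<noteq> \<one>" by (auto simp: wone_def fun_eq_iff)
    have "\<forall>\<^sub>F k in sequentially. fix_ratio k W = 0"
      using eventually_ge_at_top[of "Suc i"]
    proof eventually_elim
      case (elim k)
      have "fixed k W = {}"
      proof (rule equals0I)
        fix x assume x: "x \<in> fixed k W"
        then have px: "x \<in> pwords k" unfolding fixed_def by blast
        have "act W (pad k x) i = pad k x i"
          using x lev_fixed_iff[OF px] elim unfolding fixed_def agree_below_def by auto
        then have "pad k x i \<otimes> transl f i = pad k x i"
          using fa(2) pad_closed[OF px] True by (simp add: acts_as_def wmul_def)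
        then show False
          using i iwordsD[OF pad_closed[OF px], of i] iwordsD[OF transl_closed[OF fa(1)], of i] by simp
      qed
      then show ?case by (simp add: fix_ratio_def)
    qed
    then show ?thesis by (rule tendsto_eventually)
  next
    case a: False
    have lim: "(\<lambda>k. real n ^ nat \<bar>a\<bar> * (1 / real n) ^ k) \<longlonglongrightarrow> 0"
      using n_ge2 by (intro tendsto_mult_right_zero LIMSEQ_power_zero) simp
    have "\<forall>\<^sub>F k in sequentially. norm (fix_ratio k W) \<le> real n ^ nat \<bar>a\<bar> * (1 / real n) ^ k"
      using eventually_ge_at_top[of "Suc 0"]
    proof eventually_elim
      case (elim k)
      then have "card (fixed k W) \<le> n ^ nat \<bar>a\<bar>" by (intro fixed_small[OF fa W a]) simp
      then have "real (card (fixed k W)) \<le> real n ^ nat \<bar>a\<bar>" by (metis of_nat_le_iff of_nat_power)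
      from divide_right_mono[OF this, of "real n ^ k"] show ?case
        by (simp add: fix_ratio_def norm_divide norm_power power_one_over)
    qed
    then show ?thesis by (rule Lim_null_comparison[OF _ lim])
  qed
  then show ?thesis using False by simp
qed

text \<open>The moments of the group are not computed anew: they are limits of the same averages
  over the levels, so both zeta functions share the coefficients \<open>lim_coeff\<close>.\<close>

lemma wsum_identity_words: "L.wsum (\<lambda>W. of_bool (el W = el [])) j = of_real (lim_moment j)"
proof -
  have "(\<lambda>k. L.wsum (fix_ratio k) j) \<longlonglongrightarrow> L.wsum (\<lambda>W. of_bool (el W = el [])) j"
    unfolding L.wsum_def by (intro tendsto_sum fix_ratio_limit) (simp add: L.words_def)
  then show ?thesis using wsum_fix_ratio_limit LIMSEQ_unique by blast
qed

text \<open>Only the returns of words to the identity enter, and these are preserved by every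
  isomorphism; hence the choice of \<phi> does not matter.\<close>

theorem has_group_zeta_wreath:
  assumes \<phi>: "\<phi> \<in> iso \<Gamma> WG" and t: "norm t * (2 * real n - 1) < 1"
  shows "has_group_zeta WG (\<phi> ` SS) t
    (exp (- (of_nat n - 1) * Ln (1 - t\<^sup>2) + (\<Sum>m. lim_coeff m * (t ^ m / of_nat m))))"
proof -
  interpret WG: group WG by (rule group_WG)
  interpret \<Gamma>: group \<Gamma> by (rule group_\<Gamma>)
  have hom: "\<phi> \<in> hom \<Gamma> WG" and inj: "inj_on \<phi> (carrier \<Gamma>)" using \<phi> by (auto simp: iso_iff)
  interpret H: group_hom \<Gamma> WG \<phi> by unfold_locales (rule hom)
  have el1: "el [s] \<in> carrier \<Gamma>" if "s \<in> letters" for s using that by simp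
  interpret M: marked_group letters flip "2 * n" WG "\<lambda>s. \<phi> (el [s])"
  proof unfold_locales
    show "\<phi> (el [s]) \<in> carrier WG" if "s \<in> letters" for s using el1[OF that] by (rule H.hom_closed)
    show "\<phi> (el [flip s]) = inv\<^bsub>WG\<^esub> \<phi> (el [s])" if "s \<in> letters" for s
    proof -
      have "inv\<^bsub>\<Gamma>\<^esub> (el [s]) = el [flip s]" using inv_\<Gamma>[of "[s]"] that by (simp add: rev_word_def)
      then show ?thesis using H.hom_inv[OF el1[OF that]] by simp
    qed
    show "inj_on (\<lambda>s. \<phi> (el [s])) letters"
      using comp_inj_on[OF inj_on_el_letter inj_on_subset[OF inj]] el1 by (simp add: comp_def image_subset_iff)
    show "2 \<le> 2 * n" using n_ge2 by simp
  qed
  have wact: "M.wact W (\<phi> (el u)) = \<phi> (el (u @ W))" if "set u \<subseteq> letters" "set W \<subseteq> letters" for u W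
    using that
  proof (induction W arbitrary: u)
    case (Cons s W)
    have "\<phi> (el [s]) \<otimes>\<^bsub>WG\<^esub> \<phi> (el u) = \<phi> (el [s] \<otimes>\<^bsub>\<Gamma>\<^esub> el u)"
      using Cons.prems by (intro H.hom_mult[symmetric] el_in_\<Gamma>) simp_all
    also have "el [s] \<otimes>\<^bsub>\<Gamma>\<^esub> el u = el (u @ [s])" using Cons.prems el_mult[of "[s]" u] by simp
    finally show ?case using Cons.IH[of "u @ [s]"] Cons.prems by simp
  qed simp
  have one: "\<phi> (el []) = \<one>\<^bsub>WG\<^esub>" using H.hom_one by (simp add: one_\<Gamma>)
  have iff: "M.wact W \<one>\<^bsub>WG\<^esub> = \<one>\<^bsub>WG\<^esub> \<longleftrightarrow> el W = el []" if "set W \<subseteq> letters" for W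
  proof -
    have "M.wact W (\<phi> (el [])) = \<phi> (el ([] @ W))" by (rule wact) (simp_all add: that)
    then have "M.wact W \<one>\<^bsub>WG\<^esub> = \<phi> (el W)" by (simp only: one append_Nil)
    moreover have "\<phi> (el W) = \<phi> (el []) \<longleftrightarrow> el W = el []"
      by (rule inj_on_eq_iff[OF inj el_in_\<Gamma>[OF that] el_in_\<Gamma>]) simp
    ultimately show ?thesis by (simp only: one)
  qed
  have "L.wsum (\<lambda>W. of_bool (M.wact W \<one>\<^bsub>WG\<^esub> = \<one>\<^bsub>WG\<^esub>)) j = of_real (lim_moment j)" for j
  proof -
    have "L.wsum (\<lambda>W. of_bool (M.wact W \<one>\<^bsub>WG\<^esub> = \<one>\<^bsub>WG\<^esub>)) j = L.wsum (\<lambda>W. of_bool (el W = el [])) j"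
      unfolding L.wsum_def L.words_def by (rule sum.cong[OF refl]) (simp only: iff mem_Collect_eq)
    then show ?thesis by (simp only: wsum_identity_words)
  qed
  then have coeff: "L.walk_eval (\<lambda>W. of_bool (M.wact W \<one>\<^bsub>WG\<^esub> = \<one>\<^bsub>WG\<^esub>)) (ihara_poly (2 * n) m) = lim_coeff m" for m
    by (simp only: L.walk_eval_def lim_coeff_def)
  have "norm t * (real (2 * n) - 1) < 1" using t by simp
  from M.has_group_zeta_walks[OF this]
  have "has_group_zeta WG ((\<lambda>s. \<phi> (el [s])) ` letters) t
     (exp (- ((of_nat (2 * n) - 2) / 2) * Ln (1 - t\<^sup>2) + (\<Sum>m. lim_coeff m * (t ^ m / of_nat m))))"
    by (simp only: coeff)
  moreover have "(\<lambda>s. \<phi> (el [s])) ` letters = \<phi> ` SS" by (simp add: SS_eq image_image)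
  moreover have "- ((of_nat (2 * n) - 2) / 2) = (- (of_nat n - 1) :: complex)" by (simp add: field_simps)
  ultimately show ?thesis by (simp only:)
qed

end

text \<open>For the abelian part, which speaks of every value z of the Schreier zeta function; it
  comes down to the uniqueness of infinite sums and of limits.\<close>

lemma has_schreier_zeta_unique:
  assumes "has_schreier_zeta H A B Q t z" "has_schreier_zeta H A B Q t z'"
  shows "z = z'"
proof -
  obtain l L l' L' where l: "\<And>k. has_ln_ihara_zeta (schreier_graph H (Q k) A) (schreier_rev H) t (l k)"
      "(\<lambda>k. l k / of_nat (card (verts (schreier_graph H (Q k) A)))) \<longlonglongrightarrow> L" "z = exp L"
    and l': "\<And>k. has_ln_ihara_zeta (schreier_graph H (Q k) A) (schreier_rev H) t (l' k)"
      "(\<lambda>k. l' k / of_nat (card (verts (schreier_graph H (Q k) A)))) \<longlonglongrightarrow> L'" "z' = exp L'"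
    using assms unfolding has_schreier_zeta_def by blast
  have "l k = l' k" for k
    using l(1)[of k] l'(1)[of k] unfolding has_ln_ihara_zeta_def by (rule has_sum_unique)
  then have "l = l'" by (rule ext)
  then have "L = L'" using l(2) l'(2) by (simp only: LIMSEQ_unique)
  then show ?thesis using l(3) l'(3) by (simp only:)
qed

theorem corollary5p13:
  fixes G :: "('a, 'm) monoid_scheme" and n :: nat and t :: complex
    and w :: "nat \<Rightarrow> 'a"
    and \<Gamma> :: "((nat \<Rightarrow> 'a) \<Rightarrow> (nat \<Rightarrow> 'a)) monoid"
    and S P :: "((nat \<Rightarrow> 'a) \<Rightarrow> (nat \<Rightarrow> 'a)) set"
    and F :: "nat \<Rightarrow> complex"
  assumes "group G" and "finite (carrier G)" and "carrier G \<noteq> {\<one>\<^bsub>G\<^esub>}" and "n = Coset.order G"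
    and "\<Gamma> = automaton_group (cayley_machine G)"
    and "S = symmetric_generators (cayley_machine G)"
    and "w \<in> infinite_words (carrier G)" and "P = parabolic_subgroup \<Gamma> w"
    and "F = (\<lambda>q. \<Prod>p | 1 \<le> p \<and> p < q \<and> coprime p q.
               (1 - 2 * of_nat n * t * of_real (cos (real p / real q * pi)) + (2 * of_nat n - 1) * t\<^sup>2)
                 powr (- ((of_nat n - 1)\<^sup>2 / (of_nat n ^ q - 1))))"
    and "norm t < 1 / (2 * real n - 1)"
  shows "convergent_prod (\<lambda>j. F (j + 2)) \<and>
         has_schreier_zeta \<Gamma> S P (prefix_stabilizer \<Gamma> w) t
           ((1 - t\<^sup>2) powi (- (int n - 1)) * (\<Prod>j. F (j + 2))) \<and>
         (comm_group G \<longrightarrow>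
            \<Gamma> \<cong> wreath_int G \<and>
            (\<forall>\<phi>\<in>iso \<Gamma> (wreath_int G). \<forall>z.
               has_schreier_zeta \<Gamma> S P (prefix_stabilizer \<Gamma> w) t z \<longrightarrow>
               has_group_zeta (wreath_int G) (\<phi> ` S) t z))"
proof -
  interpret cayley_group G n
    using assms(1-4) by (intro cayley_group.intro cayley_group_axioms.intro)
  have \<Gamma>: "\<Gamma> = automaton_group (cayley_machine G)" and S: "S = SS" using assms(5,6) by simp_all
  have pos: "0 < 2 * real n - 1" using n_ge2 by simp
  then have t: "norm t * (2 * real n - 1) < 1" using assms(10) by (simp add: pos_less_divide_eq)
  define E where "E = - (of_nat n - 1) * Ln (1 - t\<^sup>2) + (\<Sum>m. lim_coeff m * (t ^ m / of_nat m))"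
  have conv: "convergent_prod (\<lambda>j. F (j + 2))"
    unfolding assms(9) by (rule zeta_product(1)[OF t])
  have prod: "(\<Prod>j. F (j + 2)) = exp (\<Sum>m. lim_coeff m * (t ^ m / of_nat m))"
    unfolding assms(9) by (rule zeta_product(2)[OF t])
  have "1 / (2 * real n - 1) \<le> 1" using n_ge2 by simp
  then have "norm t < 1" using assms(10) by linarith
  then have "norm (t\<^sup>2) < 1" by (simp add: norm_power power_less_one_iff)
  then have nz: "1 - t\<^sup>2 \<noteq> 0" by auto
  have "int n - 1 = int (n - 1)" and n1: "of_nat n - 1 = (of_nat (n - 1) :: complex)"
    using n_ge2 by (simp_all add: of_nat_diff)
  \<comment> \<open>The exponent is an integer, so the power agrees with the exponential of the
    multiple of any branch of the logarithm, in particular of \<open>Ln\<close>.\<close>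
  then have "(1 - t\<^sup>2) powi (- (int n - 1)) = inverse ((1 - t\<^sup>2) ^ (n - 1))"
    by (simp only: power_int_minus power_int_of_nat)
  also have "\<dots> = inverse (exp (of_nat (n - 1) * Ln (1 - t\<^sup>2)))"
    by (simp only: exp_of_nat_mult exp_Ln[OF nz])
  also have "\<dots> = exp (- (of_nat n - 1) * Ln (1 - t\<^sup>2))"
    by (simp only: n1 exp_minus mult_minus_left)
  finally have val: "(1 - t\<^sup>2) powi (- (int n - 1)) * (\<Prod>j. F (j + 2)) = exp E"
    by (simp only: prod E_def exp_add)
  have schreier: "has_schreier_zeta \<Gamma> S P (prefix_stabilizer \<Gamma> w) t (exp E)"
    unfolding \<Gamma> S assms(8) E_def by (rule has_schreier_zeta_parabolic[OF assms(7) t])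
  have abelian: "\<Gamma> \<cong> wreath_int G \<and> (\<forall>\<phi>\<in>iso \<Gamma> (wreath_int G). \<forall>z.
          has_schreier_zeta \<Gamma> S P (prefix_stabilizer \<Gamma> w) t z \<longrightarrow> has_group_zeta (wreath_int G) (\<phi> ` S) t z)"
    if "comm_group G"
  proof -
    interpret comm: comm_group G by (rule that)
    interpret comm_cayley_group G n by unfold_locales
    show ?thesis
    proof (intro conjI ballI allI impI)
      show "\<Gamma> \<cong> wreath_int G" unfolding \<Gamma> by (rule \<Gamma>_iso_wreath)
      fix \<phi> z assume \<phi>: "\<phi> \<in> iso \<Gamma> (wreath_int G)"
        and "has_schreier_zeta \<Gamma> S P (prefix_stabilizer \<Gamma> w) t z"
      then have "z = exp E" using schreier by (intro has_schreier_zeta_unique)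
      then show "has_group_zeta (wreath_int G) (\<phi> ` S) t z"
        using has_group_zeta_wreath[OF \<phi>[unfolded \<Gamma>] t] unfolding S E_def by (simp only:)
    qed
  qed
  show ?thesis unfolding val by (rule conjI[OF conv conjI[OF schreier impI]]) (rule abelian)
qed

end
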